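(* For a group $G$ hyperbolic relative to a system of subgroups $\{H_\lambda\}_{\lambda\in\Lambda}$, consider the following assertion $(\mathrm{F})$ about $(G,\{H_\lambda\}_{\lambda\in\Lambda})$: There is a finite set $B\subset\bigcup_{\lambda}H_\lambda\setminus\{1\}$ such that, whenever $\{K_\lambda\}_{\lambda\in\Lambda}$ is a collection of subgroups with $K_\lambda\lhd H_\lambda$ and $K_\lambda\cap B=\emptyset$ for each $\lambda\in\Lambda$, and $N$ denotes the normal closure of $\bigcup_\lambda K_\lambda$ in $G$, then (1) for each $\lambda\in\Lambda$ the natural map $\phi_\lambda\colon H_\lambda/K_\lambda\to G/N$ (induced by the inclusion $H_\lambda\subset G$) is injective, and (2) $G/N$ is hyperbolic relative to $\{\phi_\lambda(H_\lambda/K_\lambda)\}_{\lambda\in\Lambda}$. If $(\mathrm{F})$ holds for every group $G$ hyperbolic relative to a system of subgroups $\{H_\lambda\}_{\lambda\in\Lambda}$ such that $\Lambda$ is finite and $H_\lambda$ is finitely generated for each $\lambda\in\Lambda$, then $(\mathrm{F})$ holds for every group $G$ hyperbolic relative to any system of subgroups $\{H_\lambda\}_{\lambda\in\Lambda}$ (with $\Lambda$ possibly infinite and the $H_\lambda$ not necessarily finitely generated).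
   Context: Finite relative presentation: let $G$ be a group with a family of subgroups $\{H_\lambda\}_{\lambda\in\Lambda}$ (both the index set $\Lambda$ and the groups $H_\lambda$ may be infinite and the $H_\lambda$ need not be finitely generated). Let $S$ be a finite subset of $G$, let $\mathcal{F}(S)$ be the free group on $S$, and let $\mathcal{R}$ be a finite subset of $\mathcal{F}(S)*( *_{\lambda\in\Lambda}H_\lambda)$. Let $\mathcal{H}$ be the disjoint union of the $H_\lambda$, for each $\lambda$ let $\mathcal{R}_\lambda$ be the set of words in the alphabet $H_\lambda$ which represent the identity in $H_\lambda$, and let $\mathcal{R}_\Lambda=\bigcup_\lambda\mathcal{R}_\lambda$. One writes $G=\langle S,\{H_\lambda\}_{\lambda\in\Lambda}\mid\mathcal{R}\rangle$, a finite relative presentation of $G$ with respect to $\{H_\lambda\}$, if $G=\langle S\cup\mathcal{H}\mid\mathcal{R}\cup\mathcal{R}_\Lambda\rangle$ is an ordinary presentation of $G$ (generators mapping to the corresponding elements of $G$). Relative hyperbolicity: the relative area of a van Kampen diagram over $\langle S\cup\mathcal{H}\mid\mathcal{R}\cup\mathcal{R}_\Lambda\rangle$ is its number of $2$-cells labelled by elements of $\mathcal{R}$. A group $G$ with finite relative presentation $\langle S,\{H_\lambda\}\mid\mathcal{R}\rangle$ is hyperbolic relative to $\{H_\lambda\}_{\lambda\in\Lambda}$ if there is a constant $C$ so that every word $w$ of length $n$ in the alphabet $S\cup\mathcal{H}$ which represents the identity in $G$ is the boundary label of a van Kampen diagram of relative area at most $Cn$. *)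

theory Defs
  imports
    Complex_Main
    "HOL-Algebra.Generated_Groups"
    "HOL-Combinatorics.Orbits"
begin

section \<open>Words and ordinary presentations\<close>

text \<open>A word in an alphabet \<open>X\<close> is a word in the letters of \<open>X\<close> and their formal inverses;
  \<open>(x, True)\<close> stands for \<open>x\<close> and \<open>(x, False)\<close> for its formal inverse.\<close>

type_synonym 'x letter = "'x \<times> bool"
type_synonym 'x word = "'x letter list"

definition words :: "'x set \<Rightarrow> 'x word set" where
  "words X = lists (X \<times> UNIV)"

definition inv_letter :: "'x letter \<Rightarrow> 'x letter" where
  "inv_letter l = (fst l, \<not> snd l)"

definition inv_word :: "'x word \<Rightarrow> 'x word" where
  "inv_word w = rev (map inv_letter w)"

definition word_val :: "('a, 'm) monoid_scheme \<Rightarrow> ('x \<Rightarrow> 'a) \<Rightarrow> 'x word \<Rightarrow> 'a" where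
  "word_val G f w =
     foldr (\<lambda>(x, b) g. (if b then f x else inv\<^bsub>G\<^esub> (f x)) \<otimes>\<^bsub>G\<^esub> g) w \<one>\<^bsub>G\<^esub>"

text \<open>Equality in the group presented by generators \<open>X\<close> and relators \<open>Rels\<close>: the least
  congruence on words that contains the free cancellations and kills the relators.\<close>

inductive pres_eq :: "'x set \<Rightarrow> 'x word set \<Rightarrow> 'x word \<Rightarrow> 'x word \<Rightarrow> bool"
  for X Rels where
  refl: "w \<in> words X \<Longrightarrow> pres_eq X Rels w w"
| sym: "pres_eq X Rels u v \<Longrightarrow> pres_eq X Rels v u"
| trans: "pres_eq X Rels u v \<Longrightarrow> pres_eq X Rels v w \<Longrightarrow> pres_eq X Rels u w"
| mult: "pres_eq X Rels u u' \<Longrightarrow> pres_eq X Rels v v' \<Longrightarrow> pres_eq X Rels (u @ v) (u' @ v')"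
| cancel: "[l] \<in> words X \<Longrightarrow> pres_eq X Rels [l, inv_letter l] []"
| relator: "r \<in> Rels \<Longrightarrow> pres_eq X Rels r []"

text \<open>\<open>G = \<langle>X | Rels\<rangle>\<close>, the generators being mapped to \<open>G\<close> by \<open>f\<close>: evaluation of words
  induces an isomorphism from the presented group onto \<open>G\<close>.\<close>

definition is_presentation ::
  "('a, 'm) monoid_scheme \<Rightarrow> ('x \<Rightarrow> 'a) \<Rightarrow> 'x set \<Rightarrow> 'x word set \<Rightarrow> bool" where
  "is_presentation G f X Rels \<longleftrightarrow>
     group G \<and> f ` X \<subseteq> carrier G \<and> Rels \<subseteq> words X \<and>
     word_val G f ` words X = carrier G \<and>
     (\<forall>u\<in>words X. \<forall>v\<in>words X. word_val G f u = word_val G f v \<longleftrightarrow> pres_eq X Rels u v)"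


section \<open>Finite relative presentations\<close>

text \<open>The alphabet is the disjoint union of \<open>S\<close> and of all the \<open>H i\<close>: distinct peripheral
  subgroups contribute distinct letters even where they intersect in \<open>G\<close>.\<close>

type_synonym ('a, 'l) gen = "'a + 'l \<times> 'a"

definition rel_gens :: "'a set \<Rightarrow> 'l set \<Rightarrow> ('l \<Rightarrow> 'a set) \<Rightarrow> ('a, 'l) gen set" where
  "rel_gens S \<Lambda> H = S <+> Sigma \<Lambda> H"

definition gen_val :: "('a, 'l) gen \<Rightarrow> 'a" where
  "gen_val = case_sum id snd"

definition peripheral_relators ::
  "('a, 'm) monoid_scheme \<Rightarrow> 'l set \<Rightarrow> ('l \<Rightarrow> 'a set) \<Rightarrow> ('a, 'l) gen word set" where
  "peripheral_relators G \<Lambda> H =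
     (\<Union>i\<in>\<Lambda>. {w \<in> words (Inr ` ({i} \<times> H i)). word_val G gen_val w = \<one>\<^bsub>G\<^esub>})"

text \<open>Elements of the free product of the free group on \<open>S\<close> and the groups \<open>H i\<close> are given by
  their normal forms: no free cancellation between letters from \<open>S\<close>, every letter from \<open>H i\<close>
  is a non-trivial element (taken with positive sign), and no two adjacent letters come from
  the same \<open>H i\<close>.\<close>

fun nf_adjacent :: "('a, 'l) gen letter \<Rightarrow> ('a, 'l) gen letter \<Rightarrow> bool" where
  "nf_adjacent (Inl s, b) (Inl t, c) \<longleftrightarrow> \<not> (s = t \<and> b \<noteq> c)"
| "nf_adjacent (Inr p, b) (Inr q, c) \<longleftrightarrow> fst p \<noteq> fst q"
| "nf_adjacent _ _ \<longleftrightarrow> True"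

definition free_product_elements ::
  "('a, 'm) monoid_scheme \<Rightarrow> 'a set \<Rightarrow> 'l set \<Rightarrow> ('l \<Rightarrow> 'a set) \<Rightarrow> ('a, 'l) gen word set" where
  "free_product_elements G S \<Lambda> H =
     {w \<in> words (rel_gens S \<Lambda> H).
        (\<forall>i h b. (Inr (i, h), b) \<in> set w \<longrightarrow> h \<noteq> \<one>\<^bsub>G\<^esub> \<and> b) \<and> successively nf_adjacent w}"

definition finite_relative_presentation ::
  "('a, 'm) monoid_scheme \<Rightarrow> 'l set \<Rightarrow> ('l \<Rightarrow> 'a set) \<Rightarrow> 'a set \<Rightarrow> ('a, 'l) gen word set \<Rightarrow> bool"
  where
  "finite_relative_presentation G \<Lambda> H S R \<longleftrightarrow>
     finite S \<and> S \<subseteq> carrier G \<and> finite R \<and> R \<subseteq> free_product_elements G S \<Lambda> H \<and>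
     is_presentation G gen_val (rel_gens S \<Lambda> H) (R \<union> peripheral_relators G \<Lambda> H)"


section \<open>Van Kampen diagrams\<close>

text \<open>A diagram is a finite connected simply connected planar 2-complex with labelled oriented
  edges, encoded as a combinatorial map of the sphere with a distinguished outer face.
  Darts are oriented edges; \<open>opp\<close> reverses a dart, and \<open>nxt\<close> sends a dart to the following dart
  on the boundary of the face to its left. Hence edges, faces and vertices are the orbits of
  \<open>opp\<close>, \<open>nxt\<close> and \<open>nxt \<circ> opp\<close> (which rotates about the initial vertex of a dart). The face
  containing \<open>base\<close> is the outer one; the 2-cells of the complex are the other faces.
  The diagram without darts is the one that consists of a single vertex.\<close>

record 'x diagram =
  darts :: "nat set"
  opp :: "nat \<Rightarrow> nat"
  nxt :: "nat \<Rightarrow> nat"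
  lab :: "nat \<Rightarrow> 'x letter"
  base :: nat

definition orbits_on :: "(nat \<Rightarrow> nat) \<Rightarrow> nat set \<Rightarrow> nat set set" where
  "orbits_on f A = orbit f ` A"

definition planar_diagram :: "'x diagram \<Rightarrow> bool" where
  "planar_diagram D \<longleftrightarrow>
     finite (darts D) \<and>
     opp D permutes darts D \<and> (\<forall>d\<in>darts D. opp D d \<noteq> d \<and> opp D (opp D d) = d) \<and>
     nxt D permutes darts D \<and>
     (darts D \<noteq> {} \<longrightarrow>
        base D \<in> darts D \<and>
        (\<forall>d\<in>darts D. \<forall>e\<in>darts D.
           (d, e) \<in> ({(x, opp D x) |x. x \<in> darts D} \<union> {(x, nxt D x) |x. x \<in> darts D})\<^sup>*) \<and>
        \<comment> \<open>Euler characteristic 2, i.e. the surface is a sphere\<close>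
        card (orbits_on (nxt D \<circ> opp D) (darts D)) + card (orbits_on (nxt D) (darts D))
          = card (orbits_on (opp D) (darts D)) + 2)"

definition face_word :: "'x diagram \<Rightarrow> nat \<Rightarrow> 'x word" where
  "face_word D d = map (\<lambda>i. lab D ((nxt D ^^ i) d)) [0..<card (orbit (nxt D) d)]"

definition boundary_label :: "'x diagram \<Rightarrow> 'x word" where
  "boundary_label D = (if darts D = {} then [] else face_word D (base D))"

definition two_cells :: "'x diagram \<Rightarrow> nat set set" where
  "two_cells D = orbits_on (nxt D) (darts D) - {orbit (nxt D) (base D)}"

text \<open>The label of a 2-cell may be read from any starting point and in either direction.\<close>

definition labelled_by :: "'x diagram \<Rightarrow> nat set \<Rightarrow> 'x word set \<Rightarrow> bool" where
  "labelled_by D F Rels \<longleftrightarrow> (\<exists>d\<in>F. face_word D d \<in> Rels \<or> inv_word (face_word D d) \<in> Rels)"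

definition van_kampen_diagram :: "'x set \<Rightarrow> 'x word set \<Rightarrow> 'x diagram \<Rightarrow> bool" where
  "van_kampen_diagram X Rels D \<longleftrightarrow>
     planar_diagram D \<and>
     (\<forall>d\<in>darts D. [lab D d] \<in> words X \<and> lab D (opp D d) = inv_letter (lab D d)) \<and>
     (\<forall>F\<in>two_cells D. labelled_by D F Rels)"

definition relative_area :: "'x word set \<Rightarrow> 'x diagram \<Rightarrow> nat" where
  "relative_area R D = card {F \<in> two_cells D. labelled_by D F R}"


section \<open>Relative hyperbolicity\<close>

definition linear_relative_isoperimetry ::
  "('a, 'm) monoid_scheme \<Rightarrow> 'l set \<Rightarrow> ('l \<Rightarrow> 'a set) \<Rightarrow> 'a set \<Rightarrow> ('a, 'l) gen word set \<Rightarrow> bool"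
  where
  "linear_relative_isoperimetry G \<Lambda> H S R \<longleftrightarrow>
     (\<exists>C::real. \<forall>w\<in>words (rel_gens S \<Lambda> H). word_val G gen_val w = \<one>\<^bsub>G\<^esub> \<longrightarrow>
        (\<exists>D. van_kampen_diagram (rel_gens S \<Lambda> H) (R \<union> peripheral_relators G \<Lambda> H) D \<and>
             boundary_label D = w \<and> real (relative_area R D) \<le> C * real (length w)))"

definition relatively_hyperbolic ::
  "('a, 'm) monoid_scheme \<Rightarrow> 'l set \<Rightarrow> ('l \<Rightarrow> 'a set) \<Rightarrow> bool" where
  "relatively_hyperbolic G \<Lambda> H \<longleftrightarrow>
     group G \<and> (\<forall>i\<in>\<Lambda>. subgroup (H i) G) \<and>
     (\<exists>S R. finite_relative_presentation G \<Lambda> H S R \<and> linear_relative_isoperimetry G \<Lambda> H S R)"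


section \<open>Peripheral fillings\<close>

definition finitely_generated_subgroup :: "('a, 'm) monoid_scheme \<Rightarrow> 'a set \<Rightarrow> bool" where
  "finitely_generated_subgroup G U \<longleftrightarrow> (\<exists>A. finite A \<and> A \<subseteq> U \<and> generate G A = U)"

definition normal_closure :: "('a, 'm) monoid_scheme \<Rightarrow> 'a set \<Rightarrow> 'a set" where
  "normal_closure G A = \<Inter> {N. N \<lhd> G \<and> A \<subseteq> N}"

text \<open>The quotient \<open>H i / K i\<close>, and the natural map from it to \<open>G / N\<close>. The latter sends a coset
  \<open>C\<close> to \<open>N C\<close>, which is the coset \<open>N h\<close> for each \<open>h \<in> C\<close> when \<open>K i \<subseteq> N\<close>.\<close>

definition subgroup_quotient ::
  "('a, 'm) monoid_scheme \<Rightarrow> 'a set \<Rightarrow> 'a set \<Rightarrow> 'a set monoid" where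
  "subgroup_quotient G U K = G\<lparr>carrier := U\<rparr> Mod K"

definition natural_map :: "('a, 'm) monoid_scheme \<Rightarrow> 'a set \<Rightarrow> 'a set \<Rightarrow> 'a set" where
  "natural_map G N C = N <#>\<^bsub>G\<^esub> C"

lemma natural_map_coset:
  fixes G (structure)
  assumes "group G" "N \<lhd> G" "K \<subseteq> N" "subgroup K G" "h \<in> carrier G"
  shows "natural_map G N (K #>\<^bsub>G\<^esub> h) = N #>\<^bsub>G\<^esub> h"
proof -
  interpret group G by fact
  have N: "subgroup N G" by (rule normal_imp_subgroup) fact
  then have "N \<subseteq> carrier G" by (rule subgroup.subset)
  moreover have "K \<subseteq> carrier G" using assms(3) \<open>N \<subseteq> carrier G\<close> by blast
  moreover have "N <#> K = N"
  proof
    show "N <#> K \<subseteq> N"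
      using N assms(3) by (auto simp: set_mult_def intro: subgroup.m_closed)
    show "N \<subseteq> N <#> K"
    proof
      fix x assume "x \<in> N"
      then have "x = x \<otimes> \<one>" "\<one> \<in> K"
        using \<open>N \<subseteq> carrier G\<close> assms(4) by (auto intro: subgroup.one_closed)
      then show "x \<in> N <#> K" using \<open>x \<in> N\<close> unfolding set_mult_def by blast
    qed
  qed
  ultimately show ?thesis
    using assms(5) setmult_rcos_assoc[of N K h] by (simp add: natural_map_def)
qed

definition filling_property ::
  "('a, 'm) monoid_scheme \<Rightarrow> 'l set \<Rightarrow> ('l \<Rightarrow> 'a set) \<Rightarrow> bool" where
  "filling_property G \<Lambda> H \<longleftrightarrow>
     (\<exists>B. finite B \<and> B \<subseteq> (\<Union>i\<in>\<Lambda>. H i) - {\<one>\<^bsub>G\<^esub>} \<and>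
        (\<forall>K N. (\<forall>i\<in>\<Lambda>. K i \<lhd> G\<lparr>carrier := H i\<rparr> \<and> K i \<inter> B = {}) \<and>
               N = normal_closure G (\<Union>i\<in>\<Lambda>. K i) \<longrightarrow>
           (\<forall>i\<in>\<Lambda>. inj_on (natural_map G N) (carrier (subgroup_quotient G (H i) (K i)))) \<and>
           relatively_hyperbolic (G Mod N) \<Lambda>
             (\<lambda>i. natural_map G N ` carrier (subgroup_quotient G (H i) (K i)))))"

text \<open>For a finite system of finitely generated subgroups it is enough to consider groups on
  subsets of \<open>nat\<close> and indices in \<open>nat\<close>: by the relative presentation such a group is generated
  by the finite set \<open>S\<close> together with finitely many finitely generated subgroups, so it is
  countable. Hence quantification over the groups on \<open>nat\<close> covers every isomorphism type, whereas
  no single type carries all the groups with arbitrary peripheral systems.\<close>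

end

theory Submission
  imports Defs "HOL-Algebra.Weak_Morphisms" "HOL-Library.Countable_Set"
begin

text \<open>Let \<open>G\<close> be given by a finite relative presentation with generators \<open>S\<close> and relators \<open>R\<close>. Only
  finitely many elements of the peripheral subgroups occur in \<open>R\<close>. Let \<open>A i\<close> be the finite set of those
  that occur with index \<open>i\<close>, let \<open>core i\<close> be the subgroup of \<open>H i\<close> that it generates, and let \<open>\<Gamma>\<close> be
  the subgroup of \<open>G\<close> generated by \<open>S\<close> and all the \<open>A i\<close>. Morally \<open>G\<close> is the amalgam of \<open>\<Gamma>\<close> with the
  groups \<open>H i\<close> along the subgroups \<open>core i\<close>, which are trivial for all but finitely many \<open>i\<close>. The proof
  transfers assertion (F) from \<open>\<Gamma>\<close> to \<open>G\<close> through this decomposition, in two steps.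

  First, \<open>\<Gamma>\<close> is hyperbolic relative to the \<open>core i\<close> (theorem \<open>core_relatively_hyperbolic\<close>). A trivial
  word of \<open>\<Gamma>\<close> bounds a small diagram over \<open>G\<close>, whose vertices carry elements of \<open>G\<close>. Choose for every
  \<open>i\<close> a map \<open>\<tau>\<close> from \<open>G\<close> to \<open>core i\<close> that commutes with right multiplication by \<open>core i\<close>, and replace
  the label of each peripheral edge from \<open>g\<close> to \<open>g h\<close> by \<open>inv (\<tau> g) \<otimes> \<tau> (g \<otimes> h)\<close>. Labels in \<open>core i\<close> do not change,
  so neither do the boundary and the cells labelled by \<open>R\<close>, while a peripheral cell stays peripheral
  because the new labels telescope. Hence the same diagram proves the inequality for \<open>\<Gamma>\<close>. The group \<open>\<Gamma>\<close>
  is countable and so has a copy on the natural numbers, where (F) is assumed; this yields a finite set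
  \<open>B\<close>, which also serves for \<open>G\<close>.

  Second, let \<open>K i\<close> be normal in \<open>H i\<close> and disjoint from \<open>B\<close>. Filling \<open>\<Gamma>\<close> along the groups
  \<open>K i \<inter> core i\<close> gives a relatively hyperbolic quotient \<open>Q0\<close> in which the groups
  \<open>core i / (K i \<inter> core i)\<close> embed. The amalgam of \<open>Q0\<close> with the groups \<open>H i / K i\<close> along them is
  realised by permutations of the set of normal forms (locale \<open>amalgam\<close>), on which \<open>Q0\<close> and every
  \<open>H i / K i\<close> act faithfully. The presentation turns this into an action of \<open>G\<close> in which the normal closure
  \<open>N\<close> of the \<open>K i\<close> acts trivially. So \<open>H i / K i\<close> and \<open>Q0\<close> embed into \<open>G / N\<close>, and a word that is
  trivial in \<open>G / N\<close> fixes the empty normal form. By \<open>fixed_word_reducible\<close> such a word either lies in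
  the alphabet of \<open>Q0\<close> or contains two letters of some \<open>H i / K i\<close> separated by a word \<open>u\<close> of \<open>Q0\<close>
  whose value lies in the amalgamated subgroup. Merging these letters and \<open>u\<close> into one letter shortens
  the word by \<open>|u| + 1\<close> and costs at most \<open>C (|u| + 1)\<close> in \<open>Q0\<close>, so the isoperimetric constant of \<open>Q0\<close>
  is a constant for \<open>G / N\<close> as well (theorem \<open>quotient_relatively_hyperbolic\<close>).

  Both steps are about words and not about surfaces. They rest on a combinatorial form of van Kampen's
  lemma: a word bounds a diagram of relative area at most \<open>k\<close> iff it is generated at cost at most \<open>k\<close>
  by a grammar that peels off one boundary edge at a time (\<open>fills_of_diagram\<close>, \<open>diagram_of_fills\<close>). One
  direction uses the inequality \<open>V + F \<le> E + 2 c\<close> for maps with \<open>c\<close> components, proved by detaching darts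
  one after the other.\<close>

section \<open>Words\<close>

lemma inv_letter_inv_letter [simp]: "inv_letter (inv_letter l) = l"
  by (simp add: inv_letter_def)

lemma fst_inv_letter [simp]: "fst (inv_letter l) = fst l"
  by (simp add: inv_letter_def)

lemma inv_word_Nil [simp]: "inv_word [] = []"
  by (simp add: inv_word_def)

lemma inv_word_Cons [simp]: "inv_word (l # w) = inv_word w @ [inv_letter l]"
  by (simp add: inv_word_def)

lemma inv_word_append [simp]: "inv_word (u @ v) = inv_word v @ inv_word u"
  by (simp add: inv_word_def)

lemma inv_word_inv_word [simp]: "inv_word (inv_word w) = w"
  by (induction w) auto

lemma words_Nil [simp]: "[] \<in> words X"
  by (simp add: words_def)

lemma words_Cons [simp]: "l # w \<in> words X \<longleftrightarrow> fst l \<in> X \<and> w \<in> words X"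
  by (cases l) (auto simp: words_def)

lemma words_append [simp]: "u @ v \<in> words X \<longleftrightarrow> u \<in> words X \<and> v \<in> words X"
  by (induction u) auto

lemma words_inv_word [simp]: "inv_word w \<in> words X \<longleftrightarrow> w \<in> words X"
  by (induction w) auto

lemma words_iff: "w \<in> words X \<longleftrightarrow> fst ` set w \<subseteq> X"
  by (induction w) auto

section \<open>Boundary words of disc diagrams\<close>

text \<open>The words that bound disc diagrams with \<open>n\<close> edges and cells of total cost \<open>k\<close>, where \<open>T t c\<close>
  means that \<open>t\<close> may label a cell of cost \<open>c\<close>. The rules remove the first boundary edge \<open>e\<close>. In the rule
  \<open>spur\<close> its other side lies on the boundary too, and the diagram falls apart; in the rule \<open>cell\<close> its
  other side lies on a cell, which opens up and exposes the rest \<open>q\<close> of its boundary.\<close>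
inductive disc :: "'x set \<Rightarrow> ('x word \<Rightarrow> nat \<Rightarrow> bool) \<Rightarrow> nat \<Rightarrow> nat \<Rightarrow> 'x word \<Rightarrow> bool"
  for X T where
  nil: "disc X T 0 0 []"
| spur: "disc X T m i a \<Longrightarrow> disc X T n j b \<Longrightarrow> fst e \<in> X \<Longrightarrow>
    disc X T (Suc (m + n)) (i + j) (e # a @ inv_letter e # b)"
| cell: "disc X T n k (q @ v) \<Longrightarrow> fst e \<in> X \<Longrightarrow> T (inv_letter e # q) c \<Longrightarrow>
    disc X T (Suc n) (k + c) (e # v)"

lemma disc_words: "disc X T n k w \<Longrightarrow> w \<in> words X"
  by (induction rule: disc.induct) auto

definition rotation_closed :: "('x word \<Rightarrow> nat \<Rightarrow> bool) \<Rightarrow> bool" where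
  "rotation_closed T \<longleftrightarrow> (\<forall>u v c. T (u @ v) c \<longrightarrow> T (v @ u) c)"

lemma rotation_closedD: "rotation_closed T \<Longrightarrow> T (u @ v) c \<Longrightarrow> T (v @ u) c"
  by (auto simp: rotation_closed_def)

lemma disc_append:
  assumes "disc X T m i x" and y: "disc X T n j y"
  shows "disc X T (m + n) (i + j) (x @ y)"
  using assms(1)
proof (induction rule: disc.induct)
  case nil
  then show ?case using y by simp
next
  case (spur m i a m' i' b e)
  then show ?case using disc.spur[OF spur.hyps(1) spur.IH(2) spur.hyps(3)] by (simp add: ac_simps)
next
  case (cell m i q v e c)
  then show ?case using disc.cell[of X T "m + n" "i + j" q "v @ y" e c] by (simp add: ac_simps)
qed

text \<open>Two discs are joined at a boundary vertex.\<close>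
lemma disc_insert:
  assumes "disc X T n k w" "w = u @ v" and x: "disc X T m j x"
  shows "disc X T (n + m) (k + j) (u @ x @ v)"
  using assms(1,2)
proof (induction arbitrary: u v rule: disc.induct)
  case nil
  then show ?case using x by simp
next
  case (spur p i a p' i' b e)
  have D: "disc X T (Suc (p + p')) (i + i') (e # a @ inv_letter e # b)"
    by (rule disc.spur) (use spur in auto)
  show ?case
  proof (cases u)
    case Nil
    then show ?thesis using disc_append[OF x D] spur.prems by (simp add: ac_simps)
  next
    case (Cons f u')
    with spur.prems have f: "f = e" and eq: "a @ inv_letter e # b = u' @ v" by auto
    from eq consider (A) v1 where "a = u' @ v1" "v = v1 @ inv_letter e # b"
      | (B) us where "u' = a @ inv_letter e # us" "b = us @ v"
      by (auto simp: append_eq_append_conv2 Cons_eq_append_conv)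
    then show ?thesis
    proof cases
      case A
      from disc.spur[OF spur.IH(1)[OF A(1)] spur.hyps(2,3)] show ?thesis
        using A Cons f by (simp add: ac_simps)
    next
      case B
      from disc.spur[OF spur.hyps(1) spur.IH(2)[OF B(2)] spur.hyps(3)] show ?thesis
        using B Cons f by (simp add: ac_simps)
    qed
  qed
next
  case (cell p i q v0 e c)
  have D: "disc X T (Suc p) (i + c) (e # v0)"
    by (rule disc.cell) (use cell in auto)
  show ?case
  proof (cases u)
    case Nil
    then show ?thesis using disc_append[OF x D] cell.prems by (simp add: ac_simps)
  next
    case (Cons f u')
    with cell.prems have "f = e" "v0 = u' @ v" by auto
    with cell.IH[of "q @ u'" v] show ?thesis
      using disc.cell[of X T "p + m" "i + j" q "u' @ x @ v" e c] cell Cons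
      by (simp add: ac_simps)
  qed
qed

text \<open>The base point of a disc may be moved along its boundary, although every rule starts at the base
  point. To move it back over the last edge \<open>e\<close>, remove the first edge \<open>f\<close>, rotate what remains by
  induction so that \<open>e\<close> comes first, remove \<open>e\<close> as well, and restore the two edges in the opposite
  order. The induction is on the number of edges, which is the reason for recording it.\<close>
lemma disc_rotate:
  assumes T: "rotation_closed T"
  shows "disc X T n k (u @ v) \<Longrightarrow> disc X T n k (v @ u)"
proof (induction n arbitrary: k u v rule: less_induct)
  case (less n)
  have one: "disc X T n k (e # u)" if D: "disc X T n k (u @ [e])" for e u k
  proof (cases u)
    case Nil
    then show ?thesis using D by simp
  next
    case (Cons f w)
    have e: "fst e \<in> X" using disc_words[OF D] by simp
    have f: "fst f \<in> X" using disc_words[OF D] Cons by simp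
    from D Cons have "disc X T n k (f # w @ [e])" by simp
    then show ?thesis
    proof (cases rule: disc.cases)
      case (spur p i a p' i' b)
      have eq: "a @ inv_letter f # b = w @ [e]" using spur by auto
      show ?thesis
      proof (cases b rule: rev_cases)
        case Nil
        with eq have ew: "e = inv_letter f" "w = a" by auto
        have "disc X T (Suc (p' + p)) (i' + i) (e # [] @ inv_letter e # a)"
          by (rule disc.spur) (use spur Nil e in auto)
        then show ?thesis using ew spur Cons by (simp add: ac_simps)
      next
        case (snoc b' g)
        with eq have g: "g = e" and w: "w = a @ inv_letter f # b'"
          by (auto simp: append_eq_append_conv2 append_eq_Cons_conv Cons_eq_append_conv)
        have "p' < n" using spur by simp
        from less.IH[OF this, of i' b' "[e]"] spur snoc g have "disc X T p' i' (e # b')" by simp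
        moreover have "disc X T (Suc (p + 0)) (i + 0) (f # a @ inv_letter f # [])"
          by (rule disc.spur) (use spur f disc.nil in auto)
        ultimately have "disc X T (p' + Suc (p + 0)) (i' + (i + 0)) ([e] @ (f # a @ inv_letter f # []) @ b')"
          by (intro disc_insert[where w = "e # b'"]) auto
        then show ?thesis using w spur Cons by (simp add: ac_simps)
      qed
    next
      case (cell m k0 q c)
      have mn: "m < n" using cell by simp
      from less.IH[OF mn, of k0 "q @ w" "[e]"] cell have "disc X T m k0 (e # q @ w)" by simp
      then show ?thesis
      proof (cases rule: disc.cases)
        case (spur p i a p' i' b)
        have eq: "a @ inv_letter e # b = q @ w" using spur by auto
        then consider (A) w1 where "a = q @ w1" "w = w1 @ inv_letter e # b"
          | (B) q2 where "q = a @ inv_letter e # q2" "b = q2 @ w"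
          by (auto simp: append_eq_append_conv2 Cons_eq_append_conv)
        then show ?thesis
        proof cases
          case A
          have "disc X T (Suc p) (i + c) (f # w1)"
            by (rule disc.cell[of _ _ _ _ q]) (use spur cell A f in auto)
          from disc.spur[OF this spur(5) e] show ?thesis
            using A cell spur Cons by (simp add: ac_simps)
        next
          case B
          \<comment> \<open>The cell at \<open>f\<close> has \<open>e\<close> on its boundary as well. Then \<open>a\<close> bounds a disc inside that cell;
             it is moved to the other side of the new cell behind \<open>e\<close>, where \<open>f\<close> becomes a spur.\<close>
          have "disc X T (Suc (p + 0)) (i + 0) (inv_letter f # a @ inv_letter (inv_letter f) # [])"
            by (rule disc.spur) (use spur f disc.nil in auto)
          then have "disc X T (p' + Suc (p + 0)) (i' + (i + 0))
              (q2 @ (inv_letter f # a @ inv_letter (inv_letter f) # []) @ w)"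
            by (intro disc_insert[where w = b]) (use spur B in auto)
          then have *: "disc X T m k0 ((q2 @ inv_letter f # a) @ f # w)"
            using spur by (simp add: ac_simps)
          have "T (inv_letter e # q2 @ inv_letter f # a) c"
            using rotation_closedD[OF T, of "inv_letter f # a" "inv_letter e # q2" c] cell B by simp
          from disc.cell[OF * e this] show ?thesis using cell Cons by simp
        qed
      next
        case c2: (cell m' k1 p c')
        have "m' < n" using c2 mn by simp
        from less.IH[OF this, of k1 p "q @ w"] c2 have "disc X T m' k1 (q @ w @ p)" by simp
        from disc.cell[OF this f] cell have "disc X T (Suc m') (k1 + c) (f # w @ p)" by simp
        with less.IH[OF mn, of "k1 + c" "f # w" p] c2
        have "disc X T (Suc m') (k1 + c) (p @ f # w)" by simp
        from disc.cell[OF this e] c2 show ?thesis using cell Cons by (simp add: ac_simps)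
      qed
    qed
  qed
  show ?case using less.prems
  proof (induction v arbitrary: u rule: rev_induct)
    case Nil
    then show ?case by simp
  next
    case (snoc e v)
    from one[where u = "u @ v" and e = e] snoc.prems have "disc X T n k ((e # u) @ v)" by simp
    from snoc.IH[OF this] show ?case by simp
  qed
qed

text \<open>The number of edges serves as an induction measure only, and for the cost an upper bound is enough.\<close>

definition fills :: "'x set \<Rightarrow> ('x word \<Rightarrow> nat \<Rightarrow> bool) \<Rightarrow> nat \<Rightarrow> 'x word \<Rightarrow> bool" where
  "fills X T k w \<longleftrightarrow> (\<exists>n k'. k' \<le> k \<and> disc X T n k' w)"

lemma fillsI: "disc X T n k w \<Longrightarrow> fills X T k w"
  by (auto simp: fills_def)

lemma fills_mono: "fills X T k w \<Longrightarrow> k \<le> l \<Longrightarrow> fills X T l w"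
  by (auto simp: fills_def) (meson le_trans)

lemma fills_Nil: "fills X T k []"
  unfolding fills_def using disc.nil by blast

lemma fills_insert:
  "fills X T k (u @ v) \<Longrightarrow> fills X T j x \<Longrightarrow> fills X T (k + j) (u @ x @ v)"
  unfolding fills_def by (metis add_mono disc_insert)

lemma fills_append: "fills X T k u \<Longrightarrow> fills X T j v \<Longrightarrow> fills X T (k + j) (u @ v)"
  using fills_insert[of X T k u "[]" j v] by simp

lemma fills_rotate: "rotation_closed T \<Longrightarrow> fills X T k (u @ v) \<Longrightarrow> fills X T k (v @ u)"
  unfolding fills_def by (metis disc_rotate)

lemma fills_spur:
  "fills X T i a \<Longrightarrow> fills X T j b \<Longrightarrow> fst e \<in> X \<Longrightarrow> fills X T (i + j) (e # a @ inv_letter e # b)"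
  unfolding fills_def by (metis add_mono disc.spur)

lemma fills_cell:
  "fills X T k (q @ v) \<Longrightarrow> fst e \<in> X \<Longrightarrow> T (inv_letter e # q) c \<Longrightarrow> fills X T (k + c) (e # v)"
  unfolding fills_def by (metis add_le_mono1 disc.cell)

text \<open>A hole whose boundary is a cell label can be closed by a cell. The two ends of the subpath \<open>r\<close>
  may be the same vertex, and then gluing a cell along \<open>r\<close> would enclose a sphere. The induction
  avoids this: it builds the part of the disc along \<open>v\<close> anew, and the cell enters at the first
  edge of \<open>v\<close> that reappears, with opposite orientation, in \<open>r\<close>; everything that \<open>r\<close> would
  cut off is dropped.\<close>
lemma fills_close_end:
  assumes T: "rotation_closed T" and "disc X T n k w" "w = v @ r" "T r c"
  shows "fills X T (k + c) v"
  using assms(2-4)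
proof (induction arbitrary: v rule: disc.induct)
  case nil
  then show ?case by (simp add: fills_Nil)
next
  case (spur m i a n j b g)
  show ?case
  proof (cases v)
    case Nil
    then show ?thesis by (simp add: fills_Nil)
  next
    case (Cons g' v')
    with spur.prems have g: "g' = g" and eq: "a @ inv_letter g # b = v' @ r" by auto
    from eq consider (A) x where "a = v' @ x" "r = x @ inv_letter g # b"
      | (B) us where "v' = a @ inv_letter g # us" "b = us @ r"
      by (auto simp: append_eq_append_conv2 Cons_eq_append_conv)
    then show ?thesis
    proof cases
      case A
      have "fills X T i (x @ v')"
        using fillsI[OF spur.hyps(1)] A fills_rotate[OF T] by simp
      then have "fills X T (j + i) ((b @ x) @ v')"
        using fills_append[OF fillsI[OF spur.hyps(2)]] by simp
      moreover have "T (inv_letter g # b @ x) c"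
        using rotation_closedD[OF T, of x "inv_letter g # b"] A spur.prems by simp
      ultimately have "fills X T (j + i + c) (g # v')"
        using spur.hyps(3) by (intro fills_cell[where q = "b @ x"]) auto
      then show ?thesis using Cons g by (simp add: ac_simps)
    next
      case B
      from fills_spur[OF fillsI[OF spur.hyps(1)] spur.IH(2)[OF B(2) spur.prems(2)] spur.hyps(3)]
      show ?thesis using B Cons g by (simp add: ac_simps)
    qed
  qed
next
  case (cell n k q v0 g d)
  show ?case
  proof (cases v)
    case Nil
    then show ?thesis by (simp add: fills_Nil)
  next
    case (Cons g' v')
    with cell.prems have g: "g' = g" "v0 = v' @ r" by auto
    from cell.IH[of "q @ v'"] g cell.prems have "fills X T (k + c) (q @ v')" by simp
    from fills_cell[OF this cell.hyps(2,3)] show ?thesis using Cons g by (simp add: ac_simps)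
  qed
qed

lemma fills_close:
  assumes T: "rotation_closed T" and F: "fills X T k (u @ r @ v)" and r: "T r c"
  shows "fills X T (k + c) (u @ v)"
proof -
  from fills_rotate[OF T, of X k "u @ r" v] F have "fills X T k ((v @ u) @ r)" by simp
  then obtain n k' where k': "k' \<le> k" "disc X T n k' ((v @ u) @ r)" unfolding fills_def by blast
  with fills_close_end[OF T k'(2) HOL.refl r] have "fills X T (k + c) (v @ u)"
    using fills_mono by fastforce
  then show ?thesis by (rule fills_rotate[OF T])
qed

lemma fills_cancel_free: "w \<in> words X \<Longrightarrow> fills X T 0 (w @ inv_word w)"
proof (induction w)
  case Nil
  then show ?case by (simp add: fills_Nil)
next
  case (Cons l w)
  then show ?case using fills_spur[of X T 0 "w @ inv_word w" 0 "[]" l] by (simp add: fills_Nil)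
qed

text \<open>Close the inner side of the free circle \<open>r @ inv_word r\<close>.\<close>
lemma fills_relator:
  assumes T: "T (inv_word r) c" and rot: "rotation_closed T" and r: "r \<in> words X"
  shows "fills X T c r"
  using fills_close[OF rot, of X 0 r "inv_word r" "[]" c] fills_cancel_free[OF r] T by simp

text \<open>Discs may be relabelled edge by edge, where the new label depends on a state that is carried along
  the edges. Think of the state as a position at a vertex: the condition \<open>face\<close> says that positions
  are consistent around every cell, hence around the disc. An edge may also be contracted, which is the case
  \<open>\<phi> g l = []\<close>; a cell that loses its edge at the boundary is then closed up.\<close>
lemma disc_transport:
  fixes step :: "'s \<Rightarrow> 'x letter \<Rightarrow> 's" and \<phi> :: "'s \<Rightarrow> 'x letter \<Rightarrow> 'y word"
    and relabel :: "'s \<Rightarrow> 'x word \<Rightarrow> 'y word"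
  assumes rot: "rotation_closed T0"
    and empty: "\<And>g. relabel g [] = []"
    and cons: "\<And>g l w. relabel g (l # w) = \<phi> g l @ relabel (step g l) w"
    and inv1: "\<And>g l. g \<in> A \<Longrightarrow> fst l \<in> X \<Longrightarrow> step g l \<in> A \<and> step (step g l) (inv_letter l) = g"
    and inv2: "\<And>g l. g \<in> A \<Longrightarrow> fst l \<in> X \<Longrightarrow> \<phi> (step g l) (inv_letter l) = inv_word (\<phi> g l)"
    and len: "\<And>g l. g \<in> A \<Longrightarrow> fst l \<in> X \<Longrightarrow> length (\<phi> g l) \<le> 1 \<and> \<phi> g l \<in> words Y"
    and face: "\<And>g t c. g \<in> A \<Longrightarrow> t \<in> words X \<Longrightarrow> T t c \<Longrightarrow>
      foldl step g t = g \<and> (relabel g t = [] \<or> T0 (relabel g t) c)"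
  shows "disc X T n k w \<Longrightarrow> g \<in> A \<Longrightarrow> foldl step g w = g \<and> fills Y T0 k (relabel g w)"
proof -
  have app: "relabel g (u @ v) = relabel g u @ relabel (foldl step g u) v" for g u v
    by (induction u arbitrary: g) (auto simp: empty cons)
  show "disc X T n k w \<Longrightarrow> g \<in> A \<Longrightarrow> foldl step g w = g \<and> fills Y T0 k (relabel g w)"
  proof (induction arbitrary: g rule: disc.induct)
    case nil
    then show ?case by (simp add: empty fills_Nil)
  next
    case (spur m i a n j b e)
    let ?h = "step g e"
    have h: "?h \<in> A" "step ?h (inv_letter e) = g" using inv1 spur by auto
    have a: "foldl step ?h a = ?h" "fills Y T0 i (relabel ?h a)" using spur.IH(1)[OF h(1)] by auto
    have b: "foldl step g b = g" "fills Y T0 j (relabel g b)" using spur.IH(2)[OF spur.prems] by auto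
    have eq: "relabel g (e # a @ inv_letter e # b) = \<phi> g e @ relabel ?h a @ inv_word (\<phi> g e) @ relabel g b"
      using h a inv2[OF spur.prems spur.hyps(3)] by (simp add: cons app)
    have "fills Y T0 (i + j) (\<phi> g e @ relabel ?h a @ inv_word (\<phi> g e) @ relabel g b)"
    proof (cases "\<phi> g e")
      case Nil
      then show ?thesis using fills_append a b by simp
    next
      case (Cons f r)
      with len[OF spur.prems spur.hyps(3)] have "r = []" "fst f \<in> Y" by auto
      then show ?thesis using fills_spur[OF a(2) b(2), of f] Cons by simp
    qed
    then show ?case using eq h a b by simp
  next
    case (cell n k q v e c)
    let ?h = "step g e"
    have h: "?h \<in> A" "step ?h (inv_letter e) = g" using inv1 cell by auto
    have qw: "q \<in> words X" using disc_words[OF cell.hyps(1)] by simp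
    have F: "foldl step ?h (inv_letter e # q) = ?h"
        "relabel ?h (inv_letter e # q) = [] \<or> T0 (relabel ?h (inv_letter e # q)) c"
      using face[OF h(1) _ cell.hyps(3)] qw cell.hyps(2) by auto
    have gq: "foldl step g q = ?h" using F h by simp
    have IH: "foldl step g (q @ v) = g" "fills Y T0 k (relabel g (q @ v))" using cell.IH[OF cell.prems] by auto
    have hv: "foldl step ?h v = g" using IH gq by simp
    have "fills Y T0 k (relabel g q @ relabel ?h v)" using IH gq by (simp add: app)
    moreover have ph: "relabel ?h (inv_letter e # q) = inv_word (\<phi> g e) @ relabel g q"
      using h inv2[OF cell.prems cell.hyps(2)] by (simp add: cons)
    ultimately have "fills Y T0 (k + c) (\<phi> g e @ relabel ?h v)"
    proof (cases "\<phi> g e")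
      case Nil
      have "relabel g q = [] \<or> T0 (relabel g q) c" using F(2) ph Nil by simp
      then show ?thesis
        using \<open>fills Y T0 k (relabel g q @ relabel ?h v)\<close> fills_close[OF rot, of Y k "[]" "relabel g q" "relabel ?h v" c] Nil
          fills_mono[of Y T0 k _ "k + c"] by auto
    next
      case (Cons f r)
      with len[OF cell.prems cell.hyps(2)] have r: "r = []" "fst f \<in> Y" by auto
      with F(2) ph Cons have "T0 (inv_letter f # relabel g q) c" by simp
      from fills_cell[OF \<open>fills Y T0 k (relabel g q @ relabel ?h v)\<close> r(2) this] show ?thesis
        using Cons r by simp
    qed
    then show ?case using hv by (simp add: cons)
  qed
qed

section \<open>Cycles of permutations\<close>
definition is_cycle :: "('d \<Rightarrow> 'd) \<Rightarrow> 'd list \<Rightarrow> bool" where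
  "is_cycle f xs \<longleftrightarrow> xs \<noteq> [] \<and> distinct xs \<and> map f xs = rotate1 xs"

text \<open>The orbit of \<open>d\<close> in the order in which \<open>face_word\<close> reads a face.\<close>
definition cycle_from :: "('d \<Rightarrow> 'd) \<Rightarrow> 'd \<Rightarrow> 'd list" where
  "cycle_from f d = map (\<lambda>i. (f ^^ i) d) [0..<card (orbit f d)]"

lemma is_cycle_Cons: "is_cycle f (x # p) \<longleftrightarrow> distinct (x # p) \<and> f x # map f p = p @ [x]"
  by (auto simp: is_cycle_def)

lemma is_cycle_rotate: "is_cycle f (u @ v) \<Longrightarrow> is_cycle f (v @ u)"
proof -
  have r1: "is_cycle f (rotate1 xs)" if "is_cycle f xs" for xs
    using that unfolding is_cycle_def by (metis distinct1_rotate rotate1_is_Nil_conv rotate1_map)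
  have "is_cycle f (rotate n xs)" if "is_cycle f xs" for xs n
    using that by (induction n) (auto intro: r1)
  then show "is_cycle f (u @ v) \<Longrightarrow> is_cycle f (v @ u)"
    by (metis List.rotate_append)
qed

lemma is_cycle_orbit:
  assumes c: "is_cycle f xs"
  shows "cycle_from f (hd xs) = xs" and "d \<in> set xs \<Longrightarrow> orbit f d = set xs"
proof -
  have ne: "xs \<noteq> []" and dist: "distinct xs" and m: "map f xs = rotate1 xs"
    using c by (auto simp: is_cycle_def)
  have step: "f (xs ! i) = xs ! (Suc i mod length xs)" if "i < length xs" for i
    using that arg_cong[OF m, of "\<lambda>l. l ! i"] by (simp add: nth_rotate1)
  have pow: "(f ^^ i) (hd xs) = xs ! (i mod length xs)" for i
  proof (induction i)
    case 0
    then show ?case using ne by (simp add: hd_conv_nth)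
  next
    case (Suc i)
    then show ?case using step[of "i mod length xs"] ne by (simp add: mod_Suc_eq)
  qed
  have "orbit f (hd xs) = {(f ^^ m) (hd xs) |m. m < length xs}"
    by (rule orbit_altdef_bounded) (use pow[of "length xs"] pow[of 0] ne in \<open>auto simp: hd_conv_nth\<close>)
  also have "\<dots> = set xs" by (auto simp: pow in_set_conv_nth) (metis mod_less)
  finally have o: "orbit f (hd xs) = set xs" .
  then have "card (orbit f (hd xs)) = length xs" using dist by (simp add: distinct_card)
  then show "cycle_from f (hd xs) = xs"
    unfolding cycle_from_def by (intro nth_equalityI) (auto simp: pow)
  have "cyclic_on f (set xs)"
    unfolding cyclic_on_def using o ne by (metis hd_in_set)
  then show "d \<in> set xs \<Longrightarrow> orbit f d = set xs" by (rule orbit_cyclic_eq3)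
qed

lemma is_cycle_cycle_from:
  assumes p: "f permutes D" "finite D"
  shows "is_cycle f (cycle_from f d)" "hd (cycle_from f d) = d"
    "set (cycle_from f d) = orbit f d" "cycle_from f d \<noteq> []"
proof -
  have perm: "permutation f" using p permutation_permutes by blast
  then have self: "d \<in> orbit f d" by (rule permutation_self_in_orbit)
  define n where "n = (LEAST n. 0 < n \<and> (f ^^ n) d = d)"
  have "\<exists>n. 0 < n \<and> (f ^^ n) d = d" using self by (auto simp: orbit_altdef)
  then have n: "0 < n" "(f ^^ n) d = d" unfolding n_def by (metis (mono_tags, lifting) LeastI)+
  have least: "(f ^^ m) d \<noteq> d" if "0 < m" "m < n" for m
    using that not_less_Least unfolding n_def by blast
  have inj: "inj_on (\<lambda>k. (f ^^ k) d) {0..<n}"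
  proof -
    have "False" if "i < j" "j < n" "(f ^^ i) d = (f ^^ j) d" for i j
    proof -
      have "(f ^^ i) ((f ^^ (j - i)) d) = (f ^^ i) d"
        using that by (simp flip: funpow_add comp_apply[of "f ^^ i"])
      moreover have "inj (f ^^ i)" using perm by (simp add: permutation_bijective bij_is_inj inj_fn)
      ultimately have "(f ^^ (j - i)) d = d" by (simp add: inj_eq)
      then show False using least[of "j - i"] that by simp
    qed
    then show ?thesis by (intro inj_onI) (metis atLeastLessThan_iff linorder_neqE_nat)
  qed
  have o: "orbit f d = {(f ^^ m) d |m. m < n}" by (rule orbit_altdef_bounded) (use n in auto)
  also have "\<dots> = (\<lambda>k. (f ^^ k) d) ` {0..<n}" by auto
  finally have o: "orbit f d = (\<lambda>k. (f ^^ k) d) ` {0..<n}" .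
  then have card: "card (orbit f d) = n" using inj by (simp add: card_image)
  let ?c = "map (\<lambda>i. (f ^^ i) d) [0..<n]"
  have c: "cycle_from f d = ?c" by (simp add: cycle_from_def card)
  show "cycle_from f d \<noteq> []" "set (cycle_from f d) = orbit f d" using n o c by auto
  show "hd (cycle_from f d) = d" using n unfolding c by (simp add: hd_map)
  have "map f ?c = rotate1 ?c"
  proof (rule nth_equalityI)
    fix i assume i: "i < length (map f ?c)"
    show "map f ?c ! i = rotate1 ?c ! i"
      using i n by (cases "Suc i = n") (auto simp: nth_rotate1)
  qed simp
  then show "is_cycle f (cycle_from f d)"
    unfolding c is_cycle_def using n inj by (simp add: distinct_map)
qed

text \<open>Composition with a transposition cuts a cycle in two if it contains both points, and joins the
  two cycles through them otherwise. This is the only surgery used on maps: each edge is attached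
  or detached by it.\<close>
lemma is_cycle_split:
  assumes "is_cycle f (x # p @ y # q)"
  shows "is_cycle (f \<circ> transpose x y) (x # q)" "is_cycle (f \<circ> transpose x y) (y # p)"
proof -
  let ?g = "f \<circ> transpose x y"
  have d: "distinct (x # p @ y # q)" and m: "(f x # map f p) @ (f y # map f q) = (p @ [y]) @ (q @ [x])"
    using assms by (auto simp: is_cycle_Cons)
  from m have m1: "f x # map f p = p @ [y]" and m2: "f y # map f q = q @ [x]"
    by (subst (asm) append_eq_append_conv; simp)+
  have g: "map ?g p = map f p" "map ?g q = map f q" "?g x = f y" "?g y = f x"
    using d by (auto simp: transpose_def)
  have "distinct (x # q)" "distinct (y # p)" using d by auto
  then show "is_cycle ?g (x # q)" "is_cycle ?g (y # p)"
    unfolding is_cycle_Cons g using m1 m2 by blast+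
qed

lemma is_cycle_merge:
  assumes "is_cycle f (x # q)" "is_cycle f (y # p)" "set (x # q) \<inter> set (y # p) = {}"
  shows "is_cycle (f \<circ> transpose x y) (x # p @ y # q)"
proof -
  let ?g = "f \<circ> transpose x y"
  have d: "distinct (x # p @ y # q)" using assms by (auto simp: is_cycle_Cons)
  have g: "map ?g p = map f p" "map ?g q = map f q" "?g x = f y" "?g y = f x"
    using d by (auto simp: transpose_def)
  have m: "f x # map f q = q @ [x]" "f y # map f p = p @ [y]" using assms by (auto simp: is_cycle_Cons)
  have "?g x # map ?g (p @ y # q) = (f y # map f p) @ (f x # map f q)"
    unfolding map_append list.map g by simp
  also have "\<dots> = (p @ y # q) @ [x]" unfolding m by simp
  finally show ?thesis using d unfolding is_cycle_Cons by blast
qed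

lemma cycle_from_transpose_other:
  assumes "f permutes D" "finite D" "x \<notin> orbit f d" "y \<notin> orbit f d"
  shows "cycle_from (f \<circ> transpose x y) d = cycle_from f d"
    "orbit (f \<circ> transpose x y) d = orbit f d"
proof -
  let ?g = "f \<circ> transpose x y"
  note c = is_cycle_cycle_from[OF assms(1,2), of d]
  have m: "map ?g (cycle_from f d) = map f (cycle_from f d)"
    using assms(3,4) c(3) by (intro map_cong) (auto simp: transpose_def)
  have g: "is_cycle ?g (cycle_from f d)" using c(1) unfolding is_cycle_def m .
  show "cycle_from ?g d = cycle_from f d" using is_cycle_orbit(1)[OF g] c(2) by simp
  have "d \<in> set (cycle_from f d)" using c(2,4) hd_in_set[of "cycle_from f d"] by simp
  from is_cycle_orbit(2)[OF g this] c(3) show "orbit ?g d = orbit f d" by simp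
qed

lemma self_in_orbit_permutes: "f permutes D \<Longrightarrow> finite D \<Longrightarrow> d \<in> orbit f d"
  by (rule permutation_self_in_orbit) (auto simp: permutation_permutes)

lemma orbit_disjoint:
  assumes "f permutes D" "finite D" "d \<notin> orbit f e"
  shows "orbit f d \<inter> orbit f e = {}"
proof (rule ccontr)
  assume "orbit f d \<inter> orbit f e \<noteq> {}"
  then obtain z where "z \<in> orbit f d" "z \<in> orbit f e" by auto
  then have "d \<in> orbit f z" using orbit_swap[OF self_in_orbit_permutes[OF assms(1,2)]] by simp
  from orbit_trans[OF this \<open>z \<in> orbit f e\<close>] show False using assms(3) by simp
qed

lemma orbit_eq_orbit:
  assumes "f permutes D" "finite D" "d \<in> orbit f e"
  shows "orbit f d = orbit f e"
  using is_cycle_orbit(2)[OF is_cycle_cycle_from(1)[OF assms(1,2), of e], of d]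
    is_cycle_cycle_from(3)[OF assms(1,2), of e] assms(3) by simp

lemma orbits_on_disjoint:
  assumes f: "f permutes D" "finite D" and AB: "A \<in> orbits_on f D" "B \<in> orbits_on f D" "A \<noteq> B"
  shows "A \<inter> B = {}"
proof -
  obtain d e where de: "A = orbit f d" "B = orbit f e" using AB by (auto simp: orbits_on_def)
  have "d \<notin> orbit f e" using orbit_eq_orbit[OF f, of d e] de AB(3) by blast
  then show ?thesis using orbit_disjoint[OF f] de by simp
qed

lemma permutes_transpose:
  "f permutes D \<Longrightarrow> x \<in> D \<Longrightarrow> y \<in> D \<Longrightarrow> (f \<circ> transpose x y) permutes D"
  by (intro permutes_compose permutes_swap_id)

lemma orbits_transpose_split:
  assumes f: "f permutes D" "finite D" and c: "is_cycle f (x # p @ y # q)" and x: "x \<in> D"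
  defines "g \<equiv> f \<circ> transpose x y"
  shows "orbits_on g D = (orbits_on f D - {set (x # p @ y # q)}) \<union> {set (x # q), set (y # p)}"
    and "card (orbits_on g D) = Suc (card (orbits_on f D))"
proof -
  let ?C = "set (x # p @ y # q)"
  have C: "orbit f x = ?C" using is_cycle_orbit(2)[OF c, of x] by simp
  have CD: "?C \<subseteq> D" using permutes_orbit_subset[OF f(1) x] C by simp
  note s = is_cycle_split[OF c, folded g_def]
  have out: "orbit g d = orbit f d" if "d \<in> D - ?C" for d
    unfolding g_def
  proof (rule cycle_from_transpose_other[OF f])
    have "orbit f d \<inter> orbit f x = {}" using orbit_disjoint[OF f] that C by blast
    then show "x \<notin> orbit f d" "y \<notin> orbit f d" using C by auto
  qed
  have in1: "orbit g d = set (x # q)" if "d \<in> set (x # q)" for d using is_cycle_orbit(2)[OF s(1) that] .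
  have in2: "orbit g d = set (y # p)" if "d \<in> set (y # p)" for d using is_cycle_orbit(2)[OF s(2) that] .
  have "orbits_on g D = orbit g ` (D - ?C) \<union> orbit g ` set (x # q) \<union> orbit g ` set (y # p)"
    unfolding orbits_on_def using CD by auto
  also have "orbit g ` (D - ?C) = orbit f ` (D - ?C)" using out by (rule image_cong[OF HOL.refl])
  also have "\<dots> = orbits_on f D - {?C}"
  proof
    show "orbit f ` (D - ?C) \<subseteq> orbits_on f D - {?C}"
      using self_in_orbit_permutes[OF f] by (auto simp: orbits_on_def)
    show "orbits_on f D - {?C} \<subseteq> orbit f ` (D - ?C)"
      using is_cycle_orbit(2)[OF c] by (auto simp: orbits_on_def)
  qed
  also have "orbit g ` set (x # q) = {set (x # q)}" using in1 by auto
  also have "orbit g ` set (y # p) = {set (y # p)}" using in2 by auto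
  finally show eq: "orbits_on g D = (orbits_on f D - {?C}) \<union> {set (x # q), set (y # p)}" by auto
  have dist: "distinct (x # p @ y # q)" using c by (simp add: is_cycle_def)
  have fin: "finite (orbits_on f D)" using f by (simp add: orbits_on_def)
  have CO: "?C \<in> orbits_on f D" using C x by (auto simp: orbits_on_def)
  have dis: "A \<notin> orbits_on f D - {?C}" if "z \<in> A" "z \<in> ?C" for A z
    using orbits_on_disjoint[OF f _ CO, of A] that by blast
  have n1: "set (x # q) \<notin> orbits_on f D - {?C}" by (rule dis[of x]) auto
  have n2: "set (y # p) \<notin> orbits_on f D - {?C}" by (rule dis[of y]) auto
  have n3: "set (x # q) \<noteq> set (y # p)" using dist by auto
  have "card (orbits_on g D) = card (orbits_on f D - {?C}) + 2"
    unfolding eq using n1 n2 n3 fin by simp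
  also have "\<dots> = Suc (card (orbits_on f D))"
    using card_Suc_Diff1[OF fin CO] by simp
  finally show "card (orbits_on g D) = Suc (card (orbits_on f D))" .
qed

lemma cycle_through:
  assumes "f permutes D" "finite D" "y \<in> orbit f x" "x \<noteq> y"
  obtains p q where "is_cycle f (x # p @ y # q)"
proof -
  note c = is_cycle_cycle_from[OF assms(1,2), of x]
  from c obtain zs where zs: "cycle_from f x = x # zs" by (cases "cycle_from f x") auto
  have "y \<in> set zs" using c(3) zs assms(3,4) by auto
  then obtain p q where "zs = p @ y # q" using split_list[of y zs] by blast
  then show ?thesis using that[of p q] c(1) zs by simp
qed

lemma orbits_transpose_merge:
  assumes f: "f permutes D" "finite D" and c: "is_cycle f (x # q)" "is_cycle f (y # p)"
    and dis: "y \<notin> set (x # q)" and xy: "x \<in> D" "y \<in> D"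
  defines "g \<equiv> f \<circ> transpose x y"
  shows "is_cycle g (x # p @ y # q)"
    and "orbits_on g D = (orbits_on f D - {set (x # q), set (y # p)}) \<union> {set (x # p @ y # q)}"
    and "Suc (card (orbits_on g D)) = card (orbits_on f D)"
proof -
  have o: "orbit f x = set (x # q)" "orbit f y = set (y # p)"
    using is_cycle_orbit(2)[OF c(1), of x] is_cycle_orbit(2)[OF c(2), of y] by auto
  have d: "set (x # q) \<inter> set (y # p) = {}"
    using orbit_disjoint[OF f, of y x] dis o by auto
  show m: "is_cycle g (x # p @ y # q)" unfolding g_def by (rule is_cycle_merge[OF c d])
  have g: "g permutes D" unfolding g_def by (rule permutes_transpose[OF f(1) xy])
  have gt: "g \<circ> transpose x y = f" unfolding g_def by (simp add: comp_assoc)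
  note s = orbits_transpose_split[OF g f(2) m xy(1), unfolded gt]
  show "Suc (card (orbits_on g D)) = card (orbits_on f D)" using s(2) by simp
  have O: "set (x # p @ y # q) \<in> orbits_on g D"
    using is_cycle_orbit(2)[OF m, of x] xy by (auto simp: orbits_on_def)
  have dis: "A \<notin> orbits_on g D - {set (x # p @ y # q)}" if "z \<in> A" "z \<in> set (x # p @ y # q)" for A z
    using orbits_on_disjoint[OF g f(2) _ O, of A] that by blast
  have n: "set (x # q) \<notin> orbits_on g D - {set (x # p @ y # q)}"
    "set (y # p) \<notin> orbits_on g D - {set (x # p @ y # q)}"
    by (rule dis[of x]; simp) (rule dis[of y]; simp)
  show "orbits_on g D = (orbits_on f D - {set (x # q), set (y # p)}) \<union> {set (x # p @ y # q)}"
    unfolding s(1) using O n by blast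
qed

section \<open>Euler characteristic of dart maps\<close>

text \<open>A map is given by its set \<open>D\<close> of darts, the involution \<open>a\<close> that reverses darts and the permutation \<open>n\<close>
  along faces. It need not be connected.\<close>
definition link :: "nat set \<Rightarrow> (nat \<Rightarrow> nat) \<Rightarrow> (nat \<Rightarrow> nat) \<Rightarrow> (nat \<times> nat) set" where
  "link D a n = {(x, a x) |x. x \<in> D} \<union> {(x, n x) |x. x \<in> D}"

definition conn :: "nat set \<Rightarrow> (nat \<Rightarrow> nat) \<Rightarrow> (nat \<Rightarrow> nat) \<Rightarrow> (nat \<times> nat) set" where
  "conn D a n = (link D a n)\<^sup>*"

definition comps :: "nat set \<Rightarrow> (nat \<Rightarrow> nat) \<Rightarrow> (nat \<Rightarrow> nat) \<Rightarrow> nat set set" where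
  "comps D a n = (\<lambda>x. conn D a n `` {x}) ` D"

lemma conn_refl [simp]: "(x, x) \<in> conn D a n"
  by (simp add: conn_def)

lemma conn_trans: "(x, y) \<in> conn D a n \<Longrightarrow> (y, z) \<in> conn D a n \<Longrightarrow> (x, z) \<in> conn D a n"
  unfolding conn_def by (rule rtrancl_trans)

lemma conn_step1: "x \<in> D \<Longrightarrow> (x, a x) \<in> conn D a n"
  unfolding conn_def link_def by (rule r_into_rtrancl) auto

lemma conn_step2: "x \<in> D \<Longrightarrow> (x, n x) \<in> conn D a n"
  unfolding conn_def link_def by (rule r_into_rtrancl) auto

locale dart_map =
  fixes D :: "nat set" and a n :: "nat \<Rightarrow> nat"
  assumes fin: "finite D" and a: "a permutes D" and n: "n permutes D"
    and a_inv: "d \<in> D \<Longrightarrow> a d \<noteq> d \<and> a (a d) = d"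
begin

lemma conn_in: "(x, y) \<in> conn D a n \<Longrightarrow> x \<in> D \<longleftrightarrow> y \<in> D"
  unfolding conn_def
  by (induction rule: rtrancl_induct) (auto simp: link_def permutes_in_image[OF a] permutes_in_image[OF n])

lemma orbit_conn: "x \<in> D \<Longrightarrow> y \<in> orbit n x \<Longrightarrow> (x, y) \<in> conn D a n"
proof (rotate_tac, induction rule: orbit.induct)
  case base
  then show ?case by (rule conn_step2)
next
  case (step y)
  then show ?case using conn_in conn_step2 conn_trans by metis
qed

lemma conn_sym: "(x, y) \<in> conn D a n \<Longrightarrow> (y, x) \<in> conn D a n"
proof (cases "x = y")
  case False
  assume "(x, y) \<in> conn D a n"
  then show ?thesis unfolding conn_def
  proof (induction rule: rtrancl_induct)
    case (step y z)
    then have y: "y \<in> D" by (auto simp: link_def)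
    have "(a y, y) \<in> conn D a n"
      using conn_step1[of "a y" D a n] a_inv[OF y] permutes_in_image[OF a] y by auto
    moreover have "(n y, y) \<in> conn D a n"
    proof (rule orbit_conn)
      show "n y \<in> D" using permutes_in_image[OF n] y by simp
      show "y \<in> orbit n (n y)"
        using orbit_eq_orbit[OF n fin, of "n y" y] self_in_orbit_permutes[OF n fin] orbit.base[of n y] by simp
    qed
    ultimately have "(z, y) \<in> conn D a n" using step(2) by (auto simp: link_def)
    then show ?case using step(3) unfolding conn_def by (rule rtrancl_trans)
  qed simp
qed simp

lemma conn_class_eq: "conn D a n `` {x} = conn D a n `` {y} \<longleftrightarrow> (x, y) \<in> conn D a n"
  using conn_sym conn_trans conn_refl by blast

lemma finite_comps: "finite (comps D a n)"
  using fin by (simp add: comps_def)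

end

lemma card_comps_antimono:
  assumes m1: "dart_map D a n1" and m2: "dart_map D a n2" and sub: "conn D a n1 \<subseteq> conn D a n2"
  shows "card (comps D a n2) \<le> card (comps D a n1)"
proof -
  have "comps D a n2 = (\<lambda>C. conn D a n2 `` C) ` comps D a n1"
  proof -
    have "conn D a n2 `` {x} = conn D a n2 `` (conn D a n1 `` {x})" for x
      using sub conn_trans conn_refl by blast
    then show ?thesis by (auto simp: comps_def image_image)
  qed
  then show ?thesis using card_image_le[OF dart_map.finite_comps[OF m1]] by simp
qed

lemma conn_subset_transpose:
  assumes m: "dart_map D a (n \<circ> transpose x y)" and xy: "x \<in> D" "y \<in> D"
    and c: "(x, y) \<in> conn D a (n \<circ> transpose x y)"
  shows "conn D a n \<subseteq> conn D a (n \<circ> transpose x y)"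
proof -
  let ?m = "n \<circ> transpose x y"
  have "link D a n \<subseteq> conn D a ?m"
  proof
    fix p assume "p \<in> link D a n"
    then obtain d where d: "d \<in> D" "p = (d, a d) \<or> p = (d, n d)" by (auto simp: link_def)
    have c': "(y, x) \<in> conn D a ?m" using dart_map.conn_sym[OF m] c by blast
    have s: "(x, n y) \<in> conn D a ?m" "(y, n x) \<in> conn D a ?m"
      using conn_step2[OF xy(1), of ?m a] conn_step2[OF xy(2), of ?m a] by auto
    have "(d, n d) \<in> conn D a ?m"
    proof (cases "d = x \<or> d = y")
      case True
      then show ?thesis using conn_trans[OF c s(2)] conn_trans[OF c' s(1)] by auto
    next
      case False
      then show ?thesis using conn_step2[OF d(1), of ?m a] by simp
    qed
    then show "p \<in> conn D a ?m" using d conn_step1[OF d(1)] by blast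
  qed
  then show ?thesis unfolding conn_def by (rule rtrancl_subset_rtrancl)
qed

text \<open>\<open>V + F = E + 2 c\<close>: every component of the surface is a sphere.\<close>
definition balanced :: "nat set \<Rightarrow> (nat \<Rightarrow> nat) \<Rightarrow> (nat \<Rightarrow> nat) \<Rightarrow> bool" where
  "balanced D a n \<longleftrightarrow> card (orbits_on (n \<circ> a) D) + card (orbits_on n D) =
     card (orbits_on a D) + 2 * card (comps D a n)"

text \<open>A dart \<open>e\<close> that is not alone at its initial vertex can be detached from it. Composing \<open>n\<close> with the
  transposition of the predecessor \<open>x\<close> of \<open>e\<close> and of \<open>a e\<close> splits \<open>e\<close> off its vertex, so that \<open>V\<close> grows by one,
  and \<open>F\<close> changes by one: it grows if \<open>x\<close> and \<open>a e\<close> lie on the same face and drops otherwise.\<close>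

locale detaching = dart_map +
  fixes e x :: nat
  assumes e: "e \<in> D" and x: "x \<in> D" and xe: "n x = e" and not_fixed: "n (a e) \<noteq> e"
begin

definition "m = n \<circ> transpose x (a e)"

lemma ae: "a e \<in> D" using permutes_in_image[OF a] e by simp

lemma x_ne: "x \<noteq> a e" using not_fixed xe by auto

lemma m_permutes: "m permutes D"
  unfolding m_def by (rule permutes_transpose[OF n x ae])

lemma dart_map_m: "dart_map D a m"
  using fin a m_permutes a_inv by unfold_locales auto

lemma m_ae: "m (a e) = e" by (simp add: m_def xe)

lemma m_x: "m x = n (a e)" by (simp add: m_def)

lemma m_other: "d \<noteq> x \<Longrightarrow> d \<noteq> a e \<Longrightarrow> m d = n d" by (simp add: m_def)

lemma conn_subset: "conn D a m \<subseteq> conn D a n"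
proof -
  have xe': "(x, e) \<in> conn D a n" "(e, a e) \<in> conn D a n" "(a e, e) \<in> conn D a n"
    using conn_step2[OF x] xe conn_step1[OF e] conn_sym by auto
  have "link D a m \<subseteq> conn D a n"
  proof
    fix p assume "p \<in> link D a m"
    then obtain d where d: "d \<in> D" "p = (d, a d) \<or> p = (d, m d)" by (auto simp: link_def)
    have "(d, m d) \<in> conn D a n"
    proof (cases "d = x \<or> d = a e")
      case True
      then show ?thesis using xe' conn_step2[OF ae] conn_trans m_ae m_x by metis
    next
      case False
      then show ?thesis using m_other conn_step2[OF d(1)] by metis
    qed
    then show "p \<in> conn D a n" using d conn_step1[OF d(1)] by blast
  qed
  then show ?thesis unfolding conn_def by (rule rtrancl_subset_rtrancl)
qed

lemma conn_eq_if_connected: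
  assumes c: "(x, a e) \<in> conn D a m"
  shows "conn D a m = conn D a n"
proof
  show "conn D a m \<subseteq> conn D a n" by (rule conn_subset)
  show "conn D a n \<subseteq> conn D a m"
    using conn_subset_transpose[OF dart_map_m[unfolded m_def] x ae] c by (simp add: m_def)
qed

text \<open>Only the component of \<open>e\<close> can fall apart, and only into the components of \<open>x\<close> and of \<open>a e\<close>.\<close>
lemma card_comps_le_Suc: "card (comps D a m) \<le> Suc (card (comps D a n))"
proof -
  interpret m: dart_map D a m by (rule dart_map_m)
  let ?c = "conn D a m" 
  let ?U = "?c `` {x} \<union> ?c `` {a e}"
  have key: "(d, z) \<in> ?c \<or> (d \<in> ?U \<and> z \<in> ?U)" if "(d, z) \<in> conn D a n" for d z
    using that unfolding conn_def[of D a n]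
  proof (induction rule: rtrancl_induct)
    case base
    then show ?case by simp
  next
    case (step y z)
    have y: "y \<in> D" using step by (auto simp: link_def)
    have U: "v \<in> ?U" if "u \<in> ?U" "(u, v) \<in> ?c" for u v using that conn_trans by blast
    have yz: "(y, z) \<in> ?c \<or> (y \<in> {x, a e} \<and> z \<in> ?U)"
    proof (cases "z = n y \<and> y \<in> {x, a e}")
      case True
      moreover have "n x \<in> ?U" "n (a e) \<in> ?U"
        using conn_step2[OF ae, of m a] conn_step2[OF x, of m a] m_ae m_x xe by auto
      ultimately show ?thesis by auto
    next
      case False
      then show ?thesis using step(2) m_other conn_step1[OF y] conn_step2[OF y, of m a] by (auto simp: link_def)
    qed
    from step(3) show ?case
    proof
      assume dy: "(d, y) \<in> ?c"
      from yz show ?thesis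
      proof
        assume "(y, z) \<in> ?c"
        then show ?thesis using dy conn_trans by blast
      next
        assume *: "y \<in> {x, a e} \<and> z \<in> ?U"
        have "(y, d) \<in> ?c" using dy by (rule m.conn_sym)
        then have "d \<in> ?U" using * by auto
        then show ?thesis using * by simp
      qed
    next
      assume "d \<in> ?U \<and> y \<in> ?U"
      then show ?thesis using yz U by blast
    qed
  qed
  have "comps D a m \<subseteq> (comps D a n - {conn D a n `` {x}}) \<union> {?c `` {x}, ?c `` {a e}}"
  proof
    fix C assume "C \<in> comps D a m"
    then obtain d where d: "d \<in> D" "C = ?c `` {d}" by (auto simp: comps_def)
    show "C \<in> (comps D a n - {conn D a n `` {x}}) \<union> {?c `` {x}, ?c `` {a e}}"
    proof (cases "d \<in> ?U")
      case True
      then have "C = ?c `` {x} \<or> C = ?c `` {a e}" using d m.conn_class_eq by blast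
      then show ?thesis by blast
    next
      case False
      then have "C = conn D a n `` {d}" using key conn_subset d by blast
      moreover have "(d, x) \<notin> conn D a n"
      proof
        assume "(d, x) \<in> conn D a n"
        then have "(d, x) \<in> ?c" using key False by blast
        then show False using m.conn_sym False by blast
      qed
      ultimately show ?thesis using d conn_class_eq[of d x] by (auto simp: comps_def)
    qed
  qed
  then have "card (comps D a m) \<le> card ((comps D a n - {conn D a n `` {x}}) \<union> {?c `` {x}, ?c `` {a e}})"
    by (rule card_mono[rotated]) (simp add: finite_comps)
  also have "\<dots> \<le> card (comps D a n - {conn D a n `` {x}}) + card {?c `` {x}, ?c `` {a e}}"
    by (rule card_Un_le)
  also have "\<dots> \<le> card (comps D a n - {conn D a n `` {x}}) + 2"
    by (simp add: card_insert_if)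
  also have "\<dots> = Suc (card (comps D a n))"
    using card_Suc_Diff1[OF finite_comps, of "conn D a n `` {x}"] x by (simp add: comps_def)
  finally show ?thesis .
qed

text \<open>The effect of the surgery on the vertices, which are the cycles of \<open>n \<circ> a\<close>.\<close>
lemma sigma: "m \<circ> a = (n \<circ> a) \<circ> transpose (a x) e"
proof
  fix d
  have "a d = x \<longleftrightarrow> d = a x" using a_inv[OF x] permutes_inj[OF a] by (metis injD)
  moreover have "a d = a e \<longleftrightarrow> d = e" using permutes_inj[OF a] by (metis injD)
  ultimately show "(m \<circ> a) d = ((n \<circ> a) \<circ> transpose (a x) e) d"
    using a_inv[OF x] by (auto simp: m_def transpose_def)
qed

lemma ax: "a x \<in> D" "a x \<noteq> e" "(n \<circ> a) (a x) = e"
  using permutes_in_image[OF a] x x_ne a_inv[OF x] xe by auto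

lemma card_vertices: "card (orbits_on (m \<circ> a) D) = Suc (card (orbits_on (n \<circ> a) D))"
proof -
  have s: "(n \<circ> a) permutes D" by (rule permutes_compose[OF a n])
  have "e \<in> orbit (n \<circ> a) (a x)" using orbit.base[of "n \<circ> a" "a x"] ax by simp
  then obtain p q where "is_cycle (n \<circ> a) (a x # p @ e # q)"
    using cycle_through[OF s fin] ax by metis
  from orbits_transpose_split(2)[OF s fin this ax(1)] show ?thesis by (simp add: sigma)
qed

lemma measure: "card {d \<in> D. m (a d) \<noteq> d} < card {d \<in> D. n (a d) \<noteq> d}"
proof (rule psubset_card_mono)
  show "finite {d \<in> D. n (a d) \<noteq> d}" using fin by simp
  have "n (a d) \<noteq> d" if "d \<in> D" "m (a d) \<noteq> d" for d
  proof (cases "d = a x")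
    case True
    then show ?thesis using ax by auto
  next
    case False
    then have "a d \<noteq> x" using a_inv[OF that(1)] by auto
    moreover have "a d \<noteq> a e" using that m_ae permutes_inj[OF a] by (metis injD)
    ultimately show ?thesis using that m_other by simp
  qed
  then have "{d \<in> D. m (a d) \<noteq> d} \<subseteq> {d \<in> D. n (a d) \<noteq> d}" by blast
  moreover have "e \<notin> {d \<in> D. m (a d) \<noteq> d}" "e \<in> {d \<in> D. n (a d) \<noteq> d}"
    using m_ae e not_fixed by auto
  ultimately show "{d \<in> D. m (a d) \<noteq> d} \<subset> {d \<in> D. n (a d) \<noteq> d}" by blast
qed

lemma card_faces_split:
  assumes "a e \<in> orbit n x"
  shows "card (orbits_on m D) = Suc (card (orbits_on n D))"
proof -
  obtain p q where "is_cycle n (x # p @ a e # q)" using cycle_through[OF n fin assms x_ne] by metis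
  from orbits_transpose_split(2)[OF n fin this x] show ?thesis by (simp add: m_def)
qed

lemma faces_merge:
  assumes "a e \<notin> orbit n x"
  shows "Suc (card (orbits_on m D)) = card (orbits_on n D)" "(x, a e) \<in> conn D a m"
proof -
  note cx = is_cycle_cycle_from[OF n fin, of x] and cy = is_cycle_cycle_from[OF n fin, of "a e"]
  obtain q where q: "cycle_from n x = x # q" using cx by (cases "cycle_from n x") auto
  obtain p where p: "cycle_from n (a e) = a e # p" using cy by (cases "cycle_from n (a e)") auto
  note mg = orbits_transpose_merge[OF n fin cx(1)[unfolded q] cy(1)[unfolded p] _ x ae, folded m_def]
  have ni: "a e \<notin> set (x # q)" using assms cx(3) q by simp
  show "Suc (card (orbits_on m D)) = card (orbits_on n D)" using mg(3)[OF ni] .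
  have "a e \<in> orbit m x" using is_cycle_orbit(2)[OF mg(1)[OF ni], of x] by simp
  then show "(x, a e) \<in> conn D a m" by (rule dart_map.orbit_conn[OF dart_map_m x])
qed

end

text \<open>Detach darts until each of them is alone at its vertex; then every component is a single edge and
  equality holds. If a detachment joins two faces, then \<open>V + F\<close> and the components are unchanged. If it splits a
  face, then \<open>V + F\<close> grows by two, and \<open>2 c\<close> grows by at most two.\<close>
lemma euler_le:
  assumes "dart_map D a n"
  shows "card (orbits_on (n \<circ> a) D) + card (orbits_on n D) \<le> card (orbits_on a D) + 2 * card (comps D a n)"
  using assms
proof (induction "card {d \<in> D. n (a d) \<noteq> d}" arbitrary: n rule: less_induct)
  case (less n)
  interpret dart_map D a n by fact
  show ?case
  proof (cases "\<exists>e\<in>D. n (a e) \<noteq> e")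
    case False
    then have fixed: "n (a d) = d" if "d \<in> D" for d using that by blast
    have na: "n d = a d" for d
    proof (cases "d \<in> D")
      case True
      then show ?thesis using fixed[of "a d"] a_inv[of d] permutes_in_image[OF a] by simp
    next
      case False
      then show ?thesis using permutes_not_in[OF a] permutes_not_in[OF n] by simp
    qed
    then have "n = a" by auto
    have "card (orbits_on (n \<circ> a) D) \<le> card D"
      unfolding orbits_on_def by (rule card_image_le[OF fin])
    also have "card D \<le> (\<Sum>C\<in>comps D a n. card C)"
    proof -
      have "D \<subseteq> \<Union> (comps D a n)" by (auto simp: comps_def)
      moreover have "finite (\<Union> (comps D a n))"
        using finite_comps conn_in fin by (auto simp: comps_def intro!: finite_subset[OF _ fin])
      ultimately have "card D \<le> card (\<Union> (comps D a n))" by (rule card_mono[rotated])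
      also have "\<dots> \<le> (\<Sum>C\<in>comps D a n. card C)" by (rule card_Union_le_sum_card)
      finally show ?thesis .
    qed
    also have "\<dots> \<le> (\<Sum>C\<in>comps D a n. 2)"
    proof (rule sum_mono)
      fix C assume "C \<in> comps D a n"
      then obtain d where d: "d \<in> D" "C = conn D a n `` {d}" by (auto simp: comps_def)
      have "z \<in> {d, a d}" if "(d, z) \<in> conn D a n" for z
        using that unfolding conn_def
        by (induction rule: rtrancl_induct) (use a_inv[OF d(1)] \<open>n = a\<close> in \<open>auto simp: link_def\<close>)
      then have "C \<subseteq> {d, a d}" using d by auto
      then have "card C \<le> card {d, a d}" by (intro card_mono) auto
      also have "\<dots> \<le> 2" by (simp add: card_insert_if)
      finally show "card C \<le> 2" .
    qed
    finally show ?thesis using \<open>n = a\<close> by simp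
  next
    case True
    then obtain e where e: "e \<in> D" "n (a e) \<noteq> e" by blast
    obtain x where x: "n x = e" using permutes_surj[OF n] by (metis surjD)
    have "x \<in> D" using permutes_in_image[OF n, of x] x e by simp
    then interpret detaching D a n e x using e x by unfold_locales auto
    have IH: "card (orbits_on (m \<circ> a) D) + card (orbits_on m D) \<le> card (orbits_on a D) + 2 * card (comps D a m)"
      by (rule less.hyps[OF measure dart_map_m])
    show ?thesis
    proof (cases "a e \<in> orbit n x")
      case True
      from card_faces_split[OF this] card_vertices card_comps_le_Suc IH show ?thesis by simp
    next
      case False
      have "card (comps D a m) \<le> card (comps D a n)"
        using conn_eq_if_connected[OF faces_merge(2)[OF False]]
        by (intro card_comps_antimono[OF less.prems dart_map_m]) simp
      with faces_merge(1)[OF False] card_vertices IH show ?thesis by simp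
    qed
  qed
qed

context detaching
begin

text \<open>On a sphere a curve separates: if the detachment of \<open>e\<close> splits a face, then it must also split
  the component, for otherwise the new map would violate \<open>euler_le\<close>.\<close>
lemma balanced_m:
  assumes b: "balanced D a n"
  shows "balanced D a m" and "a e \<in> orbit n x \<Longrightarrow> (x, a e) \<notin> conn D a m"
proof -
  have le: "card (orbits_on (m \<circ> a) D) + card (orbits_on m D) \<le> card (orbits_on a D) + 2 * card (comps D a m)"
    by (rule euler_le[OF dart_map_m])
  have dm: "dart_map D a n" by (rule dart_map_axioms)
  have eq: "card (comps D a m) \<le> card (comps D a n)" if "(x, a e) \<in> conn D a m"
    using conn_eq_if_connected[OF that] by (intro card_comps_antimono[OF dm dart_map_m]) simp
  show "a e \<in> orbit n x \<Longrightarrow> (x, a e) \<notin> conn D a m"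
    using le eq card_faces_split card_vertices b by (auto simp: balanced_def)
  show "balanced D a m"
  proof (cases "a e \<in> orbit n x")
    case True
    then show ?thesis using le card_faces_split card_vertices b card_comps_le_Suc by (auto simp: balanced_def)
  next
    case False
    then show ?thesis using le faces_merge[OF False] card_vertices b eq by (auto simp: balanced_def)
  qed
qed

end

section \<open>Diagrams yield disc words\<close>
lemma is_cycle_next: "is_cycle f (u @ z # v) \<Longrightarrow> f z = hd (v @ u @ [z])"
  using is_cycle_rotate[of f u "z # v"] by (auto simp: is_cycle_Cons) (metis append.assoc list.sel(1))

lemma is_cycle_prev:
  assumes c: "is_cycle f (z # w)" and x: "x \<in> set (z # w)" "f x = z"
  shows "x = last (z # w)"
proof -
  obtain u v where uv: "z # w = u @ x # v" using split_list[OF x(1)] by blast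
  show ?thesis
  proof (cases v)
    case Nil
    then show ?thesis using uv by simp
  next
    case (Cons y v')
    have "f x = y" using is_cycle_next[of f u x v] c uv Cons by simp
    then have "z = y" using x by simp
    then show ?thesis using c uv Cons by (cases u) (auto simp: is_cycle_def)
  qed
qed

definition other_faces :: "nat set \<Rightarrow> (nat \<Rightarrow> nat) \<Rightarrow> (nat \<Rightarrow> nat) \<Rightarrow> nat \<Rightarrow> nat set set" where
  "other_faces D a n e = orbit n ` {d. (e, d) \<in> conn D a n \<and> d \<notin> orbit n e}"

lemma (in dart_map) finite_other_faces: "e \<in> D \<Longrightarrow> finite (other_faces D a n e)"
  unfolding other_faces_def
  by (rule finite_imageI, rule finite_subset[OF _ fin]) (use conn_in in auto)

lemma (in detaching) face_unchanged:
  assumes "d \<notin> orbit n x" "d \<notin> orbit n (a e)"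
  shows "cycle_from m d = cycle_from n d" "orbit m d = orbit n d"
proof -
  have "x \<notin> orbit n d" "a e \<notin> orbit n d"
    using assms orbit_swap[OF self_in_orbit_permutes[OF n fin]] by blast+
  from cycle_from_transpose_other[OF n fin this]
  show "cycle_from m d = cycle_from n d" "orbit m d = orbit n d" by (simp_all add: m_def)
qed

text \<open>On a map made of spheres, the face of any dart \<open>e\<close> is a disc word if all the other faces of its
  component are cells. The edge of \<open>e\<close> is deleted by detaching first \<open>e\<close> and then \<open>a e\<close>. If its two sides
  lie on different faces, then these merge, which is the rule \<open>cell\<close>. If they lie on the same face, then
  this face splits into two that lie on different components by \<open>balanced_m\<close>, which is the rule \<open>spur\<close>,
  and every other face belongs to one of these components only, so that the costs add up.\<close>
lemma fills_of_map:
  fixes cost :: "nat set \<Rightarrow> nat" and lab :: "nat \<Rightarrow> 'x letter"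
  assumes rot: "rotation_closed T"
    and lab: "\<And>d. d \<in> D \<Longrightarrow> fst (lab d) \<in> X \<and> lab (a d) = inv_letter (lab d)"
  shows "dart_map D a n \<Longrightarrow> balanced D a n \<Longrightarrow> e \<in> D \<Longrightarrow>
    (\<And>d. (e, d) \<in> conn D a n \<Longrightarrow> d \<notin> orbit n e \<Longrightarrow>
       T (map lab (cycle_from n d)) (cost (orbit n d))) \<Longrightarrow>
    fills X T (sum cost (other_faces D a n e)) (map lab (cycle_from n e))"
proof (induction "card {d \<in> D. n (a d) \<noteq> d}" arbitrary: n e rule: less_induct)
  case (less n)
  interpret dart_map D a n by fact
  note faces = less.prems(4)
  have e: "e \<in> D" by fact
  have ae: "a e \<in> D" "a e \<noteq> e" "a (a e) = e" using permutes_in_image[OF a] e a_inv by auto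
  \<comment> \<open>The second half of the deletion: \<open>e\<close> is already alone at its initial vertex.\<close>
  have pend: "fills X T (sum cost (other_faces D a n' e)) (map lab p)"
    if n': "dart_map D a n'" "balanced D a n'" "card {d \<in> D. n' (a d) \<noteq> d} \<le> card {d \<in> D. n (a d) \<noteq> d}"
      and c: "is_cycle n' (e # p @ [a e])"
      and T: "\<And>d. (e, d) \<in> conn D a n' \<Longrightarrow> d \<notin> set (e # p @ [a e]) \<Longrightarrow>
        T (map lab (cycle_from n' d)) (cost (orbit n' d))" for n' p
  proof (cases p rule: rev_cases)
    case Nil
    then show ?thesis by (simp add: fills_Nil)
  next
    case (snoc p' x)
    interpret n': dart_map D a n' by fact
    have oe: "orbit n' d = set (e # p @ [a e])" if "d \<in> set (e # p @ [a e])" for d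
      using is_cycle_orbit(2)[OF c that] .
    have sub: "set (e # p @ [a e]) \<subseteq> D" using permutes_orbit_subset[OF n'.n e] oe[of e] by simp
    have x: "x \<in> D" "n' x = a e" using sub snoc is_cycle_next[of n' "e # p'" x "[a e]"] c by auto
    have "n' e = hd (p @ [a e])" using is_cycle_next[of n' "[]" e "p @ [a e]"] c snoc by (auto simp: hd_append)
    moreover have "hd (p @ [a e]) \<in> set p" using snoc by (auto simp: hd_append)
    moreover have "a e \<notin> set p" using c by (simp add: is_cycle_def)
    ultimately have "n' (a (a e)) \<noteq> a e" using ae by metis
    then interpret dt: detaching D a n' "a e" x
      using ae x by unfold_locales auto
    have m: "dt.m = n' \<circ> transpose x e" by (simp add: dt.m_def ae)
    have "is_cycle n' (x # [a e] @ e # p')"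
      using is_cycle_rotate[of n' "e # p'" "x # [a e]"] c snoc by simp
    from is_cycle_split[OF this] have "is_cycle dt.m (x # p')" "is_cycle dt.m (e # [a e])" by (simp_all add: m)
    then have cp: "is_cycle dt.m p" using is_cycle_rotate[of dt.m "[x]" p'] snoc by simp
    have om: "orbit dt.m d = set p" if "d \<in> set p" for d using is_cycle_orbit(2)[OF cp that] .
    have bal: "balanced D a dt.m" "(x, e) \<notin> conn D a dt.m"
      using dt.balanced_m[OF n'(2)] oe[of x] ae snoc by auto
    interpret dm: dart_map D a dt.m by (rule dt.dart_map_m)
    have hp: "hd p \<in> set p" "hd p \<in> D" using snoc sub by (auto simp: hd_append)
    have hx: "(hd p, x) \<in> conn D a dt.m" using dm.orbit_conn[OF hp(2)] om[OF hp(1)] snoc by simp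
    have eh: "(e, hd p) \<in> conn D a n'" using n'.orbit_conn[OF e, of "hd p"] oe[of e] hp by simp
    have key: "(e, d) \<in> conn D a n' \<and> d \<notin> set (e # p @ [a e]) \<and> cycle_from dt.m d = cycle_from n' d \<and> orbit dt.m d = orbit n' d"
      if d: "(hd p, d) \<in> conn D a dt.m" "d \<notin> set p" for d
    proof -
      have "(e, d) \<in> conn D a n'" using eh d(1) dt.conn_subset conn_trans by blast
      moreover have "(x, d) \<in> conn D a dt.m" using dm.conn_sym[OF hx] d(1) conn_trans by blast
      then have "d \<noteq> e" "d \<noteq> a e"
        using bal(2) dm.conn_sym[OF conn_step1[OF e]] conn_trans by blast+
      then have dn: "d \<notin> set (e # p @ [a e])" using d(2) by auto
      moreover have "d \<notin> orbit n' x" "d \<notin> orbit n' (a (a e))"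
        using dn oe[of x] oe[of e] snoc ae by auto
      from dt.face_unchanged[OF this] have "cycle_from dt.m d = cycle_from n' d" "orbit dt.m d = orbit n' d" by auto
      ultimately show ?thesis by blast
    qed
    have "fills X T (sum cost (other_faces D a dt.m (hd p))) (map lab (cycle_from dt.m (hd p)))"
    proof (rule less.hyps)
      show "card {d \<in> D. dt.m (a d) \<noteq> d} < card {d \<in> D. n (a d) \<noteq> d}" using dt.measure n'(3) by simp
      show "dart_map D a dt.m" "balanced D a dt.m" "hd p \<in> D" by (rule dt.dart_map_m bal hp)+
      show "T (map lab (cycle_from dt.m d)) (cost (orbit dt.m d))"
        if "(hd p, d) \<in> conn D a dt.m" "d \<notin> orbit dt.m (hd p)" for d
        using key[of d] T[of d] that om[OF hp(1)] by simp
    qed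
    moreover have "cycle_from dt.m (hd p) = p" using is_cycle_orbit(1)[OF cp] .
    moreover have "other_faces D a dt.m (hd p) \<subseteq> other_faces D a n' e"
      using key om[OF hp(1)] oe[of e] unfolding other_faces_def by auto
    then have "sum cost (other_faces D a dt.m (hd p)) \<le> sum cost (other_faces D a n' e)"
      by (intro sum_mono2 n'.finite_other_faces e) auto
    ultimately show ?thesis using fills_mono by metis
  qed
  note ce = is_cycle_cycle_from[OF n fin, of e]
  obtain v where v: "cycle_from n e = e # v" using ce by (cases "cycle_from n e") auto
  have oe: "orbit n e = set (e # v)" using ce v by simp
  have cv: "is_cycle n (e # v)" using ce v by simp
  show ?case
  proof (cases "n (a e) = e")
    case True
    have "a e \<in> orbit n e"
      using orbit_swap[OF self_in_orbit_permutes[OF n fin, of "a e"], of e] orbit.base[of n "a e"] True by simp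
    then have "a e = last (e # v)" using is_cycle_prev[OF cv _ True] oe by simp
    then obtain p where p: "v = p @ [a e]" using ae by (cases v rule: rev_cases) auto
    have "fills X T (sum cost (other_faces D a n e)) (map lab p)"
      by (rule pend[OF less.prems(1,2)]) (use cv p faces oe in auto)
    from fills_spur[OF this fills_Nil, of "lab e" 0] show ?thesis
      using lab[OF e] v p by simp
  next
    case False
    obtain x where x: "n x = e" using permutes_surj[OF n] by (metis surjD)
    have xD: "x \<in> D" using permutes_in_image[OF n, of x] x e by simp
    then interpret dt: detaching D a n e x using x e False by unfold_locales auto
    interpret dm: dart_map D a dt.m by (rule dt.dart_map_m)
    have ox: "orbit n x = orbit n e"
      using orbit_eq_orbit[OF n fin, of e x] orbit.base[of n x] x by simp
    have xin: "x \<in> set (e # v)" using ox oe self_in_orbit_permutes[OF n fin, of x] by simp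
    have xl: "x = last (e # v)" by (rule is_cycle_prev[OF cv xin x])
    have bal: "balanced D a dt.m" by (rule dt.balanced_m(1)[OF less.prems(2)])
    show ?thesis
    proof (cases "a e \<in> orbit n x")
      case True
      then have "a e \<in> set v" using ox oe ae by auto
      then obtain p b where pb: "v = p @ a e # b" using split_list[of "a e" v] by blast
      then have "x = last (a e # b)" using xl by simp
      then obtain b' where b': "b = b' @ [x]" using dt.x_ne by (cases b rule: rev_cases) auto
      have "is_cycle n (x # (e # p) @ a e # b')"
        using is_cycle_rotate[of n "e # p @ a e # b'" "[x]"] cv pb b' by simp
      from is_cycle_split[OF this] have "is_cycle dt.m (x # b')" "is_cycle dt.m (a e # e # p)"
        by (simp_all add: dt.m_def)
      then have cb: "is_cycle dt.m b" and cp: "is_cycle dt.m (e # p @ [a e])"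
        using is_cycle_rotate[of dt.m "[x]" b'] is_cycle_rotate[of dt.m "[a e]" "e # p"] b' by simp_all
      have nc: "(x, a e) \<notin> conn D a dt.m" by (rule dt.balanced_m(2)[OF less.prems(2) True])
      have ob: "orbit dt.m d = set b" if "d \<in> set b" for d using is_cycle_orbit(2)[OF cb that] .
      have op: "orbit dt.m d = set (e # p @ [a e])" if "d \<in> set (e # p @ [a e])" for d
        using is_cycle_orbit(2)[OF cp that] .
      have hb: "hd b \<in> set b" "hd b \<in> D"
        using b' permutes_orbit_subset[OF n e] oe pb by (auto simp: hd_append)
      have hx: "(hd b, x) \<in> conn D a dt.m" using dm.orbit_conn[OF hb(2), of x] ob[OF hb(1)] b' by simp
      have ea: "(e, a e) \<in> conn D a dt.m" by (rule conn_step1[OF e])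
      have nbe: "(hd b, e) \<notin> conn D a dt.m"
        using nc dm.conn_sym[OF hx] ea conn_trans by blast
      have pe: "(e, d) \<in> conn D a dt.m" if "d \<in> set (e # p @ [a e])" for d
        using dm.orbit_conn[OF e, of d] op[of e] that by simp
      have bh: "(hd b, d) \<in> conn D a dt.m" if "d \<in> set b" for d
        using dm.orbit_conn[OF hb(2), of d] ob[OF hb(1)] that by simp
      have all: "set (e # v) = set (e # p @ [a e]) \<union> set b" using pb by auto
      have eb: "(e, hd b) \<in> conn D a n" by (rule orbit_conn[OF e]) (unfold oe all, use hb in blast)
      have unch: "cycle_from dt.m d = cycle_from n d" "orbit dt.m d = orbit n d" if "d \<notin> set (e # v)" for d
        using dt.face_unchanged[of d] ox oe orbit_eq_orbit[OF n fin True] that by simp_all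
      have key1: "d \<notin> set (e # v) \<and> (e, d) \<in> conn D a n" if "(hd b, d) \<in> conn D a dt.m" "d \<notin> set b" for d
      proof -
        have "d \<notin> set (e # p @ [a e])" using pe[of d] that nbe dm.conn_sym conn_trans by metis
        then show ?thesis using that all eb dt.conn_subset conn_trans by blast
      qed
      have key2: "d \<notin> set (e # v) \<and> (e, d) \<in> conn D a n" if "(e, d) \<in> conn D a dt.m" "d \<notin> set (e # p @ [a e])" for d
      proof -
        have "d \<notin> set b" using bh[of d] that nbe dm.conn_sym conn_trans by metis
        then show ?thesis using that all dt.conn_subset by blast
      qed
      have F1: "fills X T (sum cost (other_faces D a dt.m (hd b))) (map lab (cycle_from dt.m (hd b)))"
      proof (rule less.hyps[OF dt.measure dt.dart_map_m bal hb(2)])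
        show "T (map lab (cycle_from dt.m d)) (cost (orbit dt.m d))"
          if "(hd b, d) \<in> conn D a dt.m" "d \<notin> orbit dt.m (hd b)" for d
          using key1[of d] that ob[OF hb(1)] unch[of d] faces[of d] oe by simp
      qed
      have F2: "fills X T (sum cost (other_faces D a dt.m e)) (map lab p)"
      proof (rule pend[OF dt.dart_map_m bal _ cp])
        show "T (map lab (cycle_from dt.m d)) (cost (orbit dt.m d))"
          if "(e, d) \<in> conn D a dt.m" "d \<notin> set (e # p @ [a e])" for d
          using key2[of d] that unch[of d] faces[of d] oe by simp
      qed (use dt.measure in simp)
      have s1: "other_faces D a dt.m (hd b) \<subseteq> other_faces D a n e"
        using key1 unch ob[OF hb(1)] oe unfolding other_faces_def by auto
      have s2: "other_faces D a dt.m e \<subseteq> other_faces D a n e"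
        using key2 unch op[of e] oe unfolding other_faces_def by auto
      have dis: "other_faces D a dt.m e \<inter> other_faces D a dt.m (hd b) = {}"
      proof (rule ccontr)
        assume "other_faces D a dt.m e \<inter> other_faces D a dt.m (hd b) \<noteq> {}"
        then obtain d d' where dd: "(e, d) \<in> conn D a dt.m" "(hd b, d') \<in> conn D a dt.m"
          "orbit dt.m d = orbit dt.m d'" unfolding other_faces_def by auto
        have "d' \<in> orbit dt.m d" using dd(3) self_in_orbit_permutes[OF dm.n fin] by simp
        then have "(d, d') \<in> conn D a dt.m" using dm.orbit_conn dm.conn_in dd(1) e by metis
        then show False using dd nbe dm.conn_sym conn_trans by metis
      qed
      have "sum cost (other_faces D a dt.m e) + sum cost (other_faces D a dt.m (hd b)) =
          sum cost (other_faces D a dt.m e \<union> other_faces D a dt.m (hd b))"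
        by (rule sum.union_disjoint[OF dm.finite_other_faces[OF e] dm.finite_other_faces[OF hb(2)] dis, symmetric])
      also have "\<dots> \<le> sum cost (other_faces D a n e)"
        by (intro sum_mono2 finite_other_faces e) (use s1 s2 in auto)
      finally have le: "sum cost (other_faces D a dt.m e) + sum cost (other_faces D a dt.m (hd b)) \<le>
          sum cost (other_faces D a n e)" .
      have "cycle_from dt.m (hd b) = b" using is_cycle_orbit(1)[OF cb] .
      with fills_spur[OF F2 F1, of "lab e"] lab[OF e]
      have "fills X T (sum cost (other_faces D a dt.m e) + sum cost (other_faces D a dt.m (hd b)))
          (map lab (e # p @ a e # b))" by simp
      then show ?thesis using fills_mono[OF _ le] v pb by simp
    next
      case False
      note ca = is_cycle_cycle_from[OF n fin, of "a e"]
      obtain q where q: "cycle_from n (a e) = a e # q" using ca by (cases "cycle_from n (a e)") auto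
      have oa: "orbit n (a e) = set (a e # q)" using ca q by simp
      obtain r where r: "e # v = r @ [x]" using xl by (metis append_butlast_last_id list.distinct(1))
      have cx: "is_cycle n (x # r)" using is_cycle_rotate[of n r "[x]"] cv r by simp
      have sr: "set (x # r) = set (e # v)" using arg_cong[OF r, of set] by auto
      have "set (x # r) \<inter> set (a e # q) = {}"
        using orbit_disjoint[OF n fin False] ox oe oa sr by auto
      from is_cycle_merge[OF cx _ this] ca q have "is_cycle dt.m (x # q @ a e # r)" by (simp add: dt.m_def)
      then have "is_cycle dt.m (r @ x # q @ [a e])" using is_cycle_rotate[of dt.m "x # q @ [a e]" r] by simp
      then have "is_cycle dt.m ((r @ [x]) @ q @ [a e])" by simp
      then have cm: "is_cycle dt.m (e # (v @ q) @ [a e])" unfolding r[symmetric] by simp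
      have om: "orbit dt.m e = set (e # (v @ q) @ [a e])" using is_cycle_orbit(2)[OF cm, of e] by simp
      have unch: "cycle_from dt.m d = cycle_from n d" "orbit dt.m d = orbit n d"
        if "d \<notin> set (e # (v @ q) @ [a e])" for d
        using dt.face_unchanged[of d] ox oe oa that by auto
      have F: "fills X T (sum cost (other_faces D a dt.m e)) (map lab (v @ q))"
      proof (rule pend[OF dt.dart_map_m bal _ cm])
        show "T (map lab (cycle_from dt.m d)) (cost (orbit dt.m d))"
          if "(e, d) \<in> conn D a dt.m" "d \<notin> set (e # (v @ q) @ [a e])" for d
        proof -
          have "(e, d) \<in> conn D a n" using that dt.conn_subset by blast
          moreover have "d \<notin> orbit n e" using that oe by auto
          ultimately show ?thesis using faces[of d] unch[OF that(2)] by simp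
        qed
      qed (use dt.measure in simp)
      have "fills X T (sum cost (other_faces D a dt.m e)) (map lab q @ map lab v)"
        using fills_rotate[OF rot, of X _ "map lab v" "map lab q"] F by simp
      moreover have aen: "a e \<notin> orbit n e" using False ox by simp
      have "T (inv_letter (lab e) # map lab q) (cost (orbit n (a e)))"
        using faces[OF conn_step1[OF e] aen] q lab[OF e] by simp
      ultimately have G: "fills X T (sum cost (other_faces D a dt.m e) + cost (orbit n (a e))) (lab e # map lab v)"
        using lab[OF e] by (intro fills_cell) auto
      have s1: "other_faces D a dt.m e \<subseteq> other_faces D a n e"
      proof
        fix F assume "F \<in> other_faces D a dt.m e"
        then obtain d where d: "(e, d) \<in> conn D a dt.m" "d \<notin> orbit dt.m e" "F = orbit dt.m d"
          by (auto simp: other_faces_def)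
        then have "(e, d) \<in> conn D a n" "d \<notin> orbit n e" "F = orbit n d"
          using dt.conn_subset unch[of d] om oe by auto
        then show "F \<in> other_faces D a n e" by (auto simp: other_faces_def)
      qed
      have s2: "orbit n (a e) \<in> other_faces D a n e"
        using conn_step1[OF e] aen by (auto simp: other_faces_def)
      have s3: "orbit n (a e) \<notin> other_faces D a dt.m e"
      proof
        assume "orbit n (a e) \<in> other_faces D a dt.m e"
        then obtain d where d: "d \<notin> orbit dt.m e" "orbit n (a e) = orbit dt.m d"
          by (auto simp: other_faces_def)
        then have "d \<in> orbit n (a e)" using self_in_orbit_permutes[OF dm.n fin, of d] by simp
        then show False using d(1) om oa by auto
      qed
      have "sum cost (other_faces D a dt.m e) + cost (orbit n (a e)) =
          sum cost (insert (orbit n (a e)) (other_faces D a dt.m e))"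
        using s3 dm.finite_other_faces[OF e] by simp
      also have "\<dots> \<le> sum cost (other_faces D a n e)"
        by (intro sum_mono2 finite_other_faces e) (use s1 s2 in auto)
      finally show ?thesis using fills_mono[OF G] v by simp
    qed
  qed
qed

text \<open>A cell may be read from any starting point and in either direction.\<close>
definition cyclic_relator :: "'x word set \<Rightarrow> 'x word \<Rightarrow> bool" where
  "cyclic_relator Rels t \<longleftrightarrow> (\<exists>u v. t = u @ v \<and> (v @ u \<in> Rels \<or> inv_word (v @ u) \<in> Rels))"

text \<open>Cells labelled by \<open>R\<close> count for the area, and those labelled by \<open>Z\<close> are free.\<close>
definition face_label :: "'x word set \<Rightarrow> 'x word set \<Rightarrow> 'x word \<Rightarrow> nat \<Rightarrow> bool" where
  "face_label R Z t c \<longleftrightarrow> c = 0 \<and> cyclic_relator Z t \<or> c = 1 \<and> cyclic_relator R t"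

lemma cyclic_relator_rotate: "cyclic_relator Rels (u @ v) \<Longrightarrow> cyclic_relator Rels (v @ u)"
proof -
  assume "cyclic_relator Rels (u @ v)"
  then obtain u' v' where uv: "u @ v = u' @ v'" "v' @ u' \<in> Rels \<or> inv_word (v' @ u') \<in> Rels"
    by (auto simp: cyclic_relator_def)
  from uv(1) consider (A) w where "u' = u @ w" "v = w @ v'" | (B) w where "u = u' @ w" "v' = w @ v"
    by (auto simp: append_eq_append_conv2)
  then show ?thesis
  proof cases
    case A
    then show ?thesis using uv(2) unfolding cyclic_relator_def
      by (intro exI[of _ w] exI[of _ "v' @ u"]) auto
  next
    case B
    then show ?thesis using uv(2) unfolding cyclic_relator_def
      by (intro exI[of _ "v @ u'"] exI[of _ w]) auto
  qed
qed

lemma cyclic_relatorI: "t \<in> Rels \<Longrightarrow> cyclic_relator Rels t"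
  unfolding cyclic_relator_def by (intro exI[of _ "[]"] exI[of _ t]) auto

lemma cyclic_relator_Un: "cyclic_relator (A \<union> B) t \<longleftrightarrow> cyclic_relator A t \<or> cyclic_relator B t"
  by (auto simp: cyclic_relator_def)

lemma rotation_closed_face_label: "rotation_closed (face_label R Z)"
  by (auto simp: rotation_closed_def face_label_def cyclic_relator_rotate)

lemma face_word_cycle_from: "face_word D d = map (lab D) (cycle_from (nxt D) d)"
  by (simp add: face_word_def cycle_from_def)

lemma cycle_from_rotate:
  assumes f: "f permutes D" "finite D" and d: "d' \<in> orbit f d"
  obtains u v where "cycle_from f d = u @ v" "cycle_from f d' = v @ u"
proof -
  note c = is_cycle_cycle_from[OF f, of d]
  obtain u v where uv: "cycle_from f d = u @ d' # v" using d c(3) split_list by metis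
  with c(1) have "is_cycle f ((d' # v) @ u)" using is_cycle_rotate by metis
  from is_cycle_orbit(1)[OF this] have "cycle_from f d' = (d' # v) @ u" by simp
  then show ?thesis using that uv by blast
qed

lemma labelled_by_iff:
  assumes f: "nxt D permutes A" "finite A"
  shows "labelled_by D (orbit (nxt D) d) Rels \<longleftrightarrow> cyclic_relator Rels (face_word D d)"
proof
  assume "labelled_by D (orbit (nxt D) d) Rels"
  then obtain d' where d': "d' \<in> orbit (nxt D) d" "face_word D d' \<in> Rels \<or> inv_word (face_word D d') \<in> Rels"
    unfolding labelled_by_def by blast
  obtain u v where "cycle_from (nxt D) d = u @ v" "cycle_from (nxt D) d' = v @ u"
    using cycle_from_rotate[OF f d'(1)] by blast
  then show "cyclic_relator Rels (face_word D d)"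
    using d'(2) unfolding cyclic_relator_def face_word_cycle_from
    by (intro exI[of _ "map (lab D) u"] exI[of _ "map (lab D) v"]) simp
next
  assume "cyclic_relator Rels (face_word D d)"
  then obtain u v where uv: "face_word D d = u @ v" "v @ u \<in> Rels \<or> inv_word (v @ u) \<in> Rels"
    by (auto simp: cyclic_relator_def)
  then obtain us vs where us: "cycle_from (nxt D) d = us @ vs" "u = map (lab D) us" "v = map (lab D) vs"
    by (auto simp: face_word_cycle_from map_eq_append_conv)
  note c = is_cycle_cycle_from[OF f, of d]
  have vu: "is_cycle (nxt D) (vs @ us)" using c(1) us is_cycle_rotate by metis
  then have hd: "hd (vs @ us) \<in> orbit (nxt D) d"
    using c(3) us hd_in_set[of "vs @ us"] by (auto simp: is_cycle_def)
  have "face_word D (hd (vs @ us)) = v @ u"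
    using is_cycle_orbit(1)[OF vu] us by (simp add: face_word_cycle_from)
  then show "labelled_by D (orbit (nxt D) d) Rels" unfolding labelled_by_def using hd uv(2) by metis
qed

lemma planar_diagramD:
  assumes "planar_diagram D" "darts D \<noteq> {}"
  shows "dart_map (darts D) (opp D) (nxt D)" "balanced (darts D) (opp D) (nxt D)"
    "base D \<in> darts D" "\<And>d e. d \<in> darts D \<Longrightarrow> e \<in> darts D \<Longrightarrow> (d, e) \<in> conn (darts D) (opp D) (nxt D)"
proof -
  show m: "dart_map (darts D) (opp D) (nxt D)" and b: "base D \<in> darts D"
    using assms by (auto simp: planar_diagram_def dart_map_def)
  show c: "(d, e) \<in> conn (darts D) (opp D) (nxt D)" if "d \<in> darts D" "e \<in> darts D" for d e
    using assms that by (auto simp: planar_diagram_def conn_def link_def)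
  have "conn (darts D) (opp D) (nxt D) `` {d} = darts D" if "d \<in> darts D" for d
    using c that dart_map.conn_in[OF m] by auto
  then have "comps (darts D) (opp D) (nxt D) = {darts D}" using b by (auto simp: comps_def)
  then show "balanced (darts D) (opp D) (nxt D)"
    using assms by (simp add: planar_diagram_def balanced_def)
qed

lemma planar_diagramI:
  assumes "dart_map (darts D) (opp D) (nxt D)" "base D \<in> darts D"
    "\<And>d e. d \<in> darts D \<Longrightarrow> e \<in> darts D \<Longrightarrow> (d, e) \<in> conn (darts D) (opp D) (nxt D)"
    "card (orbits_on (nxt D \<circ> opp D) (darts D)) + card (orbits_on (nxt D) (darts D))
          = card (orbits_on (opp D) (darts D)) + 2"
  shows "planar_diagram D"
  using assms by (auto simp: planar_diagram_def dart_map_def conn_def link_def)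

lemma fills_of_diagram:
  assumes vk: "van_kampen_diagram X (R \<union> Z) D"
  shows "fills X (face_label R Z) (relative_area R D) (boundary_label D)"
proof (cases "darts D = {}")
  case True
  then show ?thesis by (simp add: boundary_label_def fills_Nil)
next
  case False
  have pl: "planar_diagram D" and lab: "\<And>d. d \<in> darts D \<Longrightarrow> fst (lab D d) \<in> X \<and> lab D (opp D d) = inv_letter (lab D d)"
    and cells: "\<And>F. F \<in> two_cells D \<Longrightarrow> labelled_by D F (R \<union> Z)"
    using vk by (auto simp: van_kampen_diagram_def)
  note pd = planar_diagramD[OF pl False]
  interpret dart_map "darts D" "opp D" "nxt D" by (rule pd(1))
  let ?cost = "\<lambda>F. if labelled_by D F R then 1 else 0 :: nat"
  have other: "orbit (nxt D) d \<in> two_cells D" if "d \<in> darts D" "d \<notin> orbit (nxt D) (base D)" for d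
    using that self_in_orbit_permutes[OF n fin, of d] by (auto simp: two_cells_def orbits_on_def)
  have "fills X (face_label R Z) (sum ?cost (other_faces (darts D) (opp D) (nxt D) (base D)))
      (map (lab D) (cycle_from (nxt D) (base D)))"
  proof (rule fills_of_map[OF rotation_closed_face_label _ pd(1,2,3)])
    show "\<And>d. d \<in> darts D \<Longrightarrow> fst (lab D d) \<in> X \<and> lab D (opp D d) = inv_letter (lab D d)"
      by (rule lab)
    fix d assume "(base D, d) \<in> conn (darts D) (opp D) (nxt D)" "d \<notin> orbit (nxt D) (base D)"
    then have "labelled_by D (orbit (nxt D) d) (R \<union> Z)" using other cells conn_in pd(3) by blast
    then show "face_label R Z (map (lab D) (cycle_from (nxt D) d)) (?cost (orbit (nxt D) d))"
      using labelled_by_iff[OF n fin, of d]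
      by (auto simp: face_label_def face_word_cycle_from cyclic_relator_Un)
  qed
  moreover have "sum ?cost (other_faces (darts D) (opp D) (nxt D) (base D)) \<le> relative_area R D"
  proof -
    have "other_faces (darts D) (opp D) (nxt D) (base D) \<subseteq> two_cells D"
      using other conn_in pd(3) by (auto simp: other_faces_def)
    moreover have f: "finite (two_cells D)" using fin by (simp add: two_cells_def orbits_on_def)
    ultimately have "sum ?cost (other_faces (darts D) (opp D) (nxt D) (base D)) \<le> sum ?cost (two_cells D)"
      by (intro sum_mono2) auto
    also have "\<dots> = relative_area R D"
      using f by (simp add: relative_area_def sum.If_cases Int_def)
    finally show ?thesis .
  qed
  ultimately have "fills X (face_label R Z) (relative_area R D) (map (lab D) (cycle_from (nxt D) (base D)))"
    by (rule fills_mono)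
  then show ?thesis using False by (simp add: boundary_label_def face_word_cycle_from)
qed

section \<open>Disc words yield diagrams\<close>

lemma is_cycle_fixpoint: "f p = p \<Longrightarrow> is_cycle f [p]"
  by (simp add: is_cycle_def)

text \<open>Two new darts that form a separate edge.\<close>
lemma orbits_on_adjoin:
  assumes f: "f permutes D" "finite D" and pq: "p \<notin> D" "q \<notin> D" "p \<noteq> q"
  defines "D' \<equiv> insert p (insert q D)"
  shows "orbits_on f D' = orbits_on f D \<union> {{p}, {q}}"
    and "card (orbits_on f D') = card (orbits_on f D) + 2"
    and "orbits_on (f \<circ> transpose p q) D' = orbits_on f D \<union> {{p, q}}"
    and "card (orbits_on (f \<circ> transpose p q) D') = Suc (card (orbits_on f D))"
proof -
  have fp: "f p = p" "f q = q" using permutes_not_in[OF f(1)] pq by auto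
  have o: "orbit f p = {p}" "orbit f q = {q}" using fp by (simp_all add: orbit_eq_singleton_iff)
  show 1: "orbits_on f D' = orbits_on f D \<union> {{p}, {q}}" by (auto simp: orbits_on_def D'_def o)
  have sub: "\<And>A. A \<in> orbits_on f D \<Longrightarrow> A \<subseteq> D"
    using permutes_orbit_subset[OF f(1)] by (auto simp: orbits_on_def)
  have n: "{p} \<notin> orbits_on f D" "{q} \<notin> orbits_on f D" using sub pq by auto
  have fo: "finite (orbits_on f D)" using f by (simp add: orbits_on_def)
  show 2: "card (orbits_on f D') = card (orbits_on f D) + 2" using 1 n pq(3) fo by simp
  have f': "f permutes D'" "finite D'"
    using permutes_subset[OF f(1), of D'] f(2) by (auto simp: D'_def)
  note m = orbits_transpose_merge[OF f' is_cycle_fixpoint[of f p, OF fp(1)] is_cycle_fixpoint[of f q, OF fp(2)]]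
  have m': "q \<notin> set [p]" "p \<in> D'" "q \<in> D'" using pq by (auto simp: D'_def)
  show "orbits_on (f \<circ> transpose p q) D' = orbits_on f D \<union> {{p, q}}"
    using m(2)[OF m'] n unfolding 1 by auto
  show "card (orbits_on (f \<circ> transpose p q) D') = Suc (card (orbits_on f D))"
    using m(3)[OF m'] 2 by simp
qed

lemma dart_map_adjoin:
  assumes m: "dart_map D a n" and pq: "p \<notin> D" "q \<notin> D" "p \<noteq> q"
    and n': "n' permutes insert p (insert q D)"
  shows "dart_map (insert p (insert q D)) (a \<circ> transpose p q) n'"
proof
  interpret dart_map D a n by fact
  let ?D = "insert p (insert q D)"
  show "finite ?D" using fin by simp
  have a': "a permutes ?D" by (rule permutes_subset[OF a]) auto
  show "(a \<circ> transpose p q) permutes ?D" by (rule permutes_transpose[OF a']) auto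
  show "n' permutes ?D" by fact
  have ap: "a p = p" "a q = q" using permutes_not_in[OF a] pq by auto
  fix d assume "d \<in> ?D"
  then consider "d = p" | "d = q" | "d \<in> D" by auto
  then show "(a \<circ> transpose p q) d \<noteq> d \<and> (a \<circ> transpose p q) ((a \<circ> transpose p q) d) = d"
  proof cases
    case 3
    then have "a d \<in> D" "d \<noteq> p" "d \<noteq> q" "a d \<noteq> p" "a d \<noteq> q" using permutes_in_image[OF a] pq by metis+
    then show ?thesis using a_inv[OF 3] by simp
  qed (use ap pq in auto)
qed

text \<open>A new edge with darts \<open>p\<close> and \<open>q\<close>, first a component of its own, is attached by one end in the corner
  between the last dart \<open>x\<close> and the first dart of a face. Two components become one, while a vertex and a face are lost.\<close>

lemma attach_spur:
  assumes m: "dart_map D a n" and pq: "p \<notin> D" "q \<notin> D" "p \<noteq> q"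
    and conn: "\<forall>d\<in>D. \<forall>e\<in>D. (d, e) \<in> conn D a n"
    and euler: "card (orbits_on (n \<circ> a) D) + card (orbits_on n D) = card (orbits_on a D) + 2"
    and c: "is_cycle n (vs @ [x])" and x: "x \<in> D"
  defines "D' \<equiv> insert p (insert q D)" and "a' \<equiv> a \<circ> transpose p q"
    and "n' \<equiv> n \<circ> transpose p q \<circ> transpose x q"
  shows "dart_map D' a' n'"
    and "\<And>d e. d \<in> D' \<Longrightarrow> e \<in> D' \<Longrightarrow> (d, e) \<in> conn D' a' n'"
    and "card (orbits_on (n' \<circ> a') D') + card (orbits_on n' D') = card (orbits_on a' D') + 2"
    and "is_cycle n' (p # q # vs @ [x])"
    and "orbits_on n' D' - {set (p # q # vs @ [x])} = orbits_on n D - {set (vs @ [x])}"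
    and "\<And>d. d \<in> D \<Longrightarrow> d \<notin> set (vs @ [x]) \<Longrightarrow> cycle_from n' d = cycle_from n d"
proof -
  interpret dart_map D a n by fact
  let ?n0 = "n \<circ> transpose p q"
  have fix_pq: "n p = p" "n q = q" "a p = p" "a q = q"
    using permutes_not_in[OF n] permutes_not_in[OF a] pq by auto
  have nD': "n permutes D'" unfolding D'_def by (rule permutes_subset[OF n]) auto
  have finD': "finite D'" using fin by (simp add: D'_def)
  have in': "p \<in> D'" "q \<in> D'" "x \<in> D'" "D \<subseteq> D'" using x by (auto simp: D'_def)
  have n0: "?n0 permutes D'" by (rule permutes_transpose[OF nD' in'(1,2)])
  have n': "n' permutes D'" unfolding n'_def by (rule permutes_transpose[OF n0 in'(3,2)])
  show dm: "dart_map D' a' n'"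
    unfolding D'_def a'_def by (rule dart_map_adjoin[OF m pq n'[unfolded D'_def]])
  have ox: "orbit n x = set (vs @ [x])" using is_cycle_orbit(2)[OF c, of x] by simp
  have cD: "set (vs @ [x]) \<subseteq> D" using permutes_orbit_subset[OF n x] ox by simp
  have out: "cycle_from ?n0 d = cycle_from n d" "orbit ?n0 d = orbit n d" if "d \<in> D" for d
  proof -
    have "p \<notin> orbit n d" "q \<notin> orbit n d" using permutes_orbit_subset[OF n that] pq by auto
    from cycle_from_transpose_other[OF nD' finD' this]
    show "cycle_from ?n0 d = cycle_from n d" "orbit ?n0 d = orbit n d" by auto
  qed
  have cx: "is_cycle n (x # vs)" using is_cycle_rotate[OF c] by simp
  have cx0: "is_cycle ?n0 (x # vs)"
    using is_cycle_cycle_from(1)[OF n0 finD', of x] out(1)[OF x] is_cycle_orbit(1)[OF cx] by simp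
  have cq0: "is_cycle ?n0 (q # [p])" using fix_pq pq by (simp add: is_cycle_def)
  have qn: "q \<notin> set (x # vs)" using cD pq by auto
  note mg = orbits_transpose_merge[OF n0 finD' cx0 cq0 qn in'(3,2), folded n'_def]
  show cyc: "is_cycle n' (p # q # vs @ [x])" using is_cycle_rotate[of n' "[x]" "p # q # vs"] mg(1) by simp
  have F: "card (orbits_on n' D') = card (orbits_on n D)"
    using mg(3) orbits_on_adjoin(4)[OF n fin pq] by (simp add: D'_def)
  have E: "card (orbits_on a' D') = Suc (card (orbits_on a D))"
    using orbits_on_adjoin(4)[OF a fin pq] by (simp add: D'_def a'_def)
  have s: "(n \<circ> a) permutes D" by (rule permutes_compose[OF a n])
  have sD': "(n \<circ> a) permutes D'" unfolding D'_def by (rule permutes_subset[OF s]) auto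
  have ax: "a x \<in> D" "a (a x) = x" using permutes_in_image[OF a] x a_inv by auto
  have axp: "a x \<noteq> p" "a x \<noteq> q" "x \<noteq> p" "x \<noteq> q" using ax x pq by auto
  have sig: "n' \<circ> a' = (n \<circ> a) \<circ> transpose (a x) p"
  proof
    fix d
    have *: "a d = x \<longleftrightarrow> d = a x" "a d = p \<longleftrightarrow> d = p" "a d = q \<longleftrightarrow> d = q"
      using ax permutes_inj[OF a] fix_pq by (metis injD)+
    show "(n' \<circ> a') d = ((n \<circ> a) \<circ> transpose (a x) p) d"
      using * fix_pq axp ax pq by (auto simp: n'_def a'_def transpose_def)
  qed
  have V: "card (orbits_on (n' \<circ> a') D') = Suc (card (orbits_on (n \<circ> a) D))"
  proof -
    note c1 = is_cycle_cycle_from[OF sD' finD', of "a x"]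
    obtain r where r: "cycle_from (n \<circ> a) (a x) = a x # r" using c1 by (cases "cycle_from (n \<circ> a) (a x)") auto
    have cp: "is_cycle (n \<circ> a) (p # [])" by (rule is_cycle_fixpoint) (simp add: fix_pq)
    have "p \<notin> set (a x # r)"
      using c1(3) r permutes_orbit_subset[OF s ax(1)] pq by auto
    from orbits_transpose_merge(3)[OF sD' finD' c1(1)[unfolded r] cp this] in' ax
    have "Suc (card (orbits_on (n' \<circ> a') D')) = card (orbits_on (n \<circ> a) D')" by (auto simp: sig)
    then show ?thesis using orbits_on_adjoin(2)[OF s fin pq] by (simp add: D'_def)
  qed
  show "card (orbits_on (n' \<circ> a') D') + card (orbits_on n' D') = card (orbits_on a' D') + 2"
    using V F E euler by simp
  have sub0: "conn D a n \<subseteq> conn D' a' ?n0"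
  proof -
    have "(d, a d) \<in> conn D' a' ?n0" "(d, n d) \<in> conn D' a' ?n0" if "d \<in> D" for d
    proof -
      have "d \<noteq> p" "d \<noteq> q" "d \<in> D'" using that pq in' by auto
      then show "(d, a d) \<in> conn D' a' ?n0" "(d, n d) \<in> conn D' a' ?n0"
        using conn_step1[of d D' a' ?n0] conn_step2[of d D' ?n0 a'] by (auto simp: a'_def)
    qed
    then have "link D a n \<subseteq> conn D' a' ?n0" by (auto simp: link_def)
    then show ?thesis unfolding conn_def by (rule rtrancl_subset_rtrancl)
  qed
  interpret d': dart_map D' a' n' by (rule dm)
  have ocyc: "orbit n' x = set (p # q # vs @ [x])" by (rule is_cycle_orbit(2)[OF cyc]) simp
  have xq: "(x, q) \<in> conn D' a' n'" "(x, p) \<in> conn D' a' n'"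
    by (rule d'.orbit_conn[OF in'(3)]; simp add: ocyc)+
  have "conn D' a' ?n0 \<subseteq> conn D' a' n'"
    using conn_subset_transpose[OF dm[unfolded n'_def] in'(3,2)] xq(1) by (simp add: n'_def)
  then have xd: "(x, d) \<in> conn D' a' n'" if "d \<in> D'" for d
    using that xq conn x sub0 by (auto simp: D'_def)
  show "(d, e) \<in> conn D' a' n'" if "d \<in> D'" "e \<in> D'" for d e
    using d'.conn_sym[OF xd[OF that(1)]] xd[OF that(2)] conn_trans by blast
  show "orbits_on n' D' - {set (p # q # vs @ [x])} = orbits_on n D - {set (vs @ [x])}"
  proof -
    have e1: "set (x # [p] @ q # vs) = set (p # q # vs @ [x])" "set (x # vs) = set (vs @ [x])"
      "set (q # [p]) = {p, q}" by auto
    have e2: "orbits_on ?n0 D' = orbits_on n D \<union> {{p, q}}"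
      unfolding D'_def by (rule orbits_on_adjoin(3)[OF n fin pq])
    have "A \<subseteq> D" if "A \<in> orbits_on n D" for A
      using that permutes_orbit_subset[OF n] by (auto simp: orbits_on_def)
    then have "{p, q} \<notin> orbits_on n D" "set (p # q # vs @ [x]) \<notin> orbits_on n D"
      using pq by fastforce+
    then show ?thesis unfolding mg(2) e1 e2 by blast
  qed
  show "cycle_from n' d = cycle_from n d" if d: "d \<in> D" "d \<notin> set (vs @ [x])" for d
  proof -
    have "x \<notin> orbit ?n0 d" "q \<notin> orbit ?n0 d"
      using d orbit_swap[OF self_in_orbit_permutes[OF n fin], of x d] ox out(2)[OF d(1)]
        permutes_orbit_subset[OF n d(1)] pq by auto
    from cycle_from_transpose_other(1)[OF n0 finD' this] show ?thesis
      using out(1)[OF d(1)] by (simp add: n'_def)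
  qed
qed

text \<open>The free end of a pendant edge is glued to a later corner of its face, which cuts off a face with boundary
  \<open>a p # us\<close>. The free end is a vertex different from that corner, so that the surface stays a sphere even if \<open>us\<close> is empty.\<close>

lemma attach_cell:
  assumes m: "dart_map D a n"
    and conn: "\<forall>d\<in>D. \<forall>e\<in>D. (d, e) \<in> conn D a n"
    and euler: "card (orbits_on (n \<circ> a) D) + card (orbits_on n D) = card (orbits_on a D) + 2"
    and c: "is_cycle n (p # a p # us @ vs)" and p: "p \<in> D"
  defines "z \<equiv> last (a p # us)"
  defines "n' \<equiv> n \<circ> transpose p z"
  shows "dart_map D a n'"
    and "\<And>d e. d \<in> D \<Longrightarrow> e \<in> D \<Longrightarrow> (d, e) \<in> conn D a n'"
    and "card (orbits_on (n' \<circ> a) D) + card (orbits_on n' D) = card (orbits_on a D) + 2"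
    and "is_cycle n' (p # vs)" "is_cycle n' (a p # us)"
    and "orbits_on n' D = (orbits_on n D - {set (p # a p # us @ vs)}) \<union> {set (p # vs), set (a p # us)}"
    and "\<And>d. d \<in> D \<Longrightarrow> d \<notin> set (p # a p # us @ vs) \<Longrightarrow> cycle_from n' d = cycle_from n d"
proof -
  interpret dart_map D a n by fact
  obtain zs where zs: "a p # us = zs @ [z]" unfolding z_def by (metis append_butlast_last_id list.distinct(1))
  have c': "is_cycle n (p # zs @ z # vs)" using c zs by (metis append.assoc append_Cons append_Nil)
  have op: "orbit n d = set (p # a p # us @ vs)" if "d \<in> set (p # a p # us @ vs)" for d
    by (rule is_cycle_orbit(2)[OF c that])
  have zin: "z \<in> set (p # a p # us @ vs)" unfolding z_def by auto
  have z: "z \<in> D" "z \<noteq> p"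
    using permutes_orbit_subset[OF n p] op[of p] zin c' by (auto simp: is_cycle_def)
  have n': "n' permutes D" unfolding n'_def by (rule permutes_transpose[OF n p z(1)])
  show dm: "dart_map D a n'" using fin a n' a_inv by unfold_locales auto
  note sp = is_cycle_split[OF c', folded n'_def] and so = orbits_transpose_split[OF n fin c' p, folded n'_def]
  show c1: "is_cycle n' (p # vs)" by (rule sp(1))
  show c2: "is_cycle n' (a p # us)" using is_cycle_rotate[of n' "[z]" zs] sp(2) zs by simp
  have sets: "set (p # zs @ z # vs) = set (p # a p # us @ vs)" "set (z # zs) = set (a p # us)"
    using arg_cong[OF zs, of set] by auto
  show "orbits_on n' D = (orbits_on n D - {set (p # a p # us @ vs)}) \<union> {set (p # vs), set (a p # us)}"
    using so(1) unfolding sets .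
  show "cycle_from n' d = cycle_from n d" if d: "d \<in> D" "d \<notin> set (p # a p # us @ vs)" for d
  proof -
    have "p \<notin> orbit n d" "z \<notin> orbit n d"
      using d(2) op[OF list.set_intros(1)] op[OF zin] orbit_swap[OF self_in_orbit_permutes[OF n fin], of _ d] by (auto simp del: set_simps)
    from cycle_from_transpose_other(1)[OF n fin this] show ?thesis by (simp add: n'_def)
  qed
  have ap: "a p \<in> D" "a p \<noteq> p" "a (a p) = p" using permutes_in_image[OF a] p a_inv by auto
  have az: "a z \<in> D" "a (a z) = z" "a z \<noteq> a p" using permutes_in_image[OF a] z a_inv[of z] ap by auto
  have sig: "n' \<circ> a = (n \<circ> a) \<circ> transpose (a z) (a p)"
  proof
    fix d
    have "a d = z \<longleftrightarrow> d = a z" "a d = p \<longleftrightarrow> d = a p"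
      using az ap permutes_inj[OF a] by (metis injD)+
    then show "(n' \<circ> a) d = ((n \<circ> a) \<circ> transpose (a z) (a p)) d"
      using az ap by (auto simp: n'_def transpose_def)
  qed
  have s: "(n \<circ> a) permutes D" by (rule permutes_compose[OF a n])
  have "n p = a p" using is_cycle_next[of n "[]" p "a p # us @ vs"] c by simp
  then have fx: "(n \<circ> a) (a p) = a p" using ap by simp
  have V: "Suc (card (orbits_on (n' \<circ> a) D)) = card (orbits_on (n \<circ> a) D)"
  proof -
    note c1 = is_cycle_cycle_from[OF s fin, of "a z"]
    obtain r where r: "cycle_from (n \<circ> a) (a z) = a z # r" using c1 by (cases "cycle_from (n \<circ> a) (a z)") auto
    have "a p \<notin> orbit (n \<circ> a) (a z)"
    proof
      assume "a p \<in> orbit (n \<circ> a) (a z)"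
      then have "a z \<in> orbit (n \<circ> a) (a p)"
        using orbit_swap[OF self_in_orbit_permutes[OF s fin]] by blast
      moreover have "orbit (n \<circ> a) (a p) = {a p}" using fx by (simp only: orbit_eq_singleton_iff)
      ultimately show False using az by simp
    qed
    then have "a p \<notin> set (a z # r)" using c1(3) r by simp
    from orbits_transpose_merge(3)[OF s fin c1(1)[unfolded r] is_cycle_fixpoint[where f = "n \<circ> a" and p = "a p", OF fx] this az(1) ap(1)]
    show ?thesis by (simp add: sig)
  qed
  show "card (orbits_on (n' \<circ> a) D) + card (orbits_on n' D) = card (orbits_on a D) + 2"
    using V so(2) euler by simp
  interpret d': dart_map D a n' by (rule dm)
  have "orbit n' (a p) = set (a p # us)" by (rule is_cycle_orbit(2)[OF c2]) simp
  then have "(a p, z) \<in> conn D a n'" using d'.orbit_conn[OF ap(1), of z] unfolding z_def by simp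
  then have "(p, z) \<in> conn D a n'" using conn_step1[OF p] conn_trans by blast
  then have "conn D a n \<subseteq> conn D a n'"
    using conn_subset_transpose[OF dm[unfolded n'_def] p z(1)] by (simp add: n'_def)
  then show "(d, e) \<in> conn D a n'" if "d \<in> D" "e \<in> D" for d e using conn that by blast
qed

definition bounds_diagram :: "'x set \<Rightarrow> 'x word set \<Rightarrow> 'x word set \<Rightarrow> nat \<Rightarrow> 'x word \<Rightarrow> bool" where
  "bounds_diagram X R Z k w \<longleftrightarrow>
    (\<exists>D. van_kampen_diagram X (R \<union> Z) D \<and> boundary_label D = w \<and> relative_area R D \<le> k)"

lemma bounds_diagram_Nil: "bounds_diagram X R Z k []"
proof -
  let ?D = "\<lparr>darts = {}, opp = id, nxt = id, lab = \<lambda>_. undefined, base = 0\<rparr>"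
  have "van_kampen_diagram X (R \<union> Z) ?D"
    by (simp add: van_kampen_diagram_def planar_diagram_def two_cells_def orbits_on_def permutes_id)
  moreover have "boundary_label ?D = []" "relative_area R ?D = 0"
    by (simp_all add: boundary_label_def relative_area_def two_cells_def orbits_on_def)
  ultimately show ?thesis unfolding bounds_diagram_def by (intro exI[of _ ?D]) simp
qed

lemma bounds_diagram_rotate:
  assumes "bounds_diagram X R Z k (u @ v)"
  shows "bounds_diagram X R Z k (v @ u)"
proof (cases "v = []")
  case True
  then show ?thesis using assms by simp
next
  case False
  from assms obtain D where D: "van_kampen_diagram X (R \<union> Z) D" "boundary_label D = u @ v" "relative_area R D \<le> k"
    unfolding bounds_diagram_def by blast
  have ne: "darts D \<noteq> {}" using D(2) False by (auto simp: boundary_label_def)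
  have pl: "planar_diagram D" using D by (simp add: van_kampen_diagram_def)
  note pd = planar_diagramD[OF pl ne]
  interpret dart_map "darts D" "opp D" "nxt D" by (rule pd(1))
  have "map (lab D) (cycle_from (nxt D) (base D)) = u @ v"
    using D(2) ne by (simp add: boundary_label_def face_word_cycle_from)
  then obtain us vs where us: "cycle_from (nxt D) (base D) = us @ vs" "u = map (lab D) us" "v = map (lab D) vs"
    by (auto simp: map_eq_append_conv)
  note c = is_cycle_cycle_from[OF n fin, of "base D"]
  have cv: "is_cycle (nxt D) (vs @ us)" using c(1) us is_cycle_rotate by metis
  let ?d = "hd (vs @ us)"
  let ?D = "D\<lparr>base := ?d\<rparr>"
  have d: "?d \<in> orbit (nxt D) (base D)"
    using c(3) us hd_in_set[of "vs @ us"] False by auto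
  have dD: "?d \<in> darts D" using permutes_orbit_subset[OF n pd(3)] d by blast
  have fw: "face_word ?D = face_word D" by (auto simp: face_word_def)
  have tc: "two_cells ?D = two_cells D" using orbit_eq_orbit[OF n fin d] by (simp add: two_cells_def)
  have lb: "labelled_by ?D F Rels = labelled_by D F Rels" for F and Rels :: "'a word set"
    by (simp add: labelled_by_def fw)
  have "van_kampen_diagram X (R \<union> Z) ?D"
    using D(1) dD by (auto simp: van_kampen_diagram_def planar_diagram_def tc lb)
  moreover have "boundary_label ?D = v @ u"
    using is_cycle_orbit(1)[OF cv] us ne by (simp add: boundary_label_def face_word_cycle_from)
  moreover have "relative_area R ?D \<le> k" using D(3) by (simp add: relative_area_def tc lb)
  ultimately show ?thesis unfolding bounds_diagram_def by blast
qed

text \<open>The new diagram starts with the new edge, whose far end is free. The last property states this and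
  lets \<open>cell_diagram\<close> continue from here.\<close>
lemma spur_diagram:
  assumes vk: "van_kampen_diagram X (R \<union> Z) D" and l: "fst l \<in> X"
  obtains D' where "van_kampen_diagram X (R \<union> Z) D'"
    "boundary_label D' = l # inv_letter l # boundary_label D"
    "relative_area R D' = relative_area R D" "darts D' \<noteq> {}" "nxt D' (base D') = opp D' (base D')"
proof (cases "darts D = {}")
  case True
  let ?t = "transpose 0 (1::nat)"
  let ?D = "\<lparr>darts = {0, 1}, opp = ?t, nxt = ?t, lab = (\<lambda>_. inv_letter l)(0 := l), base = 0\<rparr>"
  have t: "?t permutes {0, 1}" by (rule permutes_swap_id) auto
  have c: "is_cycle ?t [0, 1]" by (simp add: is_cycle_def)
  have o: "orbit ?t 0 = {0, 1}" "orbit ?t 1 = {0, 1}" "orbit id 0 = {0::nat}" "orbit id 1 = {1::nat}"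
    using is_cycle_orbit(2)[OF c, of 0] is_cycle_orbit(2)[OF c, of 1] by (auto simp: orbit_eq_singleton_iff)
  have tt: "?t \<circ> ?t = id" by simp
  have oo: "orbits_on ?t {0, 1} = {{0, 1}}" "orbits_on id {0, 1} = {{0}, {1}}"
    unfolding orbits_on_def using o by auto
  have m: "dart_map {0, 1} ?t ?t" using t by unfold_locales auto
  have "(0, 1) \<in> conn {0, 1} ?t ?t" using conn_step1[of 0 "{0, 1}" ?t ?t] by simp
  with dart_map.conn_sym[OF m this] have "planar_diagram ?D"
    using m by (intro planar_diagramI) (auto simp: oo[simplified] tt)
  moreover have tc: "two_cells ?D = {}" by (simp add: two_cells_def oo[simplified] o[simplified])
  ultimately have "van_kampen_diagram X (R \<union> Z) ?D"
    using l by (auto simp: van_kampen_diagram_def)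
  moreover have "boundary_label ?D = l # inv_letter l # boundary_label D"
    using is_cycle_orbit(1)[OF c] True by (simp add: boundary_label_def face_word_cycle_from)
  moreover have "relative_area R ?D = relative_area R D"
  proof -
    have "two_cells D = {}" using True by (simp add: two_cells_def orbits_on_def)
    then show ?thesis unfolding relative_area_def tc by simp
  qed
  ultimately show ?thesis using that[of ?D] by simp
next
  case False
  have pl: "planar_diagram D" using vk by (simp add: van_kampen_diagram_def)
  note pd = planar_diagramD[OF pl False]
  interpret dart_map "darts D" "opp D" "nxt D" by (rule pd(1))
  have lab: "\<And>d. d \<in> darts D \<Longrightarrow> fst (lab D d) \<in> X \<and> lab D (opp D d) = inv_letter (lab D d)"
    and cells: "\<And>F. F \<in> two_cells D \<Longrightarrow> labelled_by D F (R \<union> Z)"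
    using vk by (auto simp: van_kampen_diagram_def)
  obtain p where p: "p \<notin> darts D" using ex_new_if_finite[OF infinite_UNIV_nat fin] by blast
  obtain q where q': "q \<notin> insert p (darts D)" using ex_new_if_finite[OF infinite_UNIV_nat, of "insert p (darts D)"] fin by blast
  then have q: "q \<notin> darts D" "p \<noteq> q" by auto
  note c = is_cycle_cycle_from[OF n fin, of "base D"]
  obtain vs x where vx: "cycle_from (nxt D) (base D) = vs @ [x]" using c(4) by (cases "cycle_from (nxt D) (base D)" rule: rev_cases) auto
  have cv: "is_cycle (nxt D) (vs @ [x])" using c(1) vx by simp
  have ob: "orbit (nxt D) (base D) = set (vs @ [x])" using c(3) vx by simp
  have x: "x \<in> darts D" using permutes_orbit_subset[OF n pd(3)] ob by auto
  have eul: "card (orbits_on (nxt D \<circ> opp D) (darts D)) + card (orbits_on (nxt D) (darts D))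
          = card (orbits_on (opp D) (darts D)) + 2" using pl False by (simp add: planar_diagram_def)
  let ?n = "nxt D \<circ> transpose p q \<circ> transpose x q" and ?a = "opp D \<circ> transpose p q"
  let ?D = "\<lparr>darts = insert p (insert q (darts D)), opp = ?a, nxt = ?n, lab = (lab D)(p := l, q := inv_letter l), base = p\<rparr>"
  have cn: "\<forall>d\<in>darts D. \<forall>e\<in>darts D. (d, e) \<in> conn (darts D) (opp D) (nxt D)" using pd(4) by blast
  note at = attach_spur[OF pd(1) p q cn eul cv x]
  have "planar_diagram ?D" by (rule planar_diagramI) (use at(1,2,3) in auto)
  have fixp: "opp D p = p" "opp D q = q" using permutes_not_in[OF a] p q by auto
  have on: "orbit ?n p = set (p # q # vs @ [x])" by (rule is_cycle_orbit(2)[OF at(4) list.set_intros(1)])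
  have tc: "two_cells ?D = two_cells D" using at(5) by (simp add: two_cells_def on ob)
  have n': "?n permutes insert p (insert q (darts D))" "finite (insert p (insert q (darts D)))"
    using at(1) by (auto simp: dart_map_def)
  have sub: "set (cycle_from (nxt D) d) \<subseteq> darts D" if "d \<in> darts D" for d
    using is_cycle_cycle_from(3)[OF n fin, of d] permutes_orbit_subset[OF n that] by simp
  have labc: "map ((lab D)(p := l, q := inv_letter l)) ys = map (lab D) ys" if "set ys \<subseteq> darts D" for ys
    using that p q by (intro map_cong) auto
  have fw: "face_word ?D d = face_word D d" if "d \<in> darts D" "d \<notin> set (vs @ [x])" for d
    using at(6)[OF that] labc[OF sub[OF that(1)]] by (simp add: face_word_cycle_from)
  have lb: "labelled_by ?D F Rels \<longleftrightarrow> labelled_by D F Rels" if F: "F \<in> two_cells D" for F and Rels :: "'a word set"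
  proof -
    obtain d where d: "d \<in> darts D" "F = orbit (nxt D) d" "F \<noteq> set (vs @ [x])"
      using F by (auto simp: two_cells_def orbits_on_def ob)
    have "d' \<in> darts D \<and> d' \<notin> set (vs @ [x])" if "d' \<in> F" for d'
      using that permutes_orbit_subset[OF n d(1)] orbit_eq_orbit[OF n fin, of d' d]
        orbit_eq_orbit[OF n fin, of d' "base D"] d ob by auto
    then show ?thesis using fw by (auto simp: labelled_by_def)
  qed
  have labs: "fst (lab ?D d) \<in> X \<and> lab ?D (opp ?D d) = inv_letter (lab ?D d)" if "d \<in> darts ?D" for d
  proof -
    consider "d = p" | "d = q" | "d \<in> darts D" "d \<noteq> p" "d \<noteq> q" using \<open>d \<in> darts ?D\<close> p q by auto
    then show ?thesis
    proof cases
      case 3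
      then have "opp D d \<in> darts D" using permutes_in_image[OF a] by simp
      then have "opp D d \<noteq> p" "opp D d \<noteq> q" using p q by auto
      then show ?thesis using 3 lab by simp
    qed (use fixp p q l in auto)
  qed
  have "van_kampen_diagram X (R \<union> Z) ?D"
    unfolding van_kampen_diagram_def
  proof (intro conjI ballI)
    show "planar_diagram ?D" by fact
    show "labelled_by ?D F (R \<union> Z)" if "F \<in> two_cells ?D" for F
      using that cells lb unfolding tc by blast
    show "[lab ?D d] \<in> words X" "lab ?D (opp ?D d) = inv_letter (lab ?D d)" if "d \<in> darts ?D" for d
      using labs[OF that] by simp_all
  qed
  moreover have "boundary_label ?D = l # inv_letter l # boundary_label D"
  proof -
    have "map (lab ?D) (vs @ [x]) = map (lab D) (vs @ [x])"
      using labc[of "vs @ [x]"] sub[OF pd(3)] vx by simp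
    then show ?thesis using is_cycle_orbit(1)[OF at(4)] False vx q(2)
      by (simp add: boundary_label_def face_word_cycle_from)
  qed
  moreover have "relative_area R ?D = relative_area R D"
  proof -
    have "{F \<in> two_cells D. labelled_by ?D F R} = {F \<in> two_cells D. labelled_by D F R}"
      using lb by blast
    then show ?thesis unfolding relative_area_def tc by (rule arg_cong)
  qed
  moreover have "nxt ?D (base ?D) = opp ?D (base ?D)"
  proof -
    have "?n p = q" using is_cycle_next[of ?n "[]" p "q # vs @ [x]"] at(4) by simp
    then show ?thesis using fixp by simp
  qed
  ultimately show ?thesis using that[of ?D] by simp
qed

text \<open>The hypothesis \<open>excl\<close> ensures that a free cell does not count for the area by accident.\<close>
lemma cell_diagram:
  assumes vk: "van_kampen_diagram X (R \<union> Z) D" and bl: "boundary_label D = l # inv_letter l # u @ v"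
    and sp: "nxt D (base D) = opp D (base D)"
    and T: "face_label R Z (inv_letter l # u) c"
    and excl: "\<And>t. t \<noteq> [] \<Longrightarrow> t \<in> words X \<Longrightarrow> cyclic_relator Z t \<Longrightarrow> \<not> cyclic_relator R t"
  obtains D' where "van_kampen_diagram X (R \<union> Z) D'" "boundary_label D' = l # v"
    "relative_area R D' \<le> relative_area R D + c"
proof -
  have ne: "darts D \<noteq> {}" using bl by (auto simp: boundary_label_def)
  have pl: "planar_diagram D" using vk by (simp add: van_kampen_diagram_def)
  note pd = planar_diagramD[OF pl ne]
  interpret dart_map "darts D" "opp D" "nxt D" by (rule pd(1))
  have lab: "\<And>d. d \<in> darts D \<Longrightarrow> fst (lab D d) \<in> X \<and> lab D (opp D d) = inv_letter (lab D d)"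
    and cells: "\<And>F. F \<in> two_cells D \<Longrightarrow> labelled_by D F (R \<union> Z)"
    using vk by (auto simp: van_kampen_diagram_def)
  let ?p = "base D" 
  note c = is_cycle_cycle_from[OF n fin, of ?p]
  have ml: "map (lab D) (cycle_from (nxt D) ?p) = l # inv_letter l # u @ v"
    using bl ne by (simp add: boundary_label_def face_word_cycle_from)
  then obtain q us vs where cf: "cycle_from (nxt D) ?p = ?p # q # us @ vs" "lab D ?p = l" "lab D q = inv_letter l"
    "map (lab D) us = u" "map (lab D) vs = v"
    using c(2) by (auto simp: map_eq_Cons_conv map_eq_append_conv)
  have "q = opp D ?p" using is_cycle_next[of "nxt D" "[]" ?p "q # us @ vs"] c(1) cf(1) sp by simp
  then have cy: "is_cycle (nxt D) (?p # opp D ?p # us @ vs)" using c(1) cf(1) by simp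
  have eul: "card (orbits_on (nxt D \<circ> opp D) (darts D)) + card (orbits_on (nxt D) (darts D))
          = card (orbits_on (opp D) (darts D)) + 2" using pl ne by (simp add: planar_diagram_def)
  let ?n = "nxt D \<circ> transpose ?p (last (opp D ?p # us))"
  let ?D = "D\<lparr>nxt := ?n\<rparr>"
  let ?O = "set (?p # opp D ?p # us @ vs)"
  have cn: "\<forall>d\<in>darts D. \<forall>e\<in>darts D. (d, e) \<in> conn (darts D) (opp D) (nxt D)" using pd(4) by blast
  note at = attach_cell[OF pd(1) cn eul cy pd(3)]
  have ob: "orbit (nxt D) ?p = ?O" by (rule is_cycle_orbit(2)[OF cy list.set_intros(1)])
  have n': "?n permutes darts D" using at(1) by (simp add: dart_map_def)
  have on: "orbit ?n ?p = set (?p # vs)" by (rule is_cycle_orbit(2)[OF at(4) list.set_intros(1)])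
  have oq: "orbit ?n (opp D ?p) = set (opp D ?p # us)" by (rule is_cycle_orbit(2)[OF at(5) list.set_intros(1)])
  have tc: "two_cells ?D \<subseteq> insert (set (opp D ?p # us)) (two_cells D)"
  proof -
    have "two_cells ?D = orbits_on ?n (darts D) - {orbit ?n ?p}" by (simp add: two_cells_def)
    moreover have "two_cells D = orbits_on (nxt D) (darts D) - {?O}" by (simp only: two_cells_def ob)
    ultimately show ?thesis unfolding on at(6) by blast
  qed
  have "planar_diagram ?D" by (rule planar_diagramI) (use at(1,2,3) pd(3) in auto)
  have fw: "face_word ?D d = face_word D d" if "d \<in> darts D" "d \<notin> ?O" for d
    using at(7)[OF that] by (simp add: face_word_cycle_from)
  have lb: "labelled_by ?D F Rels \<longleftrightarrow> labelled_by D F Rels" if F: "F \<in> two_cells D" for F and Rels :: "'a word set"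
  proof -
    obtain d where d: "d \<in> darts D" "F = orbit (nxt D) d" "F \<noteq> ?O"
      using F by (auto simp: two_cells_def orbits_on_def ob)
    have "d' \<in> darts D \<and> d' \<notin> ?O" if "d' \<in> F" for d'
      using that permutes_orbit_subset[OF n d(1)] orbit_eq_orbit[OF n fin, of d' d]
        orbit_eq_orbit[OF n fin, of d' ?p] d unfolding ob by blast
    then show ?thesis using fw by (auto simp: labelled_by_def)
  qed
  have fq: "face_word ?D (opp D ?p) = inv_letter l # u"
    using is_cycle_orbit(1)[OF at(5)] cf \<open>q = opp D ?p\<close> by (simp add: face_word_cycle_from)
  have lq: "labelled_by ?D (set (opp D ?p # us)) Rels \<longleftrightarrow> cyclic_relator Rels (inv_letter l # u)" for Rels :: "'a word set"
    using labelled_by_iff[of ?D "darts D" "opp D ?p" Rels] n' fin fq oq by simp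
  have "cyclic_relator (R \<union> Z) (inv_letter l # u)"
    using T by (auto simp: face_label_def cyclic_relator_Un)
  then have "van_kampen_diagram X (R \<union> Z) ?D"
    unfolding van_kampen_diagram_def
    using \<open>planar_diagram ?D\<close> lab cells tc lb lq by auto
  moreover have "boundary_label ?D = l # v"
    using is_cycle_orbit(1)[OF at(4)] ne cf by (simp add: boundary_label_def face_word_cycle_from)
  moreover have "relative_area R ?D \<le> relative_area R D + c"
  proof -
    have fin2: "finite (two_cells D)" using fin by (simp add: two_cells_def orbits_on_def)
    have "map (lab D) (cycle_from (nxt D) ?p) \<in> words X"
      using lab c(3) permutes_orbit_subset[OF n pd(3)] by (auto simp: words_iff)
    then have wd: "inv_letter l # u \<in> words X" using ml by simp
    show ?thesis
    proof (cases "cyclic_relator R (inv_letter l # u)")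
      case True
      then have "c = 1" using T excl[OF _ wd] by (auto simp: face_label_def)
      have "{F \<in> two_cells ?D. labelled_by ?D F R} \<subseteq> insert (set (opp D ?p # us)) {F \<in> two_cells D. labelled_by D F R}"
        using tc lb by auto
      then have "relative_area R ?D \<le> card (insert (set (opp D ?p # us)) {F \<in> two_cells D. labelled_by D F R})"
        unfolding relative_area_def by (rule card_mono[rotated]) (use fin2 in simp)
      also have "\<dots> \<le> Suc (relative_area R D)"
        unfolding relative_area_def using fin2 by (simp add: card_insert_if)
      finally show ?thesis using \<open>c = 1\<close> by simp
    next
      case False
      then have "{F \<in> two_cells ?D. labelled_by ?D F R} \<subseteq> {F \<in> two_cells D. labelled_by D F R}"
        using tc lb lq by auto
      then have "relative_area R ?D \<le> relative_area R D"
        unfolding relative_area_def by (rule card_mono[rotated]) (use fin2 in simp)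
      then show ?thesis by simp
    qed
  qed
  ultimately show ?thesis using that[of ?D] by simp
qed

text \<open>A disc is built inside any outer corner of a given diagram. In this form the induction needs two
  moves only, adding a spur and closing a cell, and no gluing of two diagrams.\<close>
lemma diagram_of_disc:
  assumes excl: "\<And>t. t \<noteq> [] \<Longrightarrow> t \<in> words X \<Longrightarrow> cyclic_relator Z t \<Longrightarrow> \<not> cyclic_relator R t"
  shows "disc X (face_label R Z) n k a \<Longrightarrow> bounds_diagram X R Z j (u @ v) \<Longrightarrow>
    bounds_diagram X R Z (j + k) (u @ a @ v)"
proof (induction arbitrary: j u v rule: disc.induct)
  case nil
  then show ?case by simp
next
  case (spur m i a n k b e)
  have "bounds_diagram X R Z j (v @ u)" using bounds_diagram_rotate[OF spur.prems] .
  then obtain D where D: "van_kampen_diagram X (R \<union> Z) D" "boundary_label D = v @ u" "relative_area R D \<le> j"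
    unfolding bounds_diagram_def by blast
  obtain D' where D': "van_kampen_diagram X (R \<union> Z) D'" "boundary_label D' = e # inv_letter e # boundary_label D"
    "relative_area R D' = relative_area R D" "darts D' \<noteq> {}" "nxt D' (base D') = opp D' (base D')"
    by (rule spur_diagram[OF D(1) spur.hyps(3)])
  have "bounds_diagram X R Z j ((e # inv_letter e # v) @ u)"
    unfolding bounds_diagram_def by (intro exI[of _ D']) (use D D' in simp)
  from bounds_diagram_rotate[OF this] have "bounds_diagram X R Z j ((u @ [e]) @ (inv_letter e # v))" by simp
  from spur.IH(1)[OF this] have "bounds_diagram X R Z (j + i) ((u @ e # a @ [inv_letter e]) @ v)" by simp
  from spur.IH(2)[OF this] show ?case by (simp add: add.assoc)
next
  case (cell n k q w e c)
  have "bounds_diagram X R Z (j + k) (u @ q @ w @ v)" using cell.IH[OF cell.prems] by simp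
  then have "bounds_diagram X R Z (j + k) (q @ w @ v @ u)"
    using bounds_diagram_rotate[of X R Z "j + k" u "q @ w @ v"] by simp
  then obtain D where D: "van_kampen_diagram X (R \<union> Z) D" "boundary_label D = q @ w @ v @ u" "relative_area R D \<le> j + k"
    unfolding bounds_diagram_def by blast
  obtain D' where D': "van_kampen_diagram X (R \<union> Z) D'" "boundary_label D' = e # inv_letter e # boundary_label D"
    "relative_area R D' = relative_area R D" "darts D' \<noteq> {}" "nxt D' (base D') = opp D' (base D')"
    by (rule spur_diagram[OF D(1) cell.hyps(2)])
  have bl: "boundary_label D' = e # inv_letter e # q @ (w @ v @ u)" using D'(2) D(2) by simp
  obtain D'' where D'': "van_kampen_diagram X (R \<union> Z) D''" "boundary_label D'' = e # w @ v @ u"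
    "relative_area R D'' \<le> relative_area R D' + c"
    by (rule cell_diagram[OF D'(1) bl D'(5) cell.hyps(3) excl])
  have "bounds_diagram X R Z (j + (k + c)) ((e # w @ v) @ u)"
    unfolding bounds_diagram_def by (intro exI[of _ D'']) (use D D' D'' in simp)
  from bounds_diagram_rotate[OF this] show ?case by simp
qed

lemma diagram_of_fills:
  assumes excl: "\<And>t. t \<noteq> [] \<Longrightarrow> t \<in> words X \<Longrightarrow> cyclic_relator Z t \<Longrightarrow> \<not> cyclic_relator R t"
    and f: "fills X (face_label R Z) k w"
  shows "bounds_diagram X R Z k w"
proof -
  obtain n k' where k': "k' \<le> k" "disc X (face_label R Z) n k' w" using f unfolding fills_def by blast
  have "bounds_diagram X R Z (0 + k') ([] @ w @ [])"
    by (rule diagram_of_disc[OF excl k'(2)]) (simp_all add: bounds_diagram_Nil)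
  then have "bounds_diagram X R Z k' w" by simp
  then obtain D where "van_kampen_diagram X (R \<union> Z) D" "boundary_label D = w" "relative_area R D \<le> k'"
    unfolding bounds_diagram_def by blast
  then show ?thesis using k'(1) unfolding bounds_diagram_def by (intro exI[of _ D]) simp
qed

section \<open>Evaluation of words\<close>
definition letter_val :: "('a, 'm) monoid_scheme \<Rightarrow> ('x \<Rightarrow> 'a) \<Rightarrow> 'x letter \<Rightarrow> 'a" where
  "letter_val G f l = (if snd l then f (fst l) else inv\<^bsub>G\<^esub> (f (fst l)))"

lemma fst_set_inv_word [simp]: "fst ` set (inv_word w) = fst ` set w"
  by (induction w) auto

lemma word_val_Nil [simp]: "word_val G f [] = \<one>\<^bsub>G\<^esub>"
  by (simp add: word_val_def)

lemma word_val_Cons: "word_val G f (l # w) = letter_val G f l \<otimes>\<^bsub>G\<^esub> word_val G f w"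
  by (simp add: word_val_def letter_val_def split_beta)

context group
begin

lemma letter_val_closed: "f ` X \<subseteq> carrier G \<Longrightarrow> fst l \<in> X \<Longrightarrow> letter_val G f l \<in> carrier G"
  by (auto simp: letter_val_def)

lemma letter_val_inv: "f ` X \<subseteq> carrier G \<Longrightarrow> fst l \<in> X \<Longrightarrow> letter_val G f (inv_letter l) = inv (letter_val G f l)"
  by (auto simp: letter_val_def inv_letter_def)

lemma word_val_closed: "f ` X \<subseteq> carrier G \<Longrightarrow> w \<in> words X \<Longrightarrow> word_val G f w \<in> carrier G"
  by (induction w) (auto simp: word_val_Cons letter_val_closed)

lemma word_val_append:
  "f ` X \<subseteq> carrier G \<Longrightarrow> u \<in> words X \<Longrightarrow> v \<in> words X \<Longrightarrow>
    word_val G f (u @ v) = word_val G f u \<otimes> word_val G f v"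
proof (induction u)
  case Nil
  then show ?case using word_val_closed[of f X v] by simp
next
  case (Cons l u)
  then show ?case using word_val_closed[of f X v] word_val_closed[of f X u] letter_val_closed[of f X l]
    by (simp add: word_val_Cons m_assoc)
qed

lemma word_val_inv_word:
  "f ` X \<subseteq> carrier G \<Longrightarrow> w \<in> words X \<Longrightarrow> word_val G f (inv_word w) = inv (word_val G f w)"
proof (induction w)
  case (Cons l w)
  then have c: "letter_val G f l \<in> carrier G" "word_val G f w \<in> carrier G"
    using letter_val_closed[of f X l] word_val_closed[of f X w] by auto
  have "word_val G f (inv_word w @ [inv_letter l]) = word_val G f (inv_word w) \<otimes> word_val G f [inv_letter l]"
    using Cons by (intro word_val_append[of f X]) auto
  also have "word_val G f [inv_letter l] = inv (letter_val G f l)"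
    using Cons c letter_val_inv[of f X l] by (simp add: word_val_Cons)
  finally show ?case using Cons c by (simp add: word_val_Cons inv_mult_group)
qed simp

lemma pres_eq_sound:
  assumes f: "f ` X \<subseteq> carrier G" and R: "Rels \<subseteq> words X" "\<And>r. r \<in> Rels \<Longrightarrow> word_val G f r = \<one>"
  shows "pres_eq X Rels u v \<Longrightarrow> u \<in> words X \<and> v \<in> words X \<and> word_val G f u = word_val G f v"
proof (induction rule: pres_eq.induct)
  case (mult u u' v v')
  then show ?case using word_val_append[OF f] by simp
next
  case (cancel l)
  then have "fst l \<in> X" by simp
  then show ?case using letter_val_closed[OF f, of l] letter_val_inv[OF f, of l] by (simp add: word_val_Cons)
qed (use R in auto)

end

lemma relator_trivial:
  assumes "is_presentation G f X Rels" "r \<in> Rels"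
  shows "r \<in> words X" "word_val G f r = \<one>\<^bsub>G\<^esub>"
proof -
  show r: "r \<in> words X" using assms by (auto simp: is_presentation_def)
  have "pres_eq X Rels r []" using assms(2) by (rule pres_eq.relator)
  then show "word_val G f r = \<one>\<^bsub>G\<^esub>"
    using assms(1) r unfolding is_presentation_def by (metis word_val_Nil words_Nil)
qed

section \<open>Fillable words are trivial in the presented group\<close>

lemma pres_eq_context:
  "pres_eq X Rels v v' \<Longrightarrow> u \<in> words X \<Longrightarrow> w \<in> words X \<Longrightarrow> pres_eq X Rels (u @ v @ w) (u @ v' @ w)"
  by (intro pres_eq.mult pres_eq.refl)

lemma pres_eq_inv_right: "w \<in> words X \<Longrightarrow> pres_eq X Rels (w @ inv_word w) []"
proof (induction w)
  case Nil
  then show ?case by (simp add: pres_eq.refl)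
next
  case (Cons l w)
  then have "pres_eq X Rels ([l] @ (w @ inv_word w) @ [inv_letter l]) ([l] @ [] @ [inv_letter l])"
    by (intro pres_eq_context) auto
  moreover have "pres_eq X Rels [l, inv_letter l] []" using Cons by (intro pres_eq.cancel) simp
  ultimately show ?case using pres_eq.trans by fastforce
qed

lemma pres_eq_inv_left: "w \<in> words X \<Longrightarrow> pres_eq X Rels (inv_word w @ w) []"
  using pres_eq_inv_right[of "inv_word w"] by simp

lemma pres_eq_rotate_Nil:
  assumes vu: "pres_eq X Rels (v @ u) []" and w: "u \<in> words X" "v \<in> words X"
  shows "pres_eq X Rels (u @ v) []"
proof -
  have "pres_eq X Rels ((u @ v) @ (u @ inv_word u)) ((u @ v) @ [])"
    using w by (intro pres_eq.mult pres_eq_inv_right pres_eq.refl) auto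
  then have "pres_eq X Rels (u @ v) (u @ (v @ u) @ inv_word u)"
    by (simp add: pres_eq.sym)
  moreover have "pres_eq X Rels (u @ (v @ u) @ inv_word u) (u @ [] @ inv_word u)"
    using vu w by (intro pres_eq_context) auto
  moreover have "pres_eq X Rels (u @ [] @ inv_word u) []" using pres_eq_inv_right[OF w(1)] by simp
  ultimately show ?thesis using pres_eq.trans by blast
qed

lemma pres_eq_inv_Nil:
  assumes "pres_eq X Rels (inv_word w) []" "w \<in> words X"
  shows "pres_eq X Rels w []"
proof -
  have "pres_eq X Rels (w @ inv_word w) (w @ [])" using assms by (intro pres_eq.mult pres_eq.refl)
  then show ?thesis using pres_eq_inv_right[OF assms(2)] pres_eq.trans pres_eq.sym by fastforce
qed

lemma pres_eq_cyclic_relator: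
  assumes "cyclic_relator Rels t" "t \<in> words X"
  shows "pres_eq X Rels t []"
proof -
  obtain u v where uv: "t = u @ v" "v @ u \<in> Rels \<or> inv_word (v @ u) \<in> Rels"
    using assms(1) by (auto simp: cyclic_relator_def)
  have w: "u \<in> words X" "v \<in> words X" using assms(2) uv by auto
  have "pres_eq X Rels (v @ u) []"
    using uv(2) pres_eq.relator pres_eq_inv_Nil[of X Rels "v @ u"] w by auto
  then show ?thesis using pres_eq_rotate_Nil w uv by blast
qed

lemma pres_eq_of_disc:
  assumes R: "\<And>t c. T t c \<Longrightarrow> cyclic_relator Rels t"
  shows "disc X T n k w \<Longrightarrow> pres_eq X Rels w []"
proof (induction rule: disc.induct)
  case nil
  then show ?case by (simp add: pres_eq.refl)
next
  case (spur m i a n j b e)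
  have b: "b \<in> words X" by (rule disc_words[OF spur.hyps(2)])
  have "pres_eq X Rels ([e] @ a @ (inv_letter e # b)) ([e] @ [] @ (inv_letter e # b))"
    using spur b by (intro pres_eq_context) auto
  then have 1: "pres_eq X Rels (e # a @ inv_letter e # b) ([e, inv_letter e] @ b)" by simp
  have "pres_eq X Rels ([e, inv_letter e] @ b) ([] @ b)"
    using spur b by (intro pres_eq.mult pres_eq.cancel pres_eq.refl) auto
  then have 2: "pres_eq X Rels ([e, inv_letter e] @ b) b" by simp
  show ?case using pres_eq.trans[OF 1 pres_eq.trans[OF 2 spur.IH(2)]] .
next
  case (cell n k q v e c)
  have w: "q \<in> words X" "v \<in> words X" using disc_words[OF cell.hyps(1)] by auto
  let ?t = "inv_letter e # q"
  have t: "pres_eq X Rels ?t []" using R[OF cell.hyps(3)] w cell.hyps(2) by (intro pres_eq_cyclic_relator) auto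
  have "pres_eq X Rels ([e] @ ?t @ v) ([e] @ [] @ v)"
    using t w cell.hyps(2) by (intro pres_eq_context) auto
  then have 1: "pres_eq X Rels (e # v) ([e, inv_letter e] @ (q @ v))" by (simp add: pres_eq.sym)
  have "pres_eq X Rels ([e, inv_letter e] @ (q @ v)) ([] @ (q @ v))"
    using w cell.hyps(2) by (intro pres_eq.mult pres_eq.cancel pres_eq.refl) auto
  then have 2: "pres_eq X Rels ([e, inv_letter e] @ (q @ v)) (q @ v)" by simp
  show ?case using pres_eq.trans[OF 1 pres_eq.trans[OF 2 cell.IH]] .
qed

section \<open>Relative hyperbolicity in terms of fillings\<close>

abbreviation rel_label :: "('a, 'm) monoid_scheme \<Rightarrow> 'l set \<Rightarrow> ('l \<Rightarrow> 'a set) \<Rightarrow> ('a, 'l) gen word set \<Rightarrow>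
    ('a, 'l) gen word \<Rightarrow> nat \<Rightarrow> bool" where
  "rel_label G \<Lambda> H R \<equiv> face_label R (peripheral_relators G \<Lambda> H)"

lemma gen_val_simps [simp]: "gen_val (Inl s) = s" "gen_val (Inr (i, h)) = h"
  by (simp_all add: gen_val_def)

lemma rel_gens_simps [simp]:
  "Inl s \<in> rel_gens S \<Lambda> H \<longleftrightarrow> s \<in> S" "Inr (i, h) \<in> rel_gens S \<Lambda> H \<longleftrightarrow> i \<in> \<Lambda> \<and> h \<in> H i"
  by (auto simp: rel_gens_def)

lemma gen_val_rel_gens:
  "S \<subseteq> carrier G \<Longrightarrow> (\<And>i. i \<in> \<Lambda> \<Longrightarrow> H i \<subseteq> carrier G) \<Longrightarrow> gen_val ` rel_gens S \<Lambda> H \<subseteq> carrier G"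
  by (force simp: rel_gens_def)

lemma peripheral_relators_iff:
  "w \<in> peripheral_relators G \<Lambda> H \<longleftrightarrow>
    (\<exists>i\<in>\<Lambda>. (\<forall>l\<in>set w. \<exists>h\<in>H i. fst l = Inr (i, h)) \<and> word_val G gen_val w = \<one>\<^bsub>G\<^esub>)"
  by (auto simp: peripheral_relators_def words_iff image_iff subset_iff)

lemma peripheral_relators_words: "peripheral_relators G \<Lambda> H \<subseteq> words (rel_gens S \<Lambda> H)"
  by (force simp: peripheral_relators_def words_iff rel_gens_def)

lemma (in group) cyclic_peripheral:
  assumes H: "\<And>i. i \<in> \<Lambda> \<Longrightarrow> H i \<subseteq> carrier G"
  shows "cyclic_relator (peripheral_relators G \<Lambda> H) t \<longleftrightarrow> t \<in> peripheral_relators G \<Lambda> H"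
proof
  assume "cyclic_relator (peripheral_relators G \<Lambda> H) t"
  then obtain u v where uv: "t = u @ v" "v @ u \<in> peripheral_relators G \<Lambda> H \<or> inv_word (v @ u) \<in> peripheral_relators G \<Lambda> H"
    by (auto simp: cyclic_relator_def)
  then obtain i where i: "i \<in> \<Lambda>" "u \<in> words (Inr ` ({i} \<times> H i))" "v \<in> words (Inr ` ({i} \<times> H i))"
    "word_val G gen_val (v @ u) = \<one> \<or> word_val G gen_val (inv_word (v @ u)) = \<one>"
    by (auto simp: peripheral_relators_def simp del: inv_word_append) 
  have f: "gen_val ` Inr ` ({i} \<times> H i) \<subseteq> carrier G" using H[OF i(1)] by auto
  have c: "word_val G gen_val u \<in> carrier G" "word_val G gen_val v \<in> carrier G"
    using word_val_closed[OF f] i by auto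
  have "word_val G gen_val (v @ u) = \<one>"
    using i(4) word_val_inv_word[OF f, of "v @ u"] word_val_closed[OF f, of "v @ u"] i(2,3) by auto
  then have "word_val G gen_val (u @ v) = \<one>"
    using word_val_append[OF f i(2,3)] word_val_append[OF f i(3,2)] c by (metis inv_comm)
  then show "t \<in> peripheral_relators G \<Lambda> H" using uv(1) i by (auto simp: peripheral_relators_def)
qed (rule cyclic_relatorI)

text \<open>A nonempty normal form in the letters of a single peripheral subgroup is one nontrivial element,
  and hence not a relator.\<close>
lemma (in group) peripheral_not_relator:
  assumes H: "\<And>i. i \<in> \<Lambda> \<Longrightarrow> H i \<subseteq> carrier G"
    and R: "R \<subseteq> free_product_elements G S \<Lambda> H" "\<And>r. r \<in> R \<Longrightarrow> word_val G gen_val r = \<one>"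
    and t: "t \<noteq> []" "cyclic_relator (peripheral_relators G \<Lambda> H) t"
  shows "\<not> cyclic_relator R t"
proof
  assume "cyclic_relator R t"
  then obtain u v where uv: "t = u @ v" "v @ u \<in> R \<or> inv_word (v @ u) \<in> R"
    by (auto simp: cyclic_relator_def)
  have "t \<in> peripheral_relators G \<Lambda> H" using t(2) cyclic_peripheral[of \<Lambda> H t] H by blast
  then obtain i where i: "i \<in> \<Lambda>" "\<And>l. l \<in> set t \<Longrightarrow> \<exists>h\<in>H i. fst l = Inr (i, h)"
    by (auto simp: peripheral_relators_iff)
  define r where "r = (if v @ u \<in> R then v @ u else inv_word (v @ u))"
  have r: "r \<in> R" "r \<noteq> []" using uv t(1) by (auto simp: r_def inv_word_def)
  have ri: "\<exists>h\<in>H i. fst l = Inr (i, h)" if "l \<in> set r" for l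
  proof -
    have "fst ` set r = fst ` set t" by (simp add: r_def uv(1) image_Un Un_commute)
    then have "fst l \<in> fst ` set t" using that by blast
    then obtain l' where l': "l' \<in> set t" "fst l = fst l'" by (rule imageE)
    show ?thesis using i(2)[OF l'(1)] unfolding l'(2) .
  qed
  have fp: "\<And>i h b. (Inr (i, h), b) \<in> set r \<Longrightarrow> h \<noteq> \<one> \<and> b" "successively nf_adjacent r"
    using r(1) R(1) by (auto simp: free_product_elements_def)
  obtain l r' where lr: "r = l # r'" using r(2) by (cases r) auto
  obtain h b where l: "l = (Inr (i, h), b)" "h \<in> H i" using ri[of l] lr by (cases l) auto
  show False
  proof (cases r')
    case Nil
    have "h \<noteq> \<one>" "b" using fp(1)[of i h b] lr l by auto
    moreover have "word_val G gen_val r = h" using H[OF i(1)] l lr Nil \<open>b\<close> by (auto simp: word_val_Cons letter_val_def)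
    ultimately show False using R(2)[OF r(1)] by simp
  next
    case (Cons l' r'')
    then obtain h' b' where "l' = (Inr (i, h'), b')" using ri[of l'] lr by (cases l') auto
    then show False using fp(2) lr l Cons by simp
  qed
qed

text \<open>Relative hyperbolicity is used through the following two rules only, in which diagrams have been
  replaced by disc words.\<close>
lemma relatively_hyperbolicD:
  assumes "relatively_hyperbolic G \<Lambda> H"
  obtains S R and C :: real where "group G" "\<And>i. i \<in> \<Lambda> \<Longrightarrow> subgroup (H i) G"
    "finite S" "S \<subseteq> carrier G" "finite R" "R \<subseteq> free_product_elements G S \<Lambda> H" "0 \<le> C"
    "is_presentation G gen_val (rel_gens S \<Lambda> H) (R \<union> peripheral_relators G \<Lambda> H)"
    "\<And>w. w \<in> words (rel_gens S \<Lambda> H) \<Longrightarrow> word_val G gen_val w = \<one>\<^bsub>G\<^esub> \<Longrightarrow>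
      \<exists>k. fills (rel_gens S \<Lambda> H) (rel_label G \<Lambda> H R) k w \<and> real k \<le> C * real (length w)"
proof -
  from assms obtain S R where 1: "group G" "\<And>i. i \<in> \<Lambda> \<Longrightarrow> subgroup (H i) G"
    and p: "finite_relative_presentation G \<Lambda> H S R" and l: "linear_relative_isoperimetry G \<Lambda> H S R"
    unfolding relatively_hyperbolic_def by blast
  from l obtain C :: real where C: "\<And>w. w \<in> words (rel_gens S \<Lambda> H) \<Longrightarrow> word_val G gen_val w = \<one>\<^bsub>G\<^esub> \<Longrightarrow>
    \<exists>D. van_kampen_diagram (rel_gens S \<Lambda> H) (R \<union> peripheral_relators G \<Lambda> H) D \<and>
             boundary_label D = w \<and> real (relative_area R D) \<le> C * real (length w)"
    unfolding linear_relative_isoperimetry_def by blast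
  have 2: "\<exists>k. fills (rel_gens S \<Lambda> H) (rel_label G \<Lambda> H R) k w \<and> real k \<le> max 0 C * real (length w)"
    if w: "w \<in> words (rel_gens S \<Lambda> H)" "word_val G gen_val w = \<one>\<^bsub>G\<^esub>" for w
  proof -
    obtain D where D: "van_kampen_diagram (rel_gens S \<Lambda> H) (R \<union> peripheral_relators G \<Lambda> H) D"
      "boundary_label D = w" "real (relative_area R D) \<le> C * real (length w)" using C[OF w] by blast
    have "C * real (length w) \<le> max 0 C * real (length w)" by (intro mult_right_mono) auto
    then show ?thesis using fills_of_diagram[OF D(1)] D(2,3) by (intro exI[of _ "relative_area R D"]) auto
  qed
  show ?thesis
    by (rule that[of S R "max 0 C"]) (use 1 2 p in \<open>auto simp: finite_relative_presentation_def\<close>)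
qed

text \<open>That the relators define the group follows from the linear inequality, since a disc word is
  trivial in the presented group.\<close>
lemma relatively_hyperbolicI:
  fixes G (structure) and C :: real
  assumes "group G" and H: "\<And>i. i \<in> \<Lambda> \<Longrightarrow> subgroup (H i) G"
    and S: "finite S" "S \<subseteq> carrier G"
    and R: "finite R" "R \<subseteq> free_product_elements G S \<Lambda> H" "\<And>r. r \<in> R \<Longrightarrow> word_val G gen_val r = \<one>\<^bsub>G\<^esub>"
    and gen: "carrier G \<subseteq> word_val G gen_val ` words (rel_gens S \<Lambda> H)"
    and fill: "\<And>w. w \<in> words (rel_gens S \<Lambda> H) \<Longrightarrow> word_val G gen_val w = \<one>\<^bsub>G\<^esub> \<Longrightarrow>
      \<exists>k. fills (rel_gens S \<Lambda> H) (rel_label G \<Lambda> H R) k w \<and> real k \<le> C * real (length w)"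
  shows "relatively_hyperbolic G \<Lambda> H"
proof -
  interpret group G by fact
  let ?X = "rel_gens S \<Lambda> H" and ?Z = "peripheral_relators G \<Lambda> H"
  have Hc: "\<And>i. i \<in> \<Lambda> \<Longrightarrow> H i \<subseteq> carrier G" using H subgroup.subset by blast
  have f: "gen_val ` ?X \<subseteq> carrier G" by (rule gen_val_rel_gens[OF S(2) Hc])
  have RZ: "R \<union> ?Z \<subseteq> words ?X"
    using R(2) peripheral_relators_words[of G \<Lambda> H S] by (auto simp: free_product_elements_def)
  have triv: "word_val G gen_val r = \<one>" if "r \<in> R \<union> ?Z" for r
    using that R(3) by (auto simp: peripheral_relators_def)
  have eq: "pres_eq ?X (R \<union> ?Z) u v" if uv: "u \<in> words ?X" "v \<in> words ?X" "word_val G gen_val u = word_val G gen_val v" for u v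
  proof -
    have "word_val G gen_val (u @ inv_word v) = \<one>"
      using uv word_val_append[OF f, of u "inv_word v"] word_val_inv_word[OF f uv(2)] word_val_closed[OF f uv(2)] by simp
    then obtain k where "fills ?X (rel_label G \<Lambda> H R) k (u @ inv_word v)"
      using fill[of "u @ inv_word v"] uv by auto
    then obtain n k' where "disc ?X (rel_label G \<Lambda> H R) n k' (u @ inv_word v)" unfolding fills_def by blast
    from pres_eq_of_disc[OF _ this, of "R \<union> ?Z"] have e: "pres_eq ?X (R \<union> ?Z) (u @ inv_word v) []"
      by (auto simp: face_label_def cyclic_relator_Un)
    have "pres_eq ?X (R \<union> ?Z) ((u @ inv_word v) @ v) ([] @ v)"
      by (intro pres_eq.mult e pres_eq.refl uv)
    moreover have "pres_eq ?X (R \<union> ?Z) (u @ (inv_word v @ v)) (u @ [])"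
      by (intro pres_eq.mult pres_eq_inv_left pres_eq.refl uv)
    ultimately show ?thesis using pres_eq.trans pres_eq.sym by fastforce
  qed
  have "word_val G gen_val ` words ?X = carrier G"
    using gen word_val_closed[OF f] by auto
  then have "is_presentation G gen_val ?X (R \<union> ?Z)"
    unfolding is_presentation_def using group_axioms f RZ eq pres_eq_sound[OF f RZ triv] by blast
  then have "finite_relative_presentation G \<Lambda> H S R"
    unfolding finite_relative_presentation_def using S R by blast
  moreover have "linear_relative_isoperimetry G \<Lambda> H S R"
    unfolding linear_relative_isoperimetry_def
  proof (intro exI[of _ C] ballI impI)
    fix w assume w: "w \<in> words ?X" "word_val G gen_val w = \<one>"
    obtain k where k: "fills ?X (rel_label G \<Lambda> H R) k w" "real k \<le> C * real (length w)" using fill[OF w] by blast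
    have "bounds_diagram ?X R ?Z k w"
      by (rule diagram_of_fills[OF peripheral_not_relator[OF Hc R(2,3)] k(1)])
    then obtain D where D: "van_kampen_diagram ?X (R \<union> ?Z) D" "boundary_label D = w" "relative_area R D \<le> k"
      unfolding bounds_diagram_def by blast
    then show "\<exists>D. van_kampen_diagram ?X (R \<union> ?Z) D \<and> boundary_label D = w \<and>
        real (relative_area R D) \<le> C * real (length w)"
      using k(2) by (intro exI[of _ D]) simp
  qed
  ultimately show ?thesis
    unfolding relatively_hyperbolic_def using group_axioms H by blast
qed

section \<open>Passing to finitely generated peripheral subgroups\<close>

lemma disc_map:
  assumes X: "\<And>l. fst l \<in> X \<Longrightarrow> fst (m l) \<in> Y \<and> m (inv_letter l) = inv_letter (m l)"
    and T: "\<And>t c. t \<in> words X \<Longrightarrow> T t c \<Longrightarrow> T' (map m t) c"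
  shows "disc X T n k w \<Longrightarrow> disc Y T' n k (map m w)"
proof (induction rule: disc.induct)
  case nil
  then show ?case by (simp add: disc.nil)
next
  case (spur p i a q j b e)
  then show ?case using disc.spur[OF spur.IH, of "m e"] X[of e] by simp
next
  case (cell p i q v e c)
  have "T' (map m (inv_letter e # q)) c"
    using T[of "inv_letter e # q" c] cell.hyps disc_words[OF cell.hyps(1)] by simp
  then show ?case using disc.cell[of Y T' p i "map m q" "map m v" "m e" c] cell X[of e] by simp
qed

lemma fills_map:
  assumes X: "\<And>l. fst l \<in> X \<Longrightarrow> fst (m l) \<in> Y \<and> m (inv_letter l) = inv_letter (m l)"
    and T: "\<And>t c. t \<in> words X \<Longrightarrow> T t c \<Longrightarrow> T' (map m t) c"
    and f: "fills X T k w"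
  shows "fills Y T' k (map m w)"
proof -
  obtain n k' where k: "k' \<le> k" "disc X T n k' w" using f unfolding fills_def by blast
  have "disc Y T' n k' (map m w)" by (rule disc_map[where X = X and T = T, OF _ _ k(2)]; fact X T)
  then show ?thesis using k(1) unfolding fills_def by blast
qed

lemma (in group) generate_word_val:
  assumes f: "f ` X \<subseteq> carrier G"
  shows "generate G (f ` X) = word_val G f ` words X"
proof
  show "generate G (f ` X) \<subseteq> word_val G f ` words X"
  proof
    fix g assume "g \<in> generate G (f ` X)"
    then show "g \<in> word_val G f ` words X"
    proof (induction rule: generate.induct)
      case one
      then show ?case by (intro image_eqI[of _ _ "[]"]) auto
    next
      case (incl h)
      then obtain x where x: "x \<in> X" "h = f x" by auto
      then have "h \<in> carrier G" using f by auto
      then show ?case using x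
        by (intro image_eqI[of _ _ "[(x, True)]"]) (auto simp: word_val_Cons letter_val_def)
    next
      case (inv h)
      then obtain x where x: "x \<in> X" "h = f x" by auto
      then have "h \<in> carrier G" using f by auto
      then show ?case using x
        by (intro image_eqI[of _ _ "[(x, False)]"]) (auto simp: word_val_Cons letter_val_def)
    next
      case (eng g h)
      then obtain u v where "u \<in> words X" "g = word_val G f u" "v \<in> words X" "h = word_val G f v" by auto
      then show ?case by (intro image_eqI[of _ _ "u @ v"]) (auto simp: word_val_append[OF f])
    qed
  qed
  show "word_val G f ` words X \<subseteq> generate G (f ` X)"
  proof
    fix g assume "g \<in> word_val G f ` words X"
    then obtain w where w: "w \<in> words X" "g = word_val G f w" by auto
    have "word_val G f w \<in> generate G (f ` X)" using w(1)
    proof (induction w)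
      case Nil
      then show ?case by (simp add: generate.one)
    next
      case (Cons l w)
      then have "letter_val G f l \<in> generate G (f ` X)"
        by (auto simp: letter_val_def intro: generate.incl generate.inv)
      then show ?case using Cons by (auto simp: word_val_Cons intro: generate.eng)
    qed
    then show "g \<in> generate G (f ` X)" using w by simp
  qed
qed

lemma (in group) countable_generate:
  assumes "finite A" "A \<subseteq> carrier G"
  shows "countable (generate G A)"
proof -
  have "countable (words A)" unfolding words_def
    using assms(1) by (intro countable_lists countable_finite) auto
  then show ?thesis using generate_word_val[of id A] assms(2) by simp
qed

lemma (in group) word_val_subgroup:
  assumes K: "subgroup K G" and w: "w \<in> words X" "f ` X \<subseteq> K"
  shows "word_val (G\<lparr>carrier := K\<rparr>) f w = word_val G f w"
  using w(1)
proof (induction w)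
  case (Cons l w)
  then have "f (fst l) \<in> K" using w(2) by auto
  then have "letter_val (G\<lparr>carrier := K\<rparr>) f l = letter_val G f l"
    using m_inv_consistent[OF K] by (simp add: letter_val_def)
  then show ?case using Cons by (simp add: word_val_Cons)
qed simp

text \<open>Choose a representative in every left coset of \<open>K\<close> and measure elements against it.\<close>
lemma (in group) equivariant_retraction:
  assumes K: "subgroup K G"
  obtains \<tau> where "\<And>g. g \<in> carrier G \<Longrightarrow> \<tau> g \<in> K"
    "\<And>g h. g \<in> carrier G \<Longrightarrow> h \<in> K \<Longrightarrow> \<tau> (g \<otimes> h) = \<tau> g \<otimes> h"
proof -
  define \<tau> where "\<tau> g = inv (SOME x. x \<in> g <# K) \<otimes> g" for g
  have KG: "K \<subseteq> carrier G" using K by (rule subgroup.subset)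
  have rep: "\<exists>k\<in>K. (SOME x. x \<in> g <# K) = g \<otimes> k" if "g \<in> carrier G" for g
  proof -
    have "g \<otimes> \<one> \<in> g <# K" using subgroup.one_closed[OF K] by (auto simp: l_coset_def)
    then have "(SOME x. x \<in> g <# K) \<in> g <# K" by (rule someI)
    then show ?thesis by (auto simp: l_coset_def)
  qed
  show ?thesis
  proof (rule that)
    fix g assume g: "g \<in> carrier G"
    obtain k where k: "k \<in> K" "(SOME x. x \<in> g <# K) = g \<otimes> k" using rep[OF g] by blast
    have "\<tau> g = inv k" using g k KG by (auto simp: \<tau>_def inv_mult_group m_assoc subset_iff)
    then show "\<tau> g \<in> K" using k subgroup.m_inv_closed[OF K] by simp
    fix h assume h: "h \<in> K"
    have "(g \<otimes> h) <# K = g <# K"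
    proof (rule l_repr_independence[symmetric])
      show "g \<otimes> h \<in> g <# K" using h by (auto simp: l_coset_def)
    qed (use g K in auto)
    moreover have "h \<in> carrier G" "g \<otimes> k \<in> carrier G" using h k g KG by auto
    ultimately show "\<tau> (g \<otimes> h) = \<tau> g \<otimes> h" using g k by (simp add: \<tau>_def m_assoc)
  qed
qed

text \<open>Relabel a word along the path that it describes.\<close>
primrec walk :: "('s \<Rightarrow> 'x letter \<Rightarrow> 's) \<Rightarrow> ('s \<Rightarrow> 'x letter \<Rightarrow> 'y word) \<Rightarrow> 's \<Rightarrow> 'x word \<Rightarrow> 'y word" where
  "walk step \<phi> g [] = []"
| "walk step \<phi> g (l # w) = \<phi> g l @ walk step \<phi> (step g l) w"

text \<open>Every peripheral letter \<open>h\<close>, read at the position \<open>g\<close>, is replaced by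
  \<open>diff i g h = inv (\<tau> i g) \<otimes> \<tau> i (g \<otimes> h)\<close>, which lies in \<open>K i\<close> and is \<open>h\<close> itself if \<open>h\<close> lies in \<open>K i\<close>; letters whose
  index is outside \<open>\<Lambda>0\<close> are erased. Then \<open>disc_transport\<close> turns a disc over \<open>G\<close> into one over the
  subgroup \<open>\<Gamma>\<close>, with the same cost and, for a word of \<open>\<Gamma>\<close>, with the same boundary.\<close>
theorem core_relatively_hyperbolic:
  fixes G :: "('a, 'm) monoid_scheme" (structure) and \<Lambda> :: "'l set" and C :: real
  assumes G: "group G" and H: "\<And>i. i \<in> \<Lambda> \<Longrightarrow> subgroup (H i) G"
    and S: "finite S" "S \<subseteq> carrier G"
    and R: "finite R" "R \<subseteq> free_product_elements G S \<Lambda> H" "\<And>r. r \<in> R \<Longrightarrow> word_val G gen_val r = \<one>"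
    and fill: "\<And>w. w \<in> words (rel_gens S \<Lambda> H) \<Longrightarrow> word_val G gen_val w = \<one> \<Longrightarrow>
      \<exists>k. fills (rel_gens S \<Lambda> H) (rel_label G \<Lambda> H R) k w \<and> real k \<le> C * real (length w)"
    and \<Lambda>0: "\<Lambda>0 \<subseteq> \<Lambda>" and A: "\<And>i. i \<in> \<Lambda>0 \<Longrightarrow> A i \<subseteq> H i"
    and RA: "\<And>r i h b. r \<in> R \<Longrightarrow> (Inr (i, h), b) \<in> set r \<Longrightarrow> i \<in> \<Lambda>0 \<and> h \<in> A i"
  defines "K \<equiv> \<lambda>i. generate G (A i)" and "\<Gamma> \<equiv> generate G (S \<union> (\<Union>i\<in>\<Lambda>0. A i))"
  shows "relatively_hyperbolic (G\<lparr>carrier := \<Gamma>\<rparr>) \<Lambda>0 K"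
proof -
  interpret group G by (rule G)
  have Hc: "H i \<subseteq> carrier G" if "i \<in> \<Lambda>" for i using H[OF that] by (rule subgroup.subset)
  have gens: "S \<union> (\<Union>i\<in>\<Lambda>0. A i) \<subseteq> carrier G" using S A Hc \<Lambda>0 by blast
  have \<Gamma>: "subgroup \<Gamma> G" unfolding \<Gamma>_def by (rule generate_is_subgroup[OF gens])
  have KH: "K i \<subseteq> H i" if "i \<in> \<Lambda>0" for i
    unfolding K_def using A[OF that] H \<Lambda>0 that by (intro generate_subgroup_incl) auto
  have Ksub: "subgroup (K i) G" if "i \<in> \<Lambda>0" for i
    unfolding K_def using A[OF that] Hc \<Lambda>0 that by (intro generate_is_subgroup) blast
  have K\<Gamma>: "K i \<subseteq> \<Gamma>" if "i \<in> \<Lambda>0" for i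
    unfolding K_def \<Gamma>_def using that by (intro mono_generate) auto
  have S\<Gamma>: "S \<subseteq> \<Gamma>" unfolding \<Gamma>_def by (auto intro: generate.incl)
  let ?X = "rel_gens S \<Lambda> H" and ?Y = "rel_gens S \<Lambda>0 K" and ?G0 = "G\<lparr>carrier := \<Gamma>\<rparr>"
  let ?T = "rel_label G \<Lambda> H R" and ?U = "rel_label ?G0 \<Lambda>0 K R"
  have YX: "?Y \<subseteq> ?X" using KH \<Lambda>0 by (auto simp: rel_gens_def)
  have fX: "gen_val ` ?X \<subseteq> carrier G" by (rule gen_val_rel_gens[OF S(2) Hc])
  have fY: "gen_val ` ?Y \<subseteq> \<Gamma>" using K\<Gamma> S\<Gamma> by (force simp: rel_gens_def)
  have val0: "word_val ?G0 gen_val w = word_val G gen_val w" if "w \<in> words ?Y" for w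
    by (rule word_val_subgroup[OF \<Gamma> that fY])
  have RX: "r \<in> words ?X" if "r \<in> R" for r using R(2) that by (auto simp: free_product_elements_def)
  have RY: "r \<in> words ?Y" if "r \<in> R" for r
  proof -
    have "fst l \<in> ?Y" if l: "l \<in> set r" for l
    proof -
      obtain x b where xb: "l = (x, b)" by (cases l)
      have "x \<in> ?X" using RX[OF \<open>r \<in> R\<close>] l xb by (force simp: words_iff)
      then show ?thesis using RA[OF \<open>r \<in> R\<close>] l xb
        by (cases x) (auto simp: K_def intro!: generate.incl)
    qed
    then show ?thesis by (auto simp: words_iff)
  qed
  define \<tau> where "\<tau> i = (SOME t. (\<forall>g\<in>carrier G. t g \<in> K i) \<and> (\<forall>g\<in>carrier G. \<forall>h\<in>K i. t (g \<otimes> h) = t g \<otimes> h))" for i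
  have \<tau>: "(\<forall>g\<in>carrier G. \<tau> i g \<in> K i) \<and> (\<forall>g\<in>carrier G. \<forall>h\<in>K i. \<tau> i (g \<otimes> h) = \<tau> i g \<otimes> h)"
    if i: "i \<in> \<Lambda>0" for i
  proof -
    obtain t where "\<And>g. g \<in> carrier G \<Longrightarrow> t g \<in> K i"
      "\<And>g h. g \<in> carrier G \<Longrightarrow> h \<in> K i \<Longrightarrow> t (g \<otimes> h) = t g \<otimes> h"
      using equivariant_retraction[OF Ksub[OF i]] by blast
    then have "\<exists>t. (\<forall>g\<in>carrier G. t g \<in> K i) \<and> (\<forall>g\<in>carrier G. \<forall>h\<in>K i. t (g \<otimes> h) = t g \<otimes> h)" by blast
    then show ?thesis unfolding \<tau>_def by (rule someI_ex)
  qed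
  have \<tau>1: "\<tau> i g \<in> K i" "\<tau> i g \<in> carrier G" if "i \<in> \<Lambda>0" "g \<in> carrier G" for i g
    using \<tau>[OF that(1)] that(2) subgroup.subset[OF Ksub[OF that(1)]] by auto
  define diff where "diff i g h = inv (\<tau> i g) \<otimes> \<tau> i (g \<otimes> h)" for i g h
  have diffK: "diff i g h \<in> K i" if "i \<in> \<Lambda>0" "g \<in> carrier G" "h \<in> carrier G" for i g h
    unfolding diff_def using \<tau>1 that
    by (intro subgroup.m_closed[OF Ksub[OF that(1)]] subgroup.m_inv_closed[OF Ksub[OF that(1)]]) auto
  have diff_same: "diff i g h = h" if "i \<in> \<Lambda>0" "g \<in> carrier G" "h \<in> K i" for i g h
  proof -
    have "h \<in> carrier G" using subgroup.subset[OF Ksub[OF that(1)]] that by blast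
    then show ?thesis using \<tau>[OF that(1)] \<tau>1(2)[OF that(1,2)] that by (auto simp: diff_def m_assoc[symmetric])
  qed
  \<comment> \<open>A negative letter is an edge traversed backwards: it starts at \<open>g \<otimes> inv h\<close>.\<close>
  define \<phi> where "\<phi> g l = (case fst l of Inl s \<Rightarrow> [l] | Inr (i, h) \<Rightarrow>
      if i \<notin> \<Lambda>0 then []
      else if snd l then [(Inr (i, diff i g h), True)] else [(Inr (i, diff i (g \<otimes> inv h) h), False)])"
    for g and l :: "('a, 'l) gen letter"
  define step where "step g l = g \<otimes> letter_val G gen_val l" for g and l :: "('a, 'l) gen letter"
  let ?walk = "walk step \<phi>"
  have lc: "letter_val G gen_val l \<in> carrier G" if "fst l \<in> ?X" for l using letter_val_closed[OF fX that] .
  have stepc: "step g l \<in> carrier G" if "g \<in> carrier G" "fst l \<in> ?X" for g l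
    using lc[OF that(2)] that(1) by (simp add: step_def)
  have fold: "foldl step g w = g \<otimes> word_val G gen_val w" if "g \<in> carrier G" "w \<in> words ?X" for g w
    using that
  proof (induction w arbitrary: g)
    case (Cons l w)
    then show ?case using stepc[of g l] lc[of l] word_val_closed[OF fX, of w]
      by (simp add: word_val_Cons step_def m_assoc)
  qed simp
  have \<phi>Y: "\<phi> g l = [l]" if "g \<in> carrier G" "fst l \<in> ?Y" for g l
  proof (cases "fst l")
    case (Inr p)
    then obtain i h where p: "fst l = Inr (i, h)" by (cases p) auto
    then have ih: "i \<in> \<Lambda>0" "h \<in> K i" using that by auto
    then have "h \<in> carrier G" using subgroup.subset[OF Ksub] by blast
    then show ?thesis using p ih diff_same that(1) by (cases l) (auto simp: \<phi>_def)
  qed (simp add: \<phi>_def)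
  have walkY: "?walk g w = w" if "g \<in> carrier G" "w \<in> words ?Y" for g w
    using that
  proof (induction w arbitrary: g)
    case (Cons l w)
    then show ?case using \<phi>Y[of g l] stepc[of g l] YX by auto
  qed simp
  \<comment> \<open>Along a word in one \<open>H i\<close> the new labels telescope.\<close>
  have walkH: "?walk g w = [] \<and> i \<notin> \<Lambda>0 \<or> i \<in> \<Lambda>0 \<and> (\<forall>l\<in>set (?walk g w). \<exists>h\<in>K i. fst l = Inr (i, h)) \<and>
      word_val G gen_val (?walk g w) = diff i g (word_val G gen_val w)"
    if "g \<in> carrier G" "i \<in> \<Lambda>" "\<And>l. l \<in> set w \<Longrightarrow> \<exists>h\<in>H i. fst l = Inr (i, h)" for g w i
    using that
  proof (induction w arbitrary: g)
    case Nil
    then show ?case using \<tau>1[of i g] by (simp add: diff_def)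
  next
    case (Cons l w)
    obtain h where h: "h \<in> H i" "fst l = Inr (i, h)" using Cons.prems(3)[of l] by auto
    have hc: "h \<in> carrier G" using h Hc Cons.prems(2) by blast
    have lX: "fst l \<in> ?X" using h Cons.prems(2) by simp
    have g': "step g l \<in> carrier G" using stepc Cons.prems(1) lX .
    have wX: "w \<in> words ?X"
    proof -
      have "fst l' \<in> ?X" if "l' \<in> set w" for l' using Cons.prems(2) Cons.prems(3)[of l'] that by auto
      then show ?thesis by (auto simp: words_iff)
    qed
    have wc: "word_val G gen_val w \<in> carrier G" by (rule word_val_closed[OF fX wX])
    note IH = Cons.IH[OF g' Cons.prems(2)]
    show ?case
    proof (cases "i \<in> \<Lambda>0")
      case False
      then show ?thesis using IH Cons.prems(3) h by (auto simp: \<phi>_def)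
    next
      case True
      have 1: "\<exists>h'\<in>K i. \<exists>b. \<phi> g l = [(Inr (i, h'), b)]"
        using h True diffK[OF True _ hc] Cons.prems(1) hc by (auto simp: \<phi>_def)
      have 2: "word_val G gen_val (\<phi> g l) = diff i g (letter_val G gen_val l)"
      proof (cases "snd l")
        case True
        then show ?thesis using h hc \<open>i \<in> \<Lambda>0\<close> Cons.prems(1) \<tau>1[OF \<open>i \<in> \<Lambda>0\<close>]
          by (auto simp: \<phi>_def word_val_Cons letter_val_def diff_def)
      next
        case False
        have "inv (diff i (g \<otimes> inv h) h) = diff i g (inv h)"
          using hc Cons.prems(1) \<tau>1(2)[OF True] by (simp add: diff_def inv_mult_group m_assoc)
        then show ?thesis using h hc True False Cons.prems(1) \<tau>1[OF True]
          by (auto simp: \<phi>_def word_val_Cons letter_val_def diff_def)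
      qed
      obtain h' b where h': "h' \<in> K i" "\<phi> g l = [(Inr (i, h'), b)]" using 1 by blast
      have IH': "\<forall>l\<in>set (?walk (step g l) w). \<exists>h\<in>K i. fst l = Inr (i, h)"
        "word_val G gen_val (?walk (step g l) w) = diff i (step g l) (word_val G gen_val w)"
        using IH Cons.prems(3) True by auto
      have dc: "diff i g (letter_val G gen_val l) \<otimes> diff i (step g l) (word_val G gen_val w) =
          diff i g (letter_val G gen_val l \<otimes> word_val G gen_val w)"
      proof -
        have c: "\<tau> i g \<in> carrier G" "\<tau> i (step g l) \<in> carrier G" "\<tau> i (step g l \<otimes> word_val G gen_val w) \<in> carrier G"
          using \<tau>1(2)[OF True] Cons.prems(1) g' wc by auto
        have "\<tau> i (step g l) \<otimes> (inv (\<tau> i (step g l)) \<otimes> \<tau> i (step g l \<otimes> word_val G gen_val w)) =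
            \<tau> i (step g l \<otimes> word_val G gen_val w)"
          using c by (simp add: m_assoc[symmetric])
        then show ?thesis
          using c wc lc[OF lX] Cons.prems(1) by (simp add: diff_def step_def m_assoc)
      qed
      have "word_val G gen_val (?walk g (l # w)) = word_val G gen_val (\<phi> g l) \<otimes> word_val G gen_val (?walk (step g l) w)"
      proof -
        have "letter_val G gen_val (Inr (i, h'), b) \<in> carrier G"
          using h'(1) subgroup.subset[OF Ksub[OF True]] by (auto simp: letter_val_def)
        then show ?thesis using h'(2) by (simp add: word_val_Cons)
      qed
      then show ?thesis using True h' IH' 2 dc by (auto simp: word_val_Cons)
    qed
  qed
  show ?thesis
  proof (rule relatively_hyperbolicI[of ?G0 \<Lambda>0 K S R C])
    show "group ?G0" by (rule subgroup_imp_group[OF \<Gamma>])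
    show "subgroup (K i) ?G0" if "i \<in> \<Lambda>0" for i
      using subgroup_incl[OF Ksub[OF that] \<Gamma> K\<Gamma>[OF that]] .
    show "finite S" "S \<subseteq> carrier ?G0" "finite R" using S R S\<Gamma> by auto
    show "R \<subseteq> free_product_elements ?G0 S \<Lambda>0 K" using R(2) RY by (auto simp: free_product_elements_def)
    show "word_val ?G0 gen_val r = \<one>\<^bsub>?G0\<^esub>" if "r \<in> R" for r using val0[OF RY[OF that]] R(3)[OF that] by simp
    show "carrier ?G0 \<subseteq> word_val ?G0 gen_val ` words ?Y"
    proof
      fix g assume "g \<in> carrier ?G0"
      then have g: "g \<in> generate G (S \<union> (\<Union>i\<in>\<Lambda>0. A i))" by (simp add: \<Gamma>_def)
      have "S \<union> (\<Union>i\<in>\<Lambda>0. A i) \<subseteq> gen_val ` ?Y"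
      proof
        fix x assume "x \<in> S \<union> (\<Union>i\<in>\<Lambda>0. A i)"
        then consider "x \<in> S" | i where "i \<in> \<Lambda>0" "x \<in> A i" by auto
        then show "x \<in> gen_val ` ?Y"
        proof cases
          case 1
          then show ?thesis by (intro image_eqI[of _ _ "Inl x"]) auto
        next
          case 2
          then show ?thesis by (intro image_eqI[of _ _ "Inr (i, x)"]) (auto simp: K_def intro: generate.incl)
        qed
      qed
      then have "g \<in> generate G (gen_val ` ?Y)" using g mono_generate by blast
      also have "\<dots> = word_val G gen_val ` words ?Y"
        by (rule generate_word_val) (use fY subgroup.subset[OF \<Gamma>] in blast)
      finally obtain w where "w \<in> words ?Y" "g = word_val G gen_val w" by auto
      then show "g \<in> word_val ?G0 gen_val ` words ?Y" using val0 by auto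
    qed
    fix w assume w: "w \<in> words ?Y" "word_val ?G0 gen_val w = \<one>\<^bsub>?G0\<^esub>"
    have wX: "w \<in> words ?X" using w(1) YX by (auto simp: words_iff)
    have "word_val G gen_val w = \<one>" using w val0 by simp
    then obtain k where k: "fills ?X ?T k w" "real k \<le> C * real (length w)" using fill[OF wX] by blast
    then obtain n k' where d: "k' \<le> k" "disc ?X ?T n k' w" unfolding fills_def by blast
    have "fills ?Y ?U k' (?walk \<one> w)"
    proof (rule disc_transport[where relabel = ?walk and step = step and \<phi> = \<phi> and A = "carrier G" and X = ?X and T = ?T, THEN conjunct2])
      show "rotation_closed ?U" by (rule rotation_closed_face_label)
      show "?walk g [] = []" "?walk g (l # w) = \<phi> g l @ ?walk (step g l) w" for g l w by simp_all
      show "\<one> \<in> carrier G" by simp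
      show "disc ?X ?T n k' w" by (rule d(2))
    next
      fix g and l :: "('a, 'l) gen letter"
      assume g: "g \<in> carrier G" and l: "fst l \<in> ?X"
      have c: "letter_val G gen_val l \<in> carrier G" by (rule lc[OF l])
      show st: "step g l \<in> carrier G \<and> step (step g l) (inv_letter l) = g"
        using g c letter_val_inv[OF fX l] by (simp add: step_def m_assoc)
      show "\<phi> (step g l) (inv_letter l) = inv_word (\<phi> g l)"
      proof (cases "fst l")
        case (Inl s)
        then show ?thesis by (simp add: \<phi>_def)
      next
        case (Inr p)
        then obtain i h where p: "fst l = Inr (i, h)" by (cases p) auto
        then have hc: "h \<in> carrier G" using l Hc by auto
        show ?thesis
        proof (cases "snd l")
          case True
          have "step g l = g \<otimes> h" using True p by (simp add: step_def letter_val_def)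
          moreover have "g \<otimes> h \<otimes> inv h = g" using g hc by (simp add: m_assoc)
          ultimately show ?thesis using True p by (auto simp: \<phi>_def inv_letter_def)
        next
          case False
          have "step g l = g \<otimes> inv h" using False p by (simp add: step_def letter_val_def)
          then show ?thesis using False p by (auto simp: \<phi>_def inv_letter_def)
        qed
      qed
      show "length (\<phi> g l) \<le> 1 \<and> \<phi> g l \<in> words ?Y"
      proof (cases "fst l")
        case (Inl s)
        then show ?thesis using l by (simp add: \<phi>_def)
      next
        case (Inr p)
        then obtain i h where p: "fst l = Inr (i, h)" by (cases p) auto
        then have hc: "h \<in> carrier G" using l Hc by auto
        show ?thesis using p diffK[OF _ _ hc] g hc by (auto simp: \<phi>_def)
      qed
    next
      fix g t c assume g: "g \<in> carrier G" and t: "t \<in> words ?X" "?T t c"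
      have "word_val G gen_val t = \<one> \<and> (?walk g t = [] \<or> ?U (?walk g t) c)"
        using t(2)[unfolded face_label_def]
      proof (elim disjE conjE)
        assume c: "c = 0" and "cyclic_relator (peripheral_relators G \<Lambda> H) t"
        then have "t \<in> peripheral_relators G \<Lambda> H" using cyclic_peripheral[of \<Lambda> H t] Hc by blast
        then obtain i where i: "i \<in> \<Lambda>" "\<And>l. l \<in> set t \<Longrightarrow> \<exists>h\<in>H i. fst l = Inr (i, h)" "word_val G gen_val t = \<one>"
          by (auto simp: peripheral_relators_iff)
        show ?thesis
        proof (cases "i \<in> \<Lambda>0")
          case False
          then show ?thesis using walkH[OF g i(1,2)] i(3) by auto
        next
          case True
          then have w: "\<forall>l\<in>set (?walk g t). \<exists>h\<in>K i. fst l = Inr (i, h)" "word_val G gen_val (?walk g t) = diff i g \<one>"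
            using walkH[OF g i(1,2)] i(3) by auto
          have "diff i g \<one> = \<one>" using g \<tau>1[OF True g] by (simp add: diff_def)
          moreover have "?walk g t \<in> words ?Y" using w(1) True by (force simp: words_iff)
          ultimately have "?walk g t \<in> peripheral_relators ?G0 \<Lambda>0 K"
            using w True val0 by (auto simp: peripheral_relators_iff)
          then show ?thesis using c i(3) cyclic_relatorI by (auto simp: face_label_def)
        qed
      next
        assume c: "c = 1" and cr: "cyclic_relator R t"
        then obtain u v where uv: "t = u @ v" "v @ u \<in> R \<or> inv_word (v @ u) \<in> R" by (auto simp: cyclic_relator_def)
        have "t \<in> words ?Y" using uv RY[of "v @ u"] RY[of "inv_word (v @ u)"] by auto
        then have "?walk g t = t" by (rule walkY[OF g])
        moreover have "word_val G gen_val t = \<one>"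
        proof -
          have "pres_eq ?X R t []" by (rule pres_eq_cyclic_relator[OF cr t(1)])
          from pres_eq_sound[OF fX _ R(3) this] RX show ?thesis by auto
        qed
        ultimately show ?thesis using c cr by (simp add: face_label_def)
      qed
      then show "foldl step g t = g \<and> (?walk g t = [] \<or> ?U (?walk g t) c)"
        using fold[OF g t(1)] g by simp
    qed
    then have "fills ?Y ?U k' w" using walkY[of \<one> w] w by simp
    moreover have "real k' \<le> C * real (length w)" using d(1) k(2) by linarith
    ultimately show "\<exists>k. fills ?Y ?U k w \<and> real k \<le> C * real (length w)" by blast
  qed
qed

section \<open>Normal forms in an amalgam\<close>

text \<open>A representative of the right coset of \<open>g\<close>; the subgroup itself is represented by the unit.\<close>
definition coset_rep :: "('a, 'm) monoid_scheme \<Rightarrow> 'a set \<Rightarrow> 'a \<Rightarrow> 'a" where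
  "coset_rep G K g = (if g \<in> K then \<one>\<^bsub>G\<^esub> else SOME x. x \<in> K #>\<^bsub>G\<^esub> g)"

context group
begin

lemma subgroup_mult_iff:
  assumes K: "subgroup K G" and k: "k \<in> K" and x: "x \<in> carrier G"
  shows "k \<otimes> x \<in> K \<longleftrightarrow> x \<in> K"
proof
  interpret K: subgroup K G by (rule K)
  assume "k \<otimes> x \<in> K"
  then have "inv k \<otimes> (k \<otimes> x) \<in> K" using k by simp
  then show "x \<in> K" using k x by (simp add: m_assoc[symmetric])
qed (use K k in \<open>rule subgroup.m_closed\<close>)

lemma coset_rep:
  assumes K: "subgroup K G" and g: "g \<in> carrier G"
  shows "coset_rep G K g \<in> carrier G" "g \<otimes> inv (coset_rep G K g) \<in> K"
    "coset_rep G K g \<in> K \<longleftrightarrow> g \<in> K"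
    "k \<in> K \<Longrightarrow> coset_rep G K (k \<otimes> g) = coset_rep G K g"
    "coset_rep G K (coset_rep G K g) = coset_rep G K g"
proof -
  interpret K: subgroup K G by (rule K)
  have ex: "\<exists>k\<in>K. coset_rep G K g = k \<otimes> g"
  proof (cases "g \<in> K")
    case True
    then show ?thesis by (intro bexI[of _ "inv g"]) (auto simp: coset_rep_def)
  next
    case False
    have "(SOME x. x \<in> K #> g) \<in> K #> g" by (rule someI[of _ g]) (rule rcos_self[OF g K])
    then show ?thesis using False by (auto simp: coset_rep_def r_coset_def)
  qed
  then obtain k0 where k0: "k0 \<in> K" "coset_rep G K g = k0 \<otimes> g" by blast
  show c: "coset_rep G K g \<in> carrier G" using k0 g by simp
  have "g \<otimes> inv (k0 \<otimes> g) = inv k0" using k0 g by (simp add: inv_mult_group m_assoc[symmetric])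
  then show "g \<otimes> inv (coset_rep G K g) \<in> K" using k0 by simp
  note in_iff = subgroup_mult_iff[OF K]
  show 3: "coset_rep G K g \<in> K \<longleftrightarrow> g \<in> K" using k0 in_iff g by simp
  have 4: "coset_rep G K (k \<otimes> g) = coset_rep G K g" if "k \<in> K" for k
  proof -
    have "K #> (k \<otimes> g) = K #> g"
      using repr_independence[of "k \<otimes> g" K g] that g K by (auto simp: r_coset_def)
    then show ?thesis using in_iff[OF that g] by (simp add: coset_rep_def)
  qed
  then show "k \<in> K \<Longrightarrow> coset_rep G K (k \<otimes> g) = coset_rep G K g" .
  show "coset_rep G K (coset_rep G K g) = coset_rep G K g" using 4[OF k0(1)] k0 by simp
qed

end

definition permutation_group :: "'p set \<Rightarrow> ('p \<Rightarrow> 'p) monoid" where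
  "permutation_group \<Omega> = \<lparr>carrier = {f. f permutes \<Omega>}, monoid.mult = (\<circ>), one = id\<rparr>"

lemma group_permutation_group: "group (permutation_group \<Omega>)"
proof (rule groupI)
  fix f assume "f \<in> carrier (permutation_group \<Omega>)"
  then have f: "f permutes \<Omega>" by (simp add: permutation_group_def)
  show "\<exists>g\<in>carrier (permutation_group \<Omega>). g \<otimes>\<^bsub>permutation_group \<Omega>\<^esub> f = \<one>\<^bsub>permutation_group \<Omega>\<^esub>"
    by (rule bexI[of _ "Hilbert_Choice.inv f"])
      (simp_all add: permutation_group_def permutes_inv[OF f] permutes_inv_o[OF f])
qed (auto simp: permutation_group_def permutes_compose permutes_id comp_assoc)

text \<open>The group \<open>A\<close> and the groups \<open>B i\<close> share the subgroups \<open>C i\<close> of \<open>A\<close> through the embeddings \<open>j i\<close>.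
  Their amalgam is not formed as a group. What is constructed is a set \<open>\<Omega>\<close> on which \<open>A\<close> and all the
  \<open>B i\<close> act so that the two actions of \<open>C i\<close> agree.

  A point of \<open>\<Omega>\<close> is a pair of an element \<open>a\<close> of \<open>A\<close> and a reduced list of triples \<open>(t, i, s)\<close>; it stands
  for the normal form that starts with \<open>a\<close> and continues with \<open>s\<close> in \<open>B i\<close> and then \<open>t\<close> in \<open>A\<close>,
  for each triple in turn. The group \<open>A\<close> acts by multiplication of \<open>a\<close>. For \<open>B i\<close> the same set is
  parametrised differently, as \<open>\<Theta> i\<close>: the normal form is read as an element of \<open>B i\<close> followed by the rest, and
  \<open>B i\<close> acts by multiplication of that element. The bijection \<open>chart i\<close> from \<open>\<Omega>\<close> to \<open>\<Theta> i\<close> respects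
  multiplication by \<open>C i\<close>, which makes the actions agree.\<close>
locale amalgam =
  fixes A :: "('a, 'm) monoid_scheme" and B :: "'l \<Rightarrow> ('b, 'n) monoid_scheme" and C :: "'l \<Rightarrow> 'a set"
    and j :: "'l \<Rightarrow> 'a \<Rightarrow> 'b" and \<Lambda> :: "'l set"
  assumes group_A: "group A" and group_B: "\<And>i. i \<in> \<Lambda> \<Longrightarrow> group (B i)"
    and sub_C: "\<And>i. i \<in> \<Lambda> \<Longrightarrow> subgroup (C i) A"
    and j_closed: "\<And>i c. i \<in> \<Lambda> \<Longrightarrow> c \<in> C i \<Longrightarrow> j i c \<in> carrier (B i)"
    and j_mult: "\<And>i c d. i \<in> \<Lambda> \<Longrightarrow> c \<in> C i \<Longrightarrow> d \<in> C i \<Longrightarrow> j i (c \<otimes>\<^bsub>A\<^esub> d) = j i c \<otimes>\<^bsub>B i\<^esub> j i d"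
    and j_inj: "\<And>i. i \<in> \<Lambda> \<Longrightarrow> inj_on (j i) (C i)"
begin

sublocale A: group A by (rule group_A)

abbreviation "D i \<equiv> j i ` C i"
abbreviation "rA i \<equiv> coset_rep A (C i)"
abbreviation "rB i \<equiv> coset_rep (B i) (D i)"
abbreviation "j_inv i \<equiv> inv_into (C i) (j i)"

text \<open>The leading element of \<open>A\<close> is absorbed by the factor \<open>B i\<close> that follows it.\<close>
definition crossing :: "'l \<Rightarrow> 'a \<Rightarrow> ('a \<times> 'l \<times> 'b) list \<Rightarrow> bool" where
  "crossing i a m \<longleftrightarrow> a \<in> C i \<and> m \<noteq> [] \<and> fst (snd (hd m)) = i"

fun reduced :: "('a \<times> 'l \<times> 'b) list \<Rightarrow> bool" where
  "reduced [] \<longleftrightarrow> True"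
| "reduced ((t, i, s) # m) \<longleftrightarrow> reduced m \<and> i \<in> \<Lambda> \<and> t \<in> carrier A \<and> rA i t = t \<and> \<not> crossing i t m \<and>
     s \<in> carrier (B i) \<and> s \<notin> D i \<and> rB i s = s"

definition \<Omega> :: "('a \<times> ('a \<times> 'l \<times> 'b) list) set" where
  "\<Omega> = {(a, m). a \<in> carrier A \<and> reduced m}"

definition \<Theta> :: "'l \<Rightarrow> ('b \<times> 'a \<times> ('a \<times> 'l \<times> 'b) list) set" where
  "\<Theta> i = {(b, t, m). b \<in> carrier (B i) \<and> t \<in> carrier A \<and> rA i t = t \<and> reduced m \<and> \<not> crossing i t m}"

definition chart :: "'l \<Rightarrow> 'a \<times> ('a \<times> 'l \<times> 'b) list \<Rightarrow> 'b \<times> 'a \<times> ('a \<times> 'l \<times> 'b) list" where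
  "chart i = (\<lambda>(a, m). if crossing i a m then (j i a \<otimes>\<^bsub>B i\<^esub> snd (snd (hd m)), fst (hd m), tl m)
     else (j i (a \<otimes>\<^bsub>A\<^esub> inv\<^bsub>A\<^esub> (rA i a)), rA i a, m))"

definition chart_inv :: "'l \<Rightarrow> 'b \<times> 'a \<times> ('a \<times> 'l \<times> 'b) list \<Rightarrow> 'a \<times> ('a \<times> 'l \<times> 'b) list" where
  "chart_inv i = (\<lambda>(b, t, m). if b \<in> D i then (j_inv i b \<otimes>\<^bsub>A\<^esub> t, m)
     else (j_inv i (b \<otimes>\<^bsub>B i\<^esub> inv\<^bsub>B i\<^esub> (rB i b)), (t, i, rB i b) # m))"

lemma C_carrier: "i \<in> \<Lambda> \<Longrightarrow> c \<in> C i \<Longrightarrow> c \<in> carrier A"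
  using sub_C subgroup.subset by blast

lemma j_hom: "i \<in> \<Lambda> \<Longrightarrow> group_hom (A\<lparr>carrier := C i\<rparr>) (B i) (j i)"
  by (intro group_hom.intro group_hom_axioms.intro A.subgroup_imp_group sub_C group_B)
    (auto simp: hom_def j_closed j_mult)

lemma sub_D: "i \<in> \<Lambda> \<Longrightarrow> subgroup (D i) (B i)"
  using group_hom.img_is_subgroup[OF j_hom] by simp

lemma chart_in: 
  assumes i: "i \<in> \<Lambda>" and p: "p \<in> \<Omega>"
  shows "chart i p \<in> \<Theta> i" "chart_inv i (chart i p) = p"
proof -
  interpret Bi: group "B i" by (rule group_B[OF i])
  interpret Ci: subgroup "C i" A by (rule sub_C[OF i])
  interpret Di: subgroup "D i" "B i" by (rule sub_D[OF i])
  obtain a m where am: "p = (a, m)" "a \<in> carrier A" "reduced m" using p by (auto simp: \<Omega>_def)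
  have "chart i p \<in> \<Theta> i \<and> chart_inv i (chart i p) = p"
  proof (cases "crossing i a m")
    case True
    then obtain t s m' where m: "m = (t, i, s) # m'" "a \<in> C i" by (cases m) (auto simp: crossing_def)
    then have r: "reduced m'" "t \<in> carrier A" "rA i t = t" "\<not> crossing i t m'"
      "s \<in> carrier (B i)" "s \<notin> D i" "rB i s = s" using am by auto
    have ch: "chart i p = (j i a \<otimes>\<^bsub>B i\<^esub> s, t, m')" using True am m by (simp add: chart_def)
    have ja: "j i a \<in> D i" using m by simp
    have rb: "rB i (j i a \<otimes>\<^bsub>B i\<^esub> s) = s" using Bi.coset_rep(4)[OF sub_D[OF i] r(5) ja] r by simp
    have nD: "j i a \<otimes>\<^bsub>B i\<^esub> s \<notin> D i"
      using Bi.subgroup_mult_iff[OF sub_D[OF i] ja r(5)] r(6) by simp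
    have "j i a \<otimes>\<^bsub>B i\<^esub> s \<otimes>\<^bsub>B i\<^esub> inv\<^bsub>B i\<^esub> s = j i a"
      using r ja Di.mem_carrier by (simp add: Bi.m_assoc)
    then have "chart_inv i (chart i p) = p"
      using ch nD rb am m inv_into_f_f[OF j_inj[OF i] m(2)] by (simp add: chart_inv_def)
    moreover have "chart i p \<in> \<Theta> i" using ch r ja Di.mem_carrier by (simp add: \<Theta>_def)
    ultimately show ?thesis by simp
  next
    case False
    have ch: "chart i p = (j i (a \<otimes>\<^bsub>A\<^esub> inv\<^bsub>A\<^esub> (rA i a)), rA i a, m)" using False am by (simp add: chart_def)
    note r = A.coset_rep[OF sub_C[OF i] am(2)]
    have "\<not> crossing i (rA i a) m" using False r(3) by (simp add: crossing_def)
    then have 1: "chart i p \<in> \<Theta> i" using ch r am j_closed[OF i r(2)] by (simp add: \<Theta>_def)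
    have "a \<otimes>\<^bsub>A\<^esub> inv\<^bsub>A\<^esub> (rA i a) \<otimes>\<^bsub>A\<^esub> rA i a = a" using r am by (simp add: A.m_assoc)
    then have "chart_inv i (chart i p) = p"
      using ch am inv_into_f_f[OF j_inj[OF i] r(2)] r(2) by (simp add: chart_inv_def)
    then show ?thesis using 1 by simp
  qed
  then show "chart i p \<in> \<Theta> i" "chart_inv i (chart i p) = p" by auto
qed

lemma chart_inv_in:
  assumes i: "i \<in> \<Lambda>" and p: "p \<in> \<Theta> i"
  shows "chart_inv i p \<in> \<Omega>" "chart i (chart_inv i p) = p"
proof -
  interpret Bi: group "B i" by (rule group_B[OF i])
  interpret Ci: subgroup "C i" A by (rule sub_C[OF i])
  interpret Di: subgroup "D i" "B i" by (rule sub_D[OF i])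
  obtain b t m where bt: "p = (b, t, m)" "b \<in> carrier (B i)" "t \<in> carrier A" "rA i t = t" "reduced m" "\<not> crossing i t m"
    using p by (auto simp: \<Theta>_def)
  have "chart_inv i p \<in> \<Omega> \<and> chart i (chart_inv i p) = p"
  proof (cases "b \<in> D i")
    case True
    then obtain c where c: "c \<in> C i" "b = j i c" by auto
    have ci: "chart_inv i p = (c \<otimes>\<^bsub>A\<^esub> t, m)"
      using True bt c inv_into_f_f[OF j_inj[OF i] c(1)] by (simp add: chart_inv_def)
    have rA: "rA i (c \<otimes>\<^bsub>A\<^esub> t) = t" using A.coset_rep(4)[OF sub_C[OF i] bt(3) c(1)] bt by simp
    have "c \<otimes>\<^bsub>A\<^esub> t \<in> C i \<longleftrightarrow> t \<in> C i"
      by (rule A.subgroup_mult_iff[OF sub_C[OF i] c(1) bt(3)])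
    then have "\<not> crossing i (c \<otimes>\<^bsub>A\<^esub> t) m" using bt by (simp add: crossing_def)
    moreover have "c \<otimes>\<^bsub>A\<^esub> t \<otimes>\<^bsub>A\<^esub> inv\<^bsub>A\<^esub> t = c" using c bt by (simp add: A.m_assoc)
    ultimately show ?thesis using ci rA bt c by (simp add: chart_def \<Omega>_def)
  next
    case False
    note r = Bi.coset_rep[OF sub_D[OF i] bt(2)]
    obtain c where c: "c \<in> C i" "b \<otimes>\<^bsub>B i\<^esub> inv\<^bsub>B i\<^esub> (rB i b) = j i c" using r(2) by auto
    have ci: "chart_inv i p = (c, (t, i, rB i b) # m)"
      using False bt c inv_into_f_f[OF j_inj[OF i] c(1)] by (simp add: chart_inv_def)
    have "crossing i c ((t, i, rB i b) # m)" using c by (simp add: crossing_def)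
    moreover have "j i c \<otimes>\<^bsub>B i\<^esub> rB i b = b"
      using r(1) bt(2) by (simp add: c(2)[symmetric] Bi.m_assoc)
    moreover have "reduced ((t, i, rB i b) # m)" using bt r False i by simp
    ultimately show ?thesis using ci bt c by (simp add: chart_def \<Omega>_def)
  qed
  then show "chart_inv i p \<in> \<Omega>" "chart i (chart_inv i p) = p" by auto
qed

lemma chart_equivariant:
  assumes i: "i \<in> \<Lambda>" and p: "(a, m) \<in> \<Omega>" and c: "c \<in> C i"
  shows "chart i (c \<otimes>\<^bsub>A\<^esub> a, m) = (j i c \<otimes>\<^bsub>B i\<^esub> fst (chart i (a, m)), snd (chart i (a, m)))"
proof -
  interpret Bi: group "B i" by (rule group_B[OF i])
  interpret Ci: subgroup "C i" A by (rule sub_C[OF i])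
  interpret Di: subgroup "D i" "B i" by (rule sub_D[OF i])
  have am: "a \<in> carrier A" "reduced m" using p by (auto simp: \<Omega>_def)
  note r = A.coset_rep[OF sub_C[OF i] am(1)]
  have rA: "rA i (c \<otimes>\<^bsub>A\<^esub> a) = rA i a" by (rule r(4)[OF c])
  have cin: "c \<otimes>\<^bsub>A\<^esub> a \<in> C i \<longleftrightarrow> a \<in> C i"
    by (rule A.subgroup_mult_iff[OF sub_C[OF i] c am(1)])
  then have cr: "crossing i (c \<otimes>\<^bsub>A\<^esub> a) m \<longleftrightarrow> crossing i a m" by (simp add: crossing_def)
  show ?thesis
  proof (cases "crossing i a m")
    case True
    then obtain t s m' where m: "m = (t, i, s) # m'" "a \<in> C i" by (cases m) (auto simp: crossing_def)
    then have s: "s \<in> carrier (B i)" using am by auto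
    have "j i (c \<otimes>\<^bsub>A\<^esub> a) \<otimes>\<^bsub>B i\<^esub> s = j i c \<otimes>\<^bsub>B i\<^esub> (j i a \<otimes>\<^bsub>B i\<^esub> s)"
      using j_mult[OF i c m(2)] j_closed[OF i c] j_closed[OF i m(2)] s by (simp add: Bi.m_assoc)
    then show ?thesis using True cr m by (simp add: chart_def)
  next
    case False
    have "c \<otimes>\<^bsub>A\<^esub> a \<otimes>\<^bsub>A\<^esub> inv\<^bsub>A\<^esub> (rA i a) = c \<otimes>\<^bsub>A\<^esub> (a \<otimes>\<^bsub>A\<^esub> inv\<^bsub>A\<^esub> (rA i a))"
      using c am r by (simp add: A.m_assoc)
    then show ?thesis using False cr rA j_mult[OF i c r(2)] by (simp add: chart_def)
  qed
qed

definition act_A :: "'a \<Rightarrow> 'a \<times> ('a \<times> 'l \<times> 'b) list \<Rightarrow> 'a \<times> ('a \<times> 'l \<times> 'b) list" where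
  "act_A a p = (if p \<in> \<Omega> then (a \<otimes>\<^bsub>A\<^esub> fst p, snd p) else p)"

definition act_B :: "'l \<Rightarrow> 'b \<Rightarrow> 'a \<times> ('a \<times> 'l \<times> 'b) list \<Rightarrow> 'a \<times> ('a \<times> 'l \<times> 'b) list" where
  "act_B i b p = (if p \<in> \<Omega> then chart_inv i (b \<otimes>\<^bsub>B i\<^esub> fst (chart i p), snd (chart i p)) else p)"

lemma act_A_comp: "a \<in> carrier A \<Longrightarrow> b \<in> carrier A \<Longrightarrow> act_A (a \<otimes>\<^bsub>A\<^esub> b) = act_A a \<circ> act_A b"
  by (auto simp: act_A_def \<Omega>_def fun_eq_iff A.m_assoc)

lemma act_A_one: "act_A \<one>\<^bsub>A\<^esub> = id"
  by (auto simp: act_A_def \<Omega>_def fun_eq_iff)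

lemma act_B_in_eq:
  assumes i: "i \<in> \<Lambda>" and b: "b \<in> carrier (B i)" and p: "p \<in> \<Omega>"
  shows "act_B i b p \<in> \<Omega>" "chart i (act_B i b p) = (b \<otimes>\<^bsub>B i\<^esub> fst (chart i p), snd (chart i p))"
proof -
  interpret Bi: group "B i" by (rule group_B[OF i])
  have "(b \<otimes>\<^bsub>B i\<^esub> fst (chart i p), snd (chart i p)) \<in> \<Theta> i"
    using chart_in(1)[OF i p] b by (auto simp: \<Theta>_def)
  from chart_inv_in[OF i this] p show "act_B i b p \<in> \<Omega>"
    "chart i (act_B i b p) = (b \<otimes>\<^bsub>B i\<^esub> fst (chart i p), snd (chart i p))"
    by (simp_all add: act_B_def)
qed

lemma chart_closed: "i \<in> \<Lambda> \<Longrightarrow> p \<in> \<Omega> \<Longrightarrow> fst (chart i p) \<in> carrier (B i)"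
  using chart_in(1) by (fastforce simp: \<Theta>_def)

lemma act_B_comp:
  assumes i: "i \<in> \<Lambda>" and b: "b \<in> carrier (B i)" "b' \<in> carrier (B i)"
  shows "act_B i (b \<otimes>\<^bsub>B i\<^esub> b') = act_B i b \<circ> act_B i b'"
proof
  interpret Bi: group "B i" by (rule group_B[OF i])
  fix p
  show "act_B i (b \<otimes>\<^bsub>B i\<^esub> b') p = (act_B i b \<circ> act_B i b') p"
  proof (cases "p \<in> \<Omega>")
    case True
    then show ?thesis using act_B_in_eq[OF i b(2) True] chart_closed[OF i True] b
      by (simp add: act_B_def Bi.m_assoc)
  qed (simp add: act_B_def)
qed

lemma act_B_one:
  assumes i: "i \<in> \<Lambda>"
  shows "act_B i \<one>\<^bsub>B i\<^esub> = id"
proof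
  interpret Bi: group "B i" by (rule group_B[OF i])
  show "act_B i \<one>\<^bsub>B i\<^esub> p = id p" for p
    using chart_in(2)[OF i, of p] chart_closed[OF i, of p] by (simp add: act_B_def)
qed

lemma act_B_j:
  assumes i: "i \<in> \<Lambda>" and c: "c \<in> C i"
  shows "act_B i (j i c) = act_A c"
proof
  fix p
  show "act_B i (j i c) p = act_A c p"
  proof (cases "p \<in> \<Omega>")
    case True
    obtain a m where am: "p = (a, m)" by (cases p)
    have "(c \<otimes>\<^bsub>A\<^esub> a, m) \<in> \<Omega>" using True am C_carrier[OF i c] by (auto simp: \<Omega>_def)
    from chart_in(2)[OF i this] chart_equivariant[OF i _ c, of a m] True am
    show ?thesis by (simp add: act_B_def act_A_def)
  qed (simp add: act_B_def act_A_def)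
qed

lemma permutes_if_inverse:
  assumes "f \<circ> g = id" "g \<circ> f = id" "\<And>p. p \<notin> \<Omega> \<Longrightarrow> f p = p"
  shows "f permutes \<Omega>"
  unfolding permutes_def using assms by (metis comp_apply id_apply)

lemma act_A_hom: "act_A \<in> hom A (permutation_group \<Omega>)"
proof -
  have "act_A a permutes \<Omega>" if "a \<in> carrier A" for a
    by (rule permutes_if_inverse[of _ "act_A (inv\<^bsub>A\<^esub> a)"])
      (use that act_A_one in \<open>simp_all add: act_A_comp[symmetric]\<close>, simp add: act_A_def)
  then show ?thesis by (auto simp: hom_def permutation_group_def act_A_comp)
qed

lemma act_B_hom: 
  assumes i: "i \<in> \<Lambda>"
  shows "act_B i \<in> hom (B i) (permutation_group \<Omega>)"
proof -
  interpret Bi: group "B i" by (rule group_B[OF i])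
  have "act_B i b permutes \<Omega>" if "b \<in> carrier (B i)" for b
    by (rule permutes_if_inverse[of _ "act_B i (inv\<^bsub>B i\<^esub> b)"])
      (use that act_B_one[OF i] in \<open>simp_all add: act_B_comp[OF i, symmetric]\<close>, simp add: act_B_def)
  then show ?thesis by (auto simp: hom_def permutation_group_def act_B_comp[OF i])
qed

lemma act_A_inj: "inj_on act_A (carrier A)"
proof (rule inj_onI)
  fix a b assume ab: "a \<in> carrier A" "b \<in> carrier A" "act_A a = act_A b"
  have "(\<one>\<^bsub>A\<^esub>, []) \<in> \<Omega>" by (simp add: \<Omega>_def)
  then show "a = b" using fun_cong[OF ab(3), of "(\<one>\<^bsub>A\<^esub>, [])"] ab(1,2) by (simp add: act_A_def)
qed

lemma act_B_inj:
  assumes i: "i \<in> \<Lambda>"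
  shows "inj_on (act_B i) (carrier (B i))"
proof (rule inj_onI)
  interpret Bi: group "B i" by (rule group_B[OF i])
  fix a b assume ab: "a \<in> carrier (B i)" "b \<in> carrier (B i)" "act_B i a = act_B i b"
  have p: "(\<one>\<^bsub>A\<^esub>, []) \<in> \<Omega>" by (simp add: \<Omega>_def)
  have "a \<otimes>\<^bsub>B i\<^esub> fst (chart i (\<one>\<^bsub>A\<^esub>, [])) = b \<otimes>\<^bsub>B i\<^esub> fst (chart i (\<one>\<^bsub>A\<^esub>, []))"
    using act_B_in_eq(2)[OF i ab(1) p] act_B_in_eq(2)[OF i ab(2) p] ab(3) by simp
  then show "a = b" using ab(1,2) chart_closed[OF i p] by simp
qed

subsection \<open>Reduced words move the base point\<close>

definition letter_ok :: "'a + 'l \<times> 'b \<Rightarrow> bool" where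
  "letter_ok = case_sum (\<lambda>a. a \<in> carrier A) (\<lambda>(i, b). i \<in> \<Lambda> \<and> b \<in> carrier (B i))"

text \<open>The letters of \<open>B i\<close> that lie in the amalgamated subgroup count as letters of \<open>A\<close>.\<close>
definition in_A :: "'a + 'l \<times> 'b \<Rightarrow> bool" where
  "in_A = case_sum (\<lambda>a. True) (\<lambda>(i, b). b \<in> D i)"

definition A_val :: "'a + 'l \<times> 'b \<Rightarrow> 'a" where
  "A_val = case_sum id (\<lambda>(i, b). j_inv i b)"

definition A_prod :: "('a + 'l \<times> 'b) list \<Rightarrow> 'a" where
  "A_prod w = foldr (\<lambda>l g. A_val l \<otimes>\<^bsub>A\<^esub> g) w \<one>\<^bsub>A\<^esub>"

definition act_letter :: "'a + 'l \<times> 'b \<Rightarrow> 'a \<times> ('a \<times> 'l \<times> 'b) list \<Rightarrow> 'a \<times> ('a \<times> 'l \<times> 'b) list" where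
  "act_letter = case_sum act_A (\<lambda>(i, b). act_B i b)"

text \<open>Two letters of the same \<open>B i\<close> with an element of \<open>C i\<close> between them can be merged.\<close>
definition reducible :: "('a + 'l \<times> 'b) list \<Rightarrow> bool" where
  "reducible w \<longleftrightarrow> (\<exists>x i b u b' y. w = x @ Inr (i, b) # u @ Inr (i, b') # y \<and>
     (\<forall>l\<in>set u. in_A l) \<and> A_prod u \<in> C i)"

lemma A_val_closed: "letter_ok l \<Longrightarrow> in_A l \<Longrightarrow> A_val l \<in> carrier A"
proof (cases l)
  case (Inr p)
  assume "letter_ok l" "in_A l"
  then obtain i b where p: "p = (i, b)" "i \<in> \<Lambda>" "b \<in> D i" using Inr by (auto simp: letter_ok_def in_A_def)
  show ?thesis using C_carrier[OF p(2) inv_into_into[OF p(3)]] Inr p(1) by (simp add: A_val_def)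
qed (simp add: letter_ok_def A_val_def)

lemma act_letter_in_A: "letter_ok l \<Longrightarrow> in_A l \<Longrightarrow> act_letter l = act_A (A_val l)"
proof (cases l)
  case (Inr p)
  assume "letter_ok l" "in_A l"
  then obtain i c where "p = (i, j i c)" "i \<in> \<Lambda>" "c \<in> C i" using Inr by (auto simp: letter_ok_def in_A_def)
  then show ?thesis using Inr act_B_j inv_into_f_f[OF j_inj] by (simp add: act_letter_def A_val_def)
qed (simp add: act_letter_def A_val_def)

lemma A_prod_closed: "(\<And>l. l \<in> set u \<Longrightarrow> letter_ok l \<and> in_A l) \<Longrightarrow> A_prod u \<in> carrier A"
  by (induction u) (auto simp: A_prod_def A_val_closed)

text \<open>Acting from right to left on the unit, an irreducible word pushes one triple for every letter outside
  of \<open>A\<close> and never pops one: a letter of \<open>B i\<close> could pop only if the word \<open>u\<close> read since the last push, made with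
  a letter of the same \<open>B i\<close>, had its value in \<open>C i\<close>. The invariant records \<open>u\<close> for this purpose.\<close>
lemma irreducible_depth:
  assumes "\<And>l. l \<in> set w \<Longrightarrow> letter_ok l" "\<not> reducible w"
  shows "\<exists>a m. foldr act_letter w (\<one>\<^bsub>A\<^esub>, []) = (a, m) \<and> (a, m) \<in> \<Omega> \<and>
    length m = length (filter (\<lambda>l. \<not> in_A l) w) \<and>
    (m \<noteq> [] \<longrightarrow> (\<exists>u i b y c. w = u @ Inr (i, b) # y \<and> fst (snd (hd m)) = i \<and> i \<in> \<Lambda> \<and>
       (\<forall>l\<in>set u. in_A l) \<and> c \<in> C i \<and> a = A_prod u \<otimes>\<^bsub>A\<^esub> c))"
  using assms
proof (induction w)
  case Nil
  then show ?case by (auto simp: \<Omega>_def)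
next
  case (Cons l w)
  have "\<not> reducible w" using Cons.prems(2) unfolding reducible_def by (metis append_Cons)
  then obtain a m where IH: "foldr act_letter w (\<one>\<^bsub>A\<^esub>, []) = (a, m)" "(a, m) \<in> \<Omega>"
    "length m = length (filter (\<lambda>l. \<not> in_A l) w)"
    "m \<noteq> [] \<Longrightarrow> \<exists>u i b y c. w = u @ Inr (i, b) # y \<and> fst (snd (hd m)) = i \<and> i \<in> \<Lambda> \<and>
       (\<forall>l\<in>set u. in_A l) \<and> c \<in> C i \<and> a = A_prod u \<otimes>\<^bsub>A\<^esub> c"
    using Cons.IH Cons.prems(1) by (metis list.set_intros(2))
  have ok: "letter_ok l" "\<And>l'. l' \<in> set w \<Longrightarrow> letter_ok l'" using Cons.prems(1) by auto
  have a: "a \<in> carrier A" using IH(2) by (simp add: \<Omega>_def)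
  show ?case
  proof (cases "in_A l")
    case True
    have v: "A_val l \<in> carrier A" by (rule A_val_closed[OF ok(1) True])
    have e: "foldr act_letter (l # w) (\<one>\<^bsub>A\<^esub>, []) = (A_val l \<otimes>\<^bsub>A\<^esub> a, m)"
      using IH(1,2) act_letter_in_A[OF ok(1) True] by (simp add: act_A_def)
    have "(A_val l \<otimes>\<^bsub>A\<^esub> a, m) \<in> \<Omega>" using IH(2) v by (simp add: \<Omega>_def)
    moreover have "\<exists>u i b y c. l # w = u @ Inr (i, b) # y \<and> fst (snd (hd m)) = i \<and> i \<in> \<Lambda> \<and>
       (\<forall>l\<in>set u. in_A l) \<and> c \<in> C i \<and> A_val l \<otimes>\<^bsub>A\<^esub> a = A_prod u \<otimes>\<^bsub>A\<^esub> c" if ne: "m \<noteq> []"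
    proof -
      obtain u i b y c where u: "w = u @ Inr (i, b) # y" "fst (snd (hd m)) = i" "i \<in> \<Lambda>"
        "\<forall>l\<in>set u. in_A l" "c \<in> C i" "a = A_prod u \<otimes>\<^bsub>A\<^esub> c" using IH(4)[OF ne] by blast
      have "A_prod u \<in> carrier A" by (rule A_prod_closed) (use ok u in auto)
      then have "A_val l \<otimes>\<^bsub>A\<^esub> a = A_prod (l # u) \<otimes>\<^bsub>A\<^esub> c"
        using u v C_carrier[OF u(3,5)] by (simp add: A_prod_def A.m_assoc)
      moreover have "l # w = (l # u) @ Inr (i, b) # y" using u by simp
      ultimately show ?thesis using u True by (metis set_ConsD)
    qed
    ultimately show ?thesis using e IH(3) True by auto
  next
    case False
    then obtain i b where l: "l = Inr (i, b)" "i \<in> \<Lambda>" "b \<in> carrier (B i)" "b \<notin> D i"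
      using ok(1) by (cases l) (auto simp: in_A_def letter_ok_def)
    interpret Bi: group "B i" by (rule group_B[OF l(2)])
    interpret Di: subgroup "D i" "B i" by (rule sub_D[OF l(2)])
    have "\<not> crossing i a m"
    proof
      assume cr: "crossing i a m"
      then obtain u b' y c where u: "w = u @ Inr (i, b') # y" "\<forall>l\<in>set u. in_A l" "c \<in> C i" "a = A_prod u \<otimes>\<^bsub>A\<^esub> c"
        using IH(4) by (auto simp: crossing_def)
      interpret Ci: subgroup "C i" A by (rule sub_C[OF l(2)])
      have pc: "A_prod u \<in> carrier A" by (rule A_prod_closed) (use ok u in auto)
      have "a \<otimes>\<^bsub>A\<^esub> inv\<^bsub>A\<^esub> c \<in> C i" using cr u(3) by (simp add: crossing_def)
      moreover have "a \<otimes>\<^bsub>A\<^esub> inv\<^bsub>A\<^esub> c = A_prod u" using u pc by (simp add: A.m_assoc)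
      ultimately have "A_prod u \<in> C i" by simp
      then have "reducible (l # w)" unfolding reducible_def using u l
        by (intro exI[of _ "[]"] exI[of _ i] exI[of _ b] exI[of _ u] exI[of _ b'] exI[of _ y]) simp
      then show False using Cons.prems(2) by simp
    qed
    note r = A.coset_rep[OF sub_C[OF l(2)] a]
    let ?d = "j i (a \<otimes>\<^bsub>A\<^esub> inv\<^bsub>A\<^esub> (rA i a))"
    have ch: "chart i (a, m) = (?d, rA i a, m)" using \<open>\<not> crossing i a m\<close> by (simp add: chart_def)
    have d: "?d \<in> D i" using r(2) by simp
    have nD: "b \<otimes>\<^bsub>B i\<^esub> ?d \<notin> D i"
    proof
      assume "b \<otimes>\<^bsub>B i\<^esub> ?d \<in> D i"
      then have "b \<otimes>\<^bsub>B i\<^esub> ?d \<otimes>\<^bsub>B i\<^esub> inv\<^bsub>B i\<^esub> ?d \<in> D i"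
        by (rule Di.m_closed[OF _ Di.m_inv_closed[OF d]])
      moreover have "b \<otimes>\<^bsub>B i\<^esub> ?d \<otimes>\<^bsub>B i\<^esub> inv\<^bsub>B i\<^esub> ?d = b"
        using l(3) Di.mem_carrier[OF d] by (simp add: Bi.m_assoc)
      ultimately show False using l by simp
    qed
    have bd: "b \<otimes>\<^bsub>B i\<^esub> ?d \<in> carrier (B i)" using l(3) Di.mem_carrier[OF d] by simp
    let ?s = "rB i (b \<otimes>\<^bsub>B i\<^esub> ?d)"
    let ?c = "j_inv i (b \<otimes>\<^bsub>B i\<^esub> ?d \<otimes>\<^bsub>B i\<^esub> inv\<^bsub>B i\<^esub> ?s)"
    have c: "?c \<in> C i" using Bi.coset_rep(2)[OF sub_D[OF l(2)] bd] by (rule inv_into_into)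
    have e: "foldr act_letter (l # w) (\<one>\<^bsub>A\<^esub>, []) = (?c, (rA i a, i, ?s) # m)"
      using IH(1,2) l ch nD by (simp add: act_letter_def act_B_def chart_inv_def)
    have "(?c, (rA i a, i, ?s) # m) \<in> \<Omega>"
      using act_B_in_eq(1)[OF l(2,3) IH(2)] IH(1) e l by (simp add: act_letter_def)
    moreover have "?c = A_prod [] \<otimes>\<^bsub>A\<^esub> ?c" using C_carrier[OF l(2) c] by (simp add: A_prod_def)
    then have "\<exists>u i' b y c'. l # w = u @ Inr (i', b) # y \<and> i = i' \<and> i' \<in> \<Lambda> \<and>
       (\<forall>l\<in>set u. in_A l) \<and> c' \<in> C i' \<and> ?c = A_prod u \<otimes>\<^bsub>A\<^esub> c'"
      using l c by (intro exI[of _ "[]"] exI[of _ i] exI[of _ b] exI[of _ w] exI[of _ ?c]) simp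
    ultimately show ?thesis using e IH(3) False by auto
  qed
qed

theorem fixed_word_reducible:
  assumes "\<And>l. l \<in> set w \<Longrightarrow> letter_ok l" "foldr act_letter w (\<one>\<^bsub>A\<^esub>, []) = (\<one>\<^bsub>A\<^esub>, [])"
  shows "(\<forall>l\<in>set w. in_A l) \<or> reducible w"
proof (rule disjCI)
  assume "\<not> reducible w"
  from irreducible_depth[OF assms(1) this] assms(2) have "filter (\<lambda>l. \<not> in_A l) w = []" by auto
  then show "\<forall>l\<in>set w. in_A l" by (simp add: filter_empty_conv)
qed

end

section \<open>Homomorphisms\<close>
definition map_letter :: "('a \<Rightarrow> 'b) \<Rightarrow> ('l \<Rightarrow> 'k) \<Rightarrow> ('a, 'l) gen letter \<Rightarrow> ('b, 'k) gen letter" where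
  "map_letter f \<kappa> = map_prod (map_sum f (map_prod \<kappa> f)) id"

lemma map_letter_simps [simp]:
  "map_letter f \<kappa> (Inl s, b) = (Inl (f s), b)"
  "map_letter f \<kappa> (Inr (i, h), b) = (Inr (\<kappa> i, f h), b)"
  "inv_letter (map_letter f \<kappa> l) = map_letter f \<kappa> (inv_letter l)"
  by (simp_all add: map_letter_def inv_letter_def)

lemma inv_word_map_letter: "inv_word (map (map_letter f \<kappa>) w) = map (map_letter f \<kappa>) (inv_word w)"
  by (induction w) auto

lemma cyclic_relator_map_letter:
  "cyclic_relator R t \<Longrightarrow> cyclic_relator (map (map_letter f \<kappa>) ` R) (map (map_letter f \<kappa>) t)"
  unfolding cyclic_relator_def by (metis imageI inv_word_map_letter map_append)

lemma gen_cases: "(\<And>s. x = Inl s \<Longrightarrow> P) \<Longrightarrow> (\<And>i h. x = Inr (i, h) \<Longrightarrow> P) \<Longrightarrow> P"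
  by (cases x) auto

lemma letter_cases: "(\<And>s b. l = (Inl s, b) \<Longrightarrow> P) \<Longrightarrow> (\<And>i h b. l = (Inr (i, h), b) \<Longrightarrow> P) \<Longrightarrow> P"
  by (cases l; cases "fst l") auto

lemma map_letter_in:
  assumes "f ` S \<subseteq> S2" "\<kappa> ` \<Lambda> \<subseteq> \<Lambda>2" "\<forall>i\<in>\<Lambda>. f ` H i \<subseteq> H2 (\<kappa> i)" "fst l \<in> rel_gens S \<Lambda> H"
  shows "fst (map_letter f \<kappa> l) \<in> rel_gens S2 \<Lambda>2 H2"
proof -
  have "\<And>i h. i \<in> \<Lambda> \<Longrightarrow> h \<in> H i \<Longrightarrow> f h \<in> H2 (\<kappa> i)" using assms(3) by blast
  then show ?thesis using assms(1,2,4) by (cases l rule: letter_cases) auto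
qed

lemma word_val_map_letter:
  assumes hom: "group_hom G G2 f" and X: "gen_val ` X \<subseteq> carrier G" and w: "w \<in> words X"
  shows "word_val G2 gen_val (map (map_letter f \<kappa>) w) = f (word_val G gen_val w)"
proof -
  interpret group_hom G G2 f by (rule hom)
  show ?thesis using w
  proof (induction w)
    case (Cons l w)
    have l: "gen_val (fst l) \<in> carrier G" using Cons X by auto
    have "letter_val G2 gen_val (map_letter f \<kappa> l) = f (letter_val G gen_val l)"
      using l by (cases l rule: letter_cases) (auto simp: letter_val_def)
    then show ?case using Cons G.letter_val_closed[OF X, of l] G.word_val_closed[OF X, of w]
      by (simp add: word_val_Cons)
  qed simp
qed

lemma fills_hom:
  assumes hom: "group_hom G G2 f" and S: "S \<subseteq> carrier G" and H: "\<And>i. i \<in> \<Lambda> \<Longrightarrow> H i \<subseteq> carrier G"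
    and m: "f ` S \<subseteq> S2" "\<kappa> ` \<Lambda> \<subseteq> \<Lambda>2" "\<forall>i\<in>\<Lambda>. f ` H i \<subseteq> H2 (\<kappa> i)"
    and F: "fills (rel_gens S \<Lambda> H) (rel_label G \<Lambda> H R) k w"
  shows "fills (rel_gens S2 \<Lambda>2 H2) (rel_label G2 \<Lambda>2 H2 (map (map_letter f \<kappa>) ` R)) k (map (map_letter f \<kappa>) w)"
proof (rule fills_map[OF _ _ F])
  interpret group_hom G G2 f by (rule hom)
  note X = gen_val_rel_gens[OF S H]
  show "fst (map_letter f \<kappa> l) \<in> rel_gens S2 \<Lambda>2 H2 \<and> map_letter f \<kappa> (inv_letter l) = inv_letter (map_letter f \<kappa> l)"
    if "fst l \<in> rel_gens S \<Lambda> H" for l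
    using map_letter_in[OF m that] by simp
  fix t c assume t: "t \<in> words (rel_gens S \<Lambda> H)" "rel_label G \<Lambda> H R t c"
  show "rel_label G2 \<Lambda>2 H2 (map (map_letter f \<kappa>) ` R) (map (map_letter f \<kappa>) t) c"
  proof (cases "c = 1 \<and> cyclic_relator R t")
    case True
    then show ?thesis using cyclic_relator_map_letter[of R t f \<kappa>] by (simp add: face_label_def)
  next
    case False
    then have c: "c = 0" "cyclic_relator (peripheral_relators G \<Lambda> H) t" using t by (auto simp: face_label_def)
    then have "t \<in> peripheral_relators G \<Lambda> H" using G.cyclic_peripheral[of \<Lambda> H t] H by blast
    then obtain i where i: "i \<in> \<Lambda>" "\<And>l. l \<in> set t \<Longrightarrow> \<exists>h\<in>H i. fst l = Inr (i, h)" "word_val G gen_val t = \<one>\<^bsub>G\<^esub>"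
      by (auto simp: peripheral_relators_iff)
    have "\<exists>h\<in>H2 (\<kappa> i). fst (map_letter f \<kappa> l) = Inr (\<kappa> i, h)" if "l \<in> set t" for l
      using i(2)[OF that] bspec[OF m(3) i(1)] by (cases l) auto
    moreover have "word_val G2 gen_val (map (map_letter f \<kappa>) t) = \<one>\<^bsub>G2\<^esub>"
      using word_val_map_letter[OF hom X t(1)] i(3) by simp
    ultimately have "map (map_letter f \<kappa>) t \<in> peripheral_relators G2 \<Lambda>2 H2"
      using i(1) m(2) unfolding peripheral_relators_iff by (intro bexI[of _ "\<kappa> i"]) auto
    then show ?thesis using c cyclic_relatorI by (auto simp: face_label_def)
  qed
qed

lemma free_product_elements_map:
  assumes hom: "group_hom G G2 f" and S: "S \<subseteq> carrier G" and H: "\<And>i. i \<in> \<Lambda> \<Longrightarrow> H i \<subseteq> carrier G"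
    and m: "f ` S \<subseteq> S2" "\<kappa> ` \<Lambda> \<subseteq> \<Lambda>2" "\<forall>i\<in>\<Lambda>. f ` H i \<subseteq> H2 (\<kappa> i)"
    and inj: "inj_on f (carrier G)" "inj_on \<kappa> \<Lambda>"
    and w: "w \<in> free_product_elements G S \<Lambda> H"
  shows "map (map_letter f \<kappa>) w \<in> free_product_elements G2 S2 \<Lambda>2 H2"
proof -
  interpret group_hom G G2 f by (rule hom)
  have w: "w \<in> words (rel_gens S \<Lambda> H)" "\<And>i h b. (Inr (i, h), b) \<in> set w \<Longrightarrow> h \<noteq> \<one>\<^bsub>G\<^esub> \<and> b"
    "successively nf_adjacent w" using w by (auto simp: free_product_elements_def)
  have lin: "fst l \<in> rel_gens S \<Lambda> H" if "l \<in> set w" for l using w(1) that by (auto simp: words_iff)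
  have "map (map_letter f \<kappa>) w \<in> words (rel_gens S2 \<Lambda>2 H2)"
    using lin map_letter_in[OF m] by (auto simp: words_iff)
  moreover have "h \<noteq> \<one>\<^bsub>G2\<^esub> \<and> b" if "(Inr (i, h), b) \<in> set (map (map_letter f \<kappa>) w)" for i h b
  proof -
    obtain l where l: "l \<in> set w" "(Inr (i, h), b) = map_letter f \<kappa> l" using \<open>_ \<in> set _\<close> by auto
    then obtain i' h' where l': "l = (Inr (i', h'), b)" "h = f h'" by (cases l rule: letter_cases) auto
    then have "h' \<noteq> \<one>\<^bsub>G\<^esub>" "b" "h' \<in> carrier G" using w(2)[of i' h' b] lin[OF l(1)] l(1) H by auto
    then show ?thesis using l' inj(1) by (metis G.one_closed hom_one inj_onD)
  qed
  moreover have "successively nf_adjacent (map (map_letter f \<kappa>) w)"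
    unfolding successively_map
  proof (rule successively_mono[OF w(3)])
    fix l l' assume l: "l \<in> set w" "l' \<in> set w" "nf_adjacent l l'"
    show "nf_adjacent (map_letter f \<kappa> l) (map_letter f \<kappa> l')"
      using l(3) lin[OF l(1)] lin[OF l(2)] S inj
      by (cases l rule: letter_cases; cases l' rule: letter_cases) (auto dest: inj_onD)
  qed
  ultimately show ?thesis by (auto simp: free_product_elements_def)
qed

lemma relatively_hyperbolic_iso:
  assumes rh: "relatively_hyperbolic G \<Lambda> H" and G2: "group G2" and f: "f \<in> iso G G2"
    and \<kappa>: "inj_on \<kappa> \<Lambda>" and H2: "\<And>i. i \<in> \<Lambda> \<Longrightarrow> H2 (\<kappa> i) = f ` H i"
  shows "relatively_hyperbolic G2 (\<kappa> ` \<Lambda>) H2"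
proof -
  obtain S R and C :: real where r: "group G" "\<And>i. i \<in> \<Lambda> \<Longrightarrow> subgroup (H i) G"
    "finite S" "S \<subseteq> carrier G" "finite R" "R \<subseteq> free_product_elements G S \<Lambda> H" "0 \<le> C"
    "is_presentation G gen_val (rel_gens S \<Lambda> H) (R \<union> peripheral_relators G \<Lambda> H)"
    "\<And>w. w \<in> words (rel_gens S \<Lambda> H) \<Longrightarrow> word_val G gen_val w = \<one>\<^bsub>G\<^esub> \<Longrightarrow>
      \<exists>k. fills (rel_gens S \<Lambda> H) (rel_label G \<Lambda> H R) k w \<and> real k \<le> C * real (length w)"
    using relatively_hyperbolicD[OF rh] by blast
  interpret group_hom G G2 f
    using r(1) G2 f by (intro group_hom.intro group_hom_axioms.intro) (auto simp: iso_def)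
  have inj: "inj_on f (carrier G)" and surj: "f ` carrier G = carrier G2"
    using f by (auto simp: iso_def bij_betw_def)
  have Hc: "H i \<subseteq> carrier G" if "i \<in> \<Lambda>" for i using r(2)[OF that] by (rule subgroup.subset)
  note X = gen_val_rel_gens[OF r(4) Hc]
  let ?m = "map (map_letter f \<kappa>)"
  have val: "word_val G2 gen_val (?m w) = f (word_val G gen_val w)" if "w \<in> words (rel_gens S \<Lambda> H)" for w
    by (rule word_val_map_letter[OF group_hom_axioms X that])
  have onto: "\<exists>w\<in>words (rel_gens S \<Lambda> H). v = ?m w" if "v \<in> words (rel_gens (f ` S) (\<kappa> ` \<Lambda>) H2)" for v
    using that
  proof (induction v)
    case Nil
    then show ?case by (intro bexI[of _ "[]"]) auto
  next
    case (Cons l v)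
    then obtain w where w: "w \<in> words (rel_gens S \<Lambda> H)" "v = ?m w" by auto
    have "\<exists>l'. fst l' \<in> rel_gens S \<Lambda> H \<and> l = map_letter f \<kappa> l'"
    proof (cases l rule: letter_cases)
      case (1 s b)
      then obtain s' where "s' \<in> S" "s = f s'" using Cons by auto
      then show ?thesis using 1 by (intro exI[of _ "(Inl s', b)"]) simp
    next
      case (2 i h b)
      then obtain i' h' where "i' \<in> \<Lambda>" "i = \<kappa> i'" "h' \<in> H i'" "h = f h'" using Cons H2 by auto
      then show ?thesis using 2 by (intro exI[of _ "(Inr (i', h'), b)"]) simp
    qed
    then obtain l' where "fst l' \<in> rel_gens S \<Lambda> H" "l = map_letter f \<kappa> l'" by blast
    then show ?case using w by (intro bexI[of _ "l' # w"]) auto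
  qed
  have m: "f ` S \<subseteq> f ` S" "\<kappa> ` \<Lambda> \<subseteq> \<kappa> ` \<Lambda>" "\<forall>i\<in>\<Lambda>. f ` H i \<subseteq> H2 (\<kappa> i)" using H2 by auto
  have R1: "word_val G gen_val w = \<one>\<^bsub>G\<^esub>" "w \<in> words (rel_gens S \<Lambda> H)" if "w \<in> R" for w
    using relator_trivial[OF r(8)] that by auto
  show ?thesis
  proof (rule relatively_hyperbolicI[of G2 "\<kappa> ` \<Lambda>" H2 "f ` S" "?m ` R" C])
    show "group G2" by (rule G2)
    show "subgroup (H2 i) G2" if "i \<in> \<kappa> ` \<Lambda>" for i
      using that H2 subgroup_img_is_subgroup[OF r(2)] by auto
    show "finite (f ` S)" "f ` S \<subseteq> carrier G2" "finite (?m ` R)" using r by auto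
    show "?m ` R \<subseteq> free_product_elements G2 (f ` S) (\<kappa> ` \<Lambda>) H2"
      using free_product_elements_map[OF group_hom_axioms r(4) Hc m inj \<kappa>] r(6) by blast
    show "word_val G2 gen_val v = \<one>\<^bsub>G2\<^esub>" if "v \<in> ?m ` R" for v
      using that val R1 by auto
    show "carrier G2 \<subseteq> word_val G2 gen_val ` words (rel_gens (f ` S) (\<kappa> ` \<Lambda>) H2)"
    proof
      fix g assume "g \<in> carrier G2"
      then obtain w where w: "w \<in> words (rel_gens S \<Lambda> H)" "g = f (word_val G gen_val w)"
        using surj r(8) unfolding is_presentation_def by (metis (no_types, lifting) imageE)
      have "?m w \<in> words (rel_gens (f ` S) (\<kappa> ` \<Lambda>) H2)"
        using w(1) map_letter_in[OF m] by (auto simp: words_iff)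
      then show "g \<in> word_val G2 gen_val ` words (rel_gens (f ` S) (\<kappa> ` \<Lambda>) H2)"
        using val[OF w(1)] w(2) by (metis imageI)
    qed
    fix v assume v: "v \<in> words (rel_gens (f ` S) (\<kappa> ` \<Lambda>) H2)" "word_val G2 gen_val v = \<one>\<^bsub>G2\<^esub>"
    obtain w where w: "w \<in> words (rel_gens S \<Lambda> H)" "v = ?m w" using onto[OF v(1)] by blast
    have "f (word_val G gen_val w) = f \<one>\<^bsub>G\<^esub>" using v(2) val[OF w(1)] w(2) by simp
    then have "word_val G gen_val w = \<one>\<^bsub>G\<^esub>"
      by (rule inj_onD[OF inj _ G.word_val_closed[OF X w(1)] G.one_closed])
    then obtain k where k: "fills (rel_gens S \<Lambda> H) (rel_label G \<Lambda> H R) k w" "real k \<le> C * real (length w)"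
      using r(9)[OF w(1)] by blast
    from fills_hom[OF group_hom_axioms r(4) Hc m k(1)] k(2) w(2)
    show "\<exists>k. fills (rel_gens (f ` S) (\<kappa> ` \<Lambda>) H2) (rel_label G2 (\<kappa> ` \<Lambda>) H2 (?m ` R)) k v \<and>
        real k \<le> C * real (length v)" by auto
  qed
qed

lemma presentation_universal:
  assumes pres: "is_presentation G f X Rels" and L: "group L" and F: "F ` X \<subseteq> carrier L"
    and rel: "\<And>r. r \<in> Rels \<Longrightarrow> word_val L F r = \<one>\<^bsub>L\<^esub>"
  obtains \<theta> where "\<theta> \<in> hom G L" "\<And>x. x \<in> X \<Longrightarrow> \<theta> (f x) = F x"
proof -
  interpret G: group G using pres by (simp add: is_presentation_def)
  interpret L: group L by (rule L)
  have p: "f ` X \<subseteq> carrier G" "Rels \<subseteq> words X" "word_val G f ` words X = carrier G"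
    "\<And>u v. u \<in> words X \<Longrightarrow> v \<in> words X \<Longrightarrow> word_val G f u = word_val G f v \<longleftrightarrow> pres_eq X Rels u v"
    using pres by (auto simp: is_presentation_def)
  define wd where "wd g = (SOME w. w \<in> words X \<and> word_val G f w = g)" for g
  define \<theta> where "\<theta> g = word_val L F (wd g)" for g
  have wd: "wd g \<in> words X" "word_val G f (wd g) = g" if "g \<in> carrier G" for g
  proof -
    have "g \<in> word_val G f ` words X" using that p(3) by simp
    then have "\<exists>w. w \<in> words X \<and> word_val G f w = g" by blast
    then have "wd g \<in> words X \<and> word_val G f (wd g) = g" unfolding wd_def by (rule someI_ex)
    then show "wd g \<in> words X" "word_val G f (wd g) = g" by auto
  qed
  have \<theta>: "\<theta> (word_val G f w) = word_val L F w" if w: "w \<in> words X" for w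
  proof -
    have g: "word_val G f w \<in> carrier G" by (rule G.word_val_closed[OF p(1) w])
    have "pres_eq X Rels (wd (word_val G f w)) w" using p(4)[of "wd (word_val G f w)" w] wd[OF g] w by simp
    from L.pres_eq_sound[OF F p(2) rel this] show ?thesis by (simp add: \<theta>_def)
  qed
  show ?thesis
  proof (rule that)
    show "\<theta> \<in> hom G L"
    proof (rule homI)
      fix g assume g: "g \<in> carrier G"
      show "\<theta> g \<in> carrier L" using L.word_val_closed[OF F wd(1)[OF g]] by (simp add: \<theta>_def)
      fix h assume h: "h \<in> carrier G"
      have "word_val G f (wd g @ wd h) = g \<otimes>\<^bsub>G\<^esub> h" using wd[OF g] wd[OF h] by (simp add: G.word_val_append[OF p(1)])
      then show "\<theta> (g \<otimes>\<^bsub>G\<^esub> h) = \<theta> g \<otimes>\<^bsub>L\<^esub> \<theta> h"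
        using \<theta>[of "wd g @ wd h"] wd[OF g] wd[OF h] by (simp add: \<theta>_def L.word_val_append[OF F])
    qed
    fix x assume x: "x \<in> X"
    have "f x \<in> carrier G" "F x \<in> carrier L" using x p(1) F by auto
    then show "\<theta> (f x) = F x"
      using \<theta>[of "[(x, True)]"] x by (simp add: word_val_Cons letter_val_def)
  qed
qed

section \<open>The quotient as an amalgam\<close>
lemma (in group) normal_closure:
  assumes A: "A \<subseteq> carrier G"
  shows "normal_closure G A \<lhd> G" "A \<subseteq> normal_closure G A"
    "M \<lhd> G \<Longrightarrow> A \<subseteq> M \<Longrightarrow> normal_closure G A \<subseteq> M"
proof -
  let ?F = "{N. N \<lhd> G \<and> A \<subseteq> N}"
  have c: "carrier G \<in> ?F" using A by (simp add: normal_inv_iff subgroup_self)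
  have "subgroup (\<Inter>?F) G" using c by (intro subgroups_Inter) (auto intro: normal_imp_subgroup)
  moreover have "x \<otimes> h \<otimes> inv x \<in> \<Inter>?F" if "x \<in> carrier G" "h \<in> \<Inter>?F" for x h
    using that by (auto simp: normal_inv_iff)
  ultimately show "normal_closure G A \<lhd> G" by (simp add: normal_closure_def normal_inv_iff)
  show "A \<subseteq> normal_closure G A" by (auto simp: normal_closure_def)
  show "M \<lhd> G \<Longrightarrow> A \<subseteq> M \<Longrightarrow> normal_closure G A \<subseteq> M" by (auto simp: normal_closure_def)
qed

lemma word_val_hom:
  assumes hom: "group_hom G L h" and f: "f ` X \<subseteq> carrier G" and F: "\<And>x. x \<in> X \<Longrightarrow> F x = h (f x)"
    and w: "w \<in> words X"
  shows "word_val L F w = h (word_val G f w)"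
proof -
  interpret group_hom G L h by (rule hom)
  show ?thesis using w
  proof (induction w)
    case (Cons l w)
    then have "f (fst l) \<in> carrier G" using f by auto
    then have "letter_val L F l = h (letter_val G f l)" using F Cons by (auto simp: letter_val_def)
    then show ?case using Cons G.letter_val_closed[OF f, of l] G.word_val_closed[OF f, of w]
      by (simp add: word_val_Cons)
  qed simp
qed

lemma (in group) rcos_eq_iff:
  assumes N: "subgroup N G" and g: "g \<in> carrier G" "h \<in> carrier G"
  shows "N #> g = N #> h \<longleftrightarrow> g \<otimes> inv h \<in> N"
proof
  assume "N #> g = N #> h"
  then obtain n where n: "n \<in> N" "g = n \<otimes> h" using rcos_self[OF g(1) N] by (auto simp: r_coset_def)
  then have "n \<in> carrier G" using subgroup.subset[OF N] by blast
  then show "g \<otimes> inv h \<in> N" using n g by (simp add: m_assoc)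
next
  assume n: "g \<otimes> inv h \<in> N"
  have "g = (g \<otimes> inv h) \<otimes> h" using g by (simp add: m_assoc)
  then have "g \<in> N #> h" using n by (auto simp: r_coset_def)
  then show "N #> g = N #> h" using repr_independence[OF _ g(2) N] by simp
qed

text \<open>Here \<open>\<Gamma>\<close> and \<open>core i\<close> are the finitely generated part of \<open>G\<close> and of \<open>H i\<close> that carries the relators, and
  \<open>\<pi>\<close> maps \<open>\<Gamma>\<close> onto a filling \<open>Q0\<close> of it whose peripheral subgroups are the images of the \<open>core i\<close>,
  indexed through \<open>\<kappa>\<close>. The conditions \<open>ker_N\<close> and \<open>ker_core\<close> say that \<open>\<pi>\<close> kills nothing
  that survives in \<open>G / N\<close> and meets \<open>core i\<close> exactly in \<open>K i\<close>; the latter is assertion (1) for \<open>Q0\<close>.\<close>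
locale relative_filling =
  fixes G :: "('a, 'm) monoid_scheme" (structure) and \<Lambda> :: "'l set" and H K A :: "'l \<Rightarrow> 'a set"
    and S :: "'a set" and R :: "('a, 'l) gen word set" and \<Lambda>0 :: "'l set"
    and Q0 :: "('q, 'z) monoid_scheme" and \<pi> :: "'a \<Rightarrow> 'q" and \<kappa> :: "'l \<Rightarrow> 'k" and P :: "'k \<Rightarrow> 'q set"
    and N \<Gamma> :: "'a set" and core :: "'l \<Rightarrow> 'a set"
  defines "N \<equiv> normal_closure G (\<Union>i\<in>\<Lambda>. K i)" and "\<Gamma> \<equiv> generate G (S \<union> (\<Union>i\<in>\<Lambda>. A i))"
    and "core \<equiv> \<lambda>i. generate G (A i)"
  assumes pres: "is_presentation G gen_val (rel_gens S \<Lambda> H) (R \<union> peripheral_relators G \<Lambda> H)"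
    and H: "\<And>i. i \<in> \<Lambda> \<Longrightarrow> subgroup (H i) G"
    and K: "\<And>i. i \<in> \<Lambda> \<Longrightarrow> K i \<lhd> G\<lparr>carrier := H i\<rparr>"
    and A: "\<And>i. i \<in> \<Lambda> \<Longrightarrow> A i \<subseteq> H i" and A_empty: "\<And>i. i \<in> \<Lambda> \<Longrightarrow> i \<notin> \<Lambda>0 \<Longrightarrow> A i = {}"
    and \<Lambda>0: "\<Lambda>0 \<subseteq> \<Lambda>"
    and R: "R \<subseteq> words (rel_gens S \<Lambda> core)"
    and Q0: "group Q0" and \<pi>_hom: "\<pi> \<in> hom (G\<lparr>carrier := \<Gamma>\<rparr>) Q0" and \<pi>_onto: "\<pi> ` \<Gamma> = carrier Q0"
    and ker_N: "\<And>g. g \<in> \<Gamma> \<Longrightarrow> \<pi> g = \<one>\<^bsub>Q0\<^esub> \<Longrightarrow> g \<in> N"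
    and ker_core: "\<And>i h. i \<in> \<Lambda> \<Longrightarrow> h \<in> core i \<Longrightarrow> \<pi> h = \<one>\<^bsub>Q0\<^esub> \<longleftrightarrow> h \<in> K i"
    and \<kappa>: "inj_on \<kappa> \<Lambda>0" and P: "\<And>i. i \<in> \<Lambda>0 \<Longrightarrow> P (\<kappa> i) = \<pi> ` core i"
    and rh: "relatively_hyperbolic Q0 (\<kappa> ` \<Lambda>0) P"
begin

sublocale group G using pres by (simp add: is_presentation_def)
sublocale Q0: group Q0 by (rule Q0)

lemma gens: "gen_val ` rel_gens S \<Lambda> H \<subseteq> carrier G"
  using pres by (simp add: is_presentation_def)

lemma S_carrier: "S \<subseteq> carrier G"
proof
  fix s assume "s \<in> S"
  then have "gen_val (Inl s :: ('a, 'l) gen) \<in> carrier G" using gens by (metis image_subset_iff rel_gens_simps(1))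
  then show "s \<in> carrier G" by simp
qed

lemma H_carrier: "i \<in> \<Lambda> \<Longrightarrow> H i \<subseteq> carrier G" using H subgroup.subset by blast

lemma \<Gamma>: "subgroup \<Gamma> G"
  unfolding \<Gamma>_def using S_carrier A H_carrier by (intro generate_is_subgroup) blast

lemma core: "i \<in> \<Lambda> \<Longrightarrow> subgroup (core i) G" "i \<in> \<Lambda> \<Longrightarrow> core i \<subseteq> H i" "i \<in> \<Lambda> \<Longrightarrow> core i \<subseteq> \<Gamma>"
proof -
  assume i: "i \<in> \<Lambda>"
  show "subgroup (core i) G"
    unfolding core_def using A[OF i] H_carrier[OF i] by (intro generate_is_subgroup) blast
  show "core i \<subseteq> H i" unfolding core_def by (rule generate_subgroup_incl[OF A[OF i] H[OF i]])
  show "core i \<subseteq> \<Gamma>" unfolding core_def \<Gamma>_def using i by (intro mono_generate) blast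
qed

lemma core_trivial: "i \<in> \<Lambda> \<Longrightarrow> i \<notin> \<Lambda>0 \<Longrightarrow> core i = {\<one>}"
  using A_empty generate_empty by (simp add: core_def)

lemma S_\<Gamma>: "S \<subseteq> \<Gamma>" unfolding \<Gamma>_def by (auto intro: generate.incl)

lemma \<Gamma>_carrier: "\<Gamma> \<subseteq> carrier G" by (rule subgroup.subset[OF \<Gamma>])

lemma K_sub: "i \<in> \<Lambda> \<Longrightarrow> K i \<subseteq> H i"
  using normal_imp_subgroup[OF K] subgroup.subset by fastforce

lemma K_subgroup: "i \<in> \<Lambda> \<Longrightarrow> subgroup (K i) G"
  by (rule incl_subgroup[OF H normal_imp_subgroup[OF K]])

lemma N: "N \<lhd> G" "i \<in> \<Lambda> \<Longrightarrow> K i \<subseteq> N" "M \<lhd> G \<Longrightarrow> (\<And>i. i \<in> \<Lambda> \<Longrightarrow> K i \<subseteq> M) \<Longrightarrow> N \<subseteq> M"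
proof -
  have "(\<Union>i\<in>\<Lambda>. K i) \<subseteq> carrier G" using K_sub H_carrier by blast
  note nc = normal_closure[OF this, folded N_def]
  show "N \<lhd> G" "i \<in> \<Lambda> \<Longrightarrow> K i \<subseteq> N" using nc by auto
  show "M \<lhd> G \<Longrightarrow> (\<And>i. i \<in> \<Lambda> \<Longrightarrow> K i \<subseteq> M) \<Longrightarrow> N \<subseteq> M" using nc(3)[of M] by blast
qed

sublocale \<pi>: group_hom "G\<lparr>carrier := \<Gamma>\<rparr>" Q0 \<pi>
  by (intro group_hom.intro group_hom_axioms.intro subgroup_imp_group \<Gamma> Q0 \<pi>_hom)

lemma \<pi>_mult: "g \<in> \<Gamma> \<Longrightarrow> h \<in> \<Gamma> \<Longrightarrow> \<pi> (g \<otimes> h) = \<pi> g \<otimes>\<^bsub>Q0\<^esub> \<pi> h"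
  using \<pi>.hom_mult by simp

lemma \<pi>_one: "\<pi> \<one> = \<one>\<^bsub>Q0\<^esub>"
  using \<pi>.hom_one by simp

lemma \<pi>_inv: "g \<in> \<Gamma> \<Longrightarrow> \<pi> (inv g) = inv\<^bsub>Q0\<^esub> (\<pi> g)"
  using \<pi>.hom_inv[of g] m_inv_consistent[OF \<Gamma>, of g] by simp

lemma \<pi>_eq: "g \<in> \<Gamma> \<Longrightarrow> h \<in> \<Gamma> \<Longrightarrow> \<pi> g = \<pi> h \<longleftrightarrow> \<pi> (g \<otimes> inv h) = \<one>\<^bsub>Q0\<^esub>"
  using \<pi>_mult[of g "inv h"] \<pi>_inv[of h] subgroup.m_inv_closed[OF \<Gamma>, of h] \<pi>.hom_closed[of g] \<pi>.hom_closed[of h]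
  by (simp add: Q0.inv_solve_right')

abbreviation B :: "'l \<Rightarrow> 'a set monoid" where "B i \<equiv> subgroup_quotient G (H i) (K i)"

abbreviation C :: "'l \<Rightarrow> 'q set" where "C i \<equiv> \<pi> ` core i"

text \<open>The embedding of \<open>core i / (K i \<inter> core i)\<close> into \<open>H i / K i\<close>, with the former seen as a subgroup of \<open>Q0\<close>.\<close>
definition j :: "'l \<Rightarrow> 'q \<Rightarrow> 'a set" where
  "j i c = K i #> (SOME h. h \<in> core i \<and> \<pi> h = c)"

lemma carrier_B: "carrier (B i) = (\<lambda>h. K i #> h) ` H i"
  by (auto simp: subgroup_quotient_def FactGroup_def RCOSETS_def r_coset_def)

lemma coset_hom: "i \<in> \<Lambda> \<Longrightarrow> group_hom (G\<lparr>carrier := H i\<rparr>) (B i) (\<lambda>h. K i #> h)"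
proof -
  assume i: "i \<in> \<Lambda>"
  interpret Ki: normal "K i" "G\<lparr>carrier := H i\<rparr>" by (rule K[OF i])
  have "(\<lambda>h. K i #>\<^bsub>G\<lparr>carrier := H i\<rparr>\<^esub> h) \<in> hom (G\<lparr>carrier := H i\<rparr>) (B i)"
    unfolding subgroup_quotient_def by (rule Ki.r_coset_hom_Mod)
  then show ?thesis
    by (intro group_hom.intro group_hom_axioms.intro subgroup_imp_group H i)
      (auto simp: subgroup_quotient_def Ki.factorgroup_is_group r_coset_def)
qed

lemma group_B: "i \<in> \<Lambda> \<Longrightarrow> group (B i)"
  using coset_hom by (simp add: group_hom_def)

lemma j_core: 
  assumes i: "i \<in> \<Lambda>" and h: "h \<in> core i"
  shows "j i (\<pi> h) = K i #> h"
proof -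
  let ?h = "SOME h'. h' \<in> core i \<and> \<pi> h' = \<pi> h"
  have h': "?h \<in> core i \<and> \<pi> ?h = \<pi> h" by (rule someI[of _ h]) (use h in simp)
  interpret core: subgroup "core i" G by (rule core(1)[OF i])
  have "?h \<otimes> inv h \<in> core i" using h h' by simp
  moreover have "\<pi> (?h \<otimes> inv h) = \<one>\<^bsub>Q0\<^esub>" using \<pi>_eq[of ?h h] h h' core(3)[OF i] by blast
  ultimately have "?h \<otimes> inv h \<in> K i" using ker_core[OF i] by simp
  then show ?thesis unfolding j_def using rcos_eq_iff[OF K_subgroup[OF i], of ?h h] h h' by simp
qed

sublocale amalgam Q0 B C j \<Lambda>
proof (rule amalgam.intro)
  fix i assume i: "i \<in> \<Lambda>"
  interpret core: subgroup "core i" G by (rule core(1)[OF i])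
  interpret ch: group_hom "G\<lparr>carrier := H i\<rparr>" "B i" "\<lambda>h. K i #> h" by (rule coset_hom[OF i])
  show "group (B i)" by (rule group_B[OF i])
  show "subgroup (C i) Q0"
    by (rule \<pi>.subgroup_img_is_subgroup[OF subgroup_incl[OF core(1)[OF i] \<Gamma> core(3)[OF i]]])
  fix c assume "c \<in> C i"
  then obtain h where h: "h \<in> core i" "c = \<pi> h" by auto
  then have hH: "h \<in> H i" "h \<in> \<Gamma>" using core(2,3)[OF i] by auto
  show "j i c \<in> carrier (B i)" using j_core[OF i h(1)] h hH carrier_B by auto
  fix d assume "d \<in> C i"
  then obtain h' where h': "h' \<in> core i" "d = \<pi> h'" by auto
  then have h'H: "h' \<in> H i" "h' \<in> \<Gamma>" using core(2,3)[OF i] by auto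
  show "j i (c \<otimes>\<^bsub>Q0\<^esub> d) = j i c \<otimes>\<^bsub>B i\<^esub> j i d"
    using j_core[OF i, of "h \<otimes> h'"] j_core[OF i h(1)] j_core[OF i h'(1)] h h' hH h'H
      ch.hom_mult[of h h'] \<pi>_mult[of h h'] by simp
next
  fix i assume i: "i \<in> \<Lambda>"
  interpret core: subgroup "core i" G by (rule core(1)[OF i])
  show "inj_on (j i) (C i)"
  proof (rule inj_onI)
    fix c d assume "c \<in> C i" "d \<in> C i" and eq: "j i c = j i d"
    then obtain h h' where h: "h \<in> core i" "c = \<pi> h" "h' \<in> core i" "d = \<pi> h'" by auto
    then have "h \<otimes> inv h' \<in> K i"
      using eq j_core[OF i] rcos_eq_iff[OF K_subgroup[OF i], of h h'] by simp
    then have "\<pi> (h \<otimes> inv h') = \<one>\<^bsub>Q0\<^esub>" using ker_core[OF i, of "h \<otimes> inv h'"] h by simp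
    then show "c = d" using \<pi>_eq[of h h'] h core(3)[OF i] by blast
  qed
qed (rule Q0)

abbreviation "L \<equiv> permutation_group \<Omega>"

lemma act_B_coset_hom: "i \<in> \<Lambda> \<Longrightarrow> group_hom (G\<lparr>carrier := H i\<rparr>) L (\<lambda>h. act_B i (K i #> h))"
  using coset_hom[of i] act_B_hom[of i] Group.hom_compose[of "\<lambda>h. K i #> h" "G\<lparr>carrier := H i\<rparr>" "B i" "act_B i" L]
  by (auto simp: group_hom_def group_hom_axioms_def comp_def group_permutation_group)

lemma act_A_\<pi>_hom: "group_hom (G\<lparr>carrier := \<Gamma>\<rparr>) L (\<lambda>g. act_A (\<pi> g))"
  using act_A_hom Group.hom_compose[OF \<pi>_hom act_A_hom] subgroup_imp_group[OF \<Gamma>]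
  by (auto simp: group_hom_def group_hom_axioms_def comp_def group_permutation_group)

text \<open>Let \<open>S\<close> act through \<open>Q0\<close> and \<open>H i\<close> through \<open>H i / K i\<close>. The relators in \<open>R\<close> act trivially because
  their peripheral letters lie in the cores and thus act through \<open>Q0\<close> as well.\<close>
lemma exists_action:
  "\<exists>\<theta>. \<theta> \<in> hom G L \<and> (\<forall>g\<in>\<Gamma>. \<theta> g = act_A (\<pi> g)) \<and> (\<forall>i\<in>\<Lambda>. \<forall>h\<in>H i. \<theta> h = act_B i (K i #> h))"
proof -
  define F where "F = case_sum (\<lambda>s. act_A (\<pi> s)) (\<lambda>(i, h). act_B i (K i #> h))"
  let ?X = "rel_gens S \<Lambda> H" and ?Y = "rel_gens S \<Lambda> core"
  have F_simps: "F (Inl s) = act_A (\<pi> s)" "F (Inr (i, h)) = act_B i (K i #> h)" for s i h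
    by (simp_all add: F_def)
  have YX: "?Y \<subseteq> ?X" using core(2) by (auto simp: rel_gens_def)
  have Yval: "gen_val ` ?Y \<subseteq> \<Gamma>" using S_\<Gamma> core(3) by (force simp: rel_gens_def)
  have FY: "F x = act_A (\<pi> (gen_val x))" if "x \<in> ?Y" for x
  proof (cases x rule: gen_cases)
    case (2 i h)
    then have "i \<in> \<Lambda>" "h \<in> core i" using that by auto
    then show ?thesis using 2 j_core[of i h] act_B_j[of i "\<pi> h"] by (simp add: F_simps)
  qed (simp add: F_simps)
  have FX: "F ` ?X \<subseteq> carrier L"
  proof
    fix y assume "y \<in> F ` ?X"
    then obtain x where x: "x \<in> ?X" "y = F x" by auto
    show "y \<in> carrier L"
    proof (cases x rule: gen_cases)
      case (1 s)
      then have "s \<in> \<Gamma>" using x S_\<Gamma> by auto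
      then show ?thesis using x 1 group_hom.hom_closed[OF act_A_\<pi>_hom, of s] by (simp add: F_simps)
    next
      case (2 i h)
      then show ?thesis using x group_hom.hom_closed[OF act_B_coset_hom, of i h] by (simp add: F_simps)
    qed
  qed
  have valY: "word_val L F w = act_A (\<pi> (word_val G gen_val w))" if w: "w \<in> words ?Y" for w
    using word_val_hom[OF act_A_\<pi>_hom _ FY w] word_val_subgroup[OF \<Gamma> w Yval] Yval by simp
  note triv = relator_trivial(2)[OF pres]
  have rel: "word_val L F r = \<one>\<^bsub>L\<^esub>" if r: "r \<in> R \<union> peripheral_relators G \<Lambda> H" for r
  proof (cases "r \<in> R")
    case True
    then show ?thesis using valY[of r] R triv[OF r] \<pi>_one act_A_one by (auto simp: permutation_group_def)
  next
    case False
    then obtain i where i: "i \<in> \<Lambda>" "r \<in> words (Inr ` ({i} \<times> H i))"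
      using r by (auto simp: peripheral_relators_def)
    have v: "gen_val ` Inr ` ({i} \<times> H i) \<subseteq> H i" by auto
    interpret gh: group_hom "G\<lparr>carrier := H i\<rparr>" L "\<lambda>h. act_B i (K i #> h)" by (rule act_B_coset_hom[OF i(1)])
    have "word_val L F r = act_B i (K i #> word_val (G\<lparr>carrier := H i\<rparr>) gen_val r)"
      by (rule word_val_hom[OF gh.group_hom_axioms _ _ i(2)]) (use v in \<open>auto simp: F_simps\<close>)
    also have "word_val (G\<lparr>carrier := H i\<rparr>) gen_val r = \<one>"
      using word_val_subgroup[OF H[OF i(1)] i(2) v] triv[OF r] by simp
    also have "act_B i (K i #> \<one>) = \<one>\<^bsub>L\<^esub>" using gh.hom_one by simp
    finally show ?thesis .
  qed
  obtain \<theta> where \<theta>: "\<theta> \<in> hom G L" "\<And>x. x \<in> ?X \<Longrightarrow> \<theta> (gen_val x) = F x"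
    using presentation_universal[OF pres group_permutation_group FX rel] by blast
  have gh: "group_hom G L \<theta>"
    using \<theta>(1) group_permutation_group by (simp add: group_hom_def group_hom_axioms_def)
  have "\<theta> g = act_A (\<pi> g)" if "g \<in> \<Gamma>" for g
  proof -
    have "S \<union> (\<Union>i\<in>\<Lambda>. A i) \<subseteq> gen_val ` ?Y"
    proof
      fix x assume "x \<in> S \<union> (\<Union>i\<in>\<Lambda>. A i)"
      then consider "x \<in> S" | i where "i \<in> \<Lambda>" "x \<in> A i" by auto
      then show "x \<in> gen_val ` ?Y"
      proof cases
        case 1
        then show ?thesis by (intro image_eqI[of _ _ "Inl x"]) auto
      next
        case 2
        then show ?thesis by (intro image_eqI[of _ _ "Inr (i, x)"]) (auto simp: core_def intro: generate.incl)
      qed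
    qed
    then have "g \<in> generate G (gen_val ` ?Y)" using that mono_generate unfolding \<Gamma>_def by blast
    moreover have "gen_val ` ?Y \<subseteq> carrier G" using Yval \<Gamma>_carrier by blast
    ultimately obtain w where w: "w \<in> words ?Y" "g = word_val G gen_val w"
      using generate_word_val by blast
    have wX: "w \<in> words ?X" using w(1) YX by (auto simp: words_iff)
    have "\<theta> g = word_val L F w" unfolding w(2)
      by (rule word_val_hom[OF gh gens _ wX, symmetric]) (simp add: \<theta>(2))
    then show ?thesis using valY[OF w(1)] w(2) by simp
  qed
  moreover have "\<theta> h = act_B i (K i #> h)" if "i \<in> \<Lambda>" "h \<in> H i" for i h
    using \<theta>(2)[of "Inr (i, h)"] that by (simp add: F_simps)
  ultimately show ?thesis using \<theta>(1) by blast
qed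

definition \<theta> :: "'a \<Rightarrow> 'q \<times> ('q \<times> 'l \<times> 'a set) list \<Rightarrow> 'q \<times> ('q \<times> 'l \<times> 'a set) list" where
  "\<theta> = (SOME \<theta>. \<theta> \<in> hom G L \<and> (\<forall>g\<in>\<Gamma>. \<theta> g = act_A (\<pi> g)) \<and> (\<forall>i\<in>\<Lambda>. \<forall>h\<in>H i. \<theta> h = act_B i (K i #> h)))"

lemma \<theta>: "\<theta> \<in> hom G L" "g \<in> \<Gamma> \<Longrightarrow> \<theta> g = act_A (\<pi> g)"
    "i \<in> \<Lambda> \<Longrightarrow> h \<in> H i \<Longrightarrow> \<theta> h = act_B i (K i #> h)"
proof -
  have "\<theta> \<in> hom G L \<and> (\<forall>g\<in>\<Gamma>. \<theta> g = act_A (\<pi> g)) \<and> (\<forall>i\<in>\<Lambda>. \<forall>h\<in>H i. \<theta> h = act_B i (K i #> h))"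
    unfolding \<theta>_def by (rule someI_ex[OF exists_action])
  then show "\<theta> \<in> hom G L" "g \<in> \<Gamma> \<Longrightarrow> \<theta> g = act_A (\<pi> g)"
    "i \<in> \<Lambda> \<Longrightarrow> h \<in> H i \<Longrightarrow> \<theta> h = act_B i (K i #> h)" by auto
qed

sublocale \<theta>: group_hom G L \<theta>
  using \<theta>(1) group_permutation_group group_axioms by (simp add: group_hom_def group_hom_axioms_def)

text \<open>The kernel of the action is normal and contains every \<open>K i\<close>.\<close>
lemma \<theta>_N: "g \<in> N \<Longrightarrow> \<theta> g = \<one>\<^bsub>L\<^esub>"
proof -
  have "K i \<subseteq> kernel G L \<theta>" if i: "i \<in> \<Lambda>" for i
  proof
    fix k assume k: "k \<in> K i"
    interpret gh: group_hom "G\<lparr>carrier := H i\<rparr>" L "\<lambda>h. act_B i (K i #> h)" by (rule act_B_coset_hom[OF i])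
    have kH: "k \<in> H i" using k K_sub[OF i] by blast
    have "K i #> k = K i #> \<one>"
      using rcos_eq_iff[OF K_subgroup[OF i], of k \<one>] k kH H_carrier[OF i] by auto
    then have "\<theta> k = \<one>\<^bsub>L\<^esub>" using \<theta>(3)[OF i kH] gh.hom_one by simp
    then show "k \<in> kernel G L \<theta>" using kH H_carrier[OF i] by (auto simp: kernel_def)
  qed
  from N(3)[OF \<theta>.normal_kernel this] show "g \<in> N \<Longrightarrow> \<theta> g = \<one>\<^bsub>L\<^esub>" by (auto simp: kernel_def)
qed

lemma N_subgroup: "subgroup N G" by (rule normal_imp_subgroup[OF N(1)])

lemma \<theta>_coset:
  assumes "g \<in> carrier G" "h \<in> carrier G" "N #> g = N #> h"
  shows "\<theta> g = \<theta> h"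
proof -
  have "g \<otimes> inv h \<in> N" using rcos_eq_iff[OF N_subgroup assms(1,2)] assms(3) by simp
  then have e: "\<theta> (g \<otimes> inv h) = \<one>\<^bsub>L\<^esub>" by (rule \<theta>_N)
  have "\<theta> g = \<theta> ((g \<otimes> inv h) \<otimes> h)" using assms by (simp add: m_assoc)
  also have "\<dots> = \<theta> (g \<otimes> inv h) \<otimes>\<^bsub>L\<^esub> \<theta> h" using assms by (intro \<theta>.hom_mult) auto
  finally show ?thesis using e assms by simp
qed

lemma natural_map_B: "i \<in> \<Lambda> \<Longrightarrow> h \<in> H i \<Longrightarrow> natural_map G N (K i #> h) = N #> h"
  using natural_map_coset[OF group_axioms N(1) N(2) K_subgroup] H_carrier by blast

theorem natural_map_inj:
  assumes i: "i \<in> \<Lambda>"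
  shows "inj_on (natural_map G N) (carrier (B i))"
proof (rule inj_onI)
  fix x y assume "x \<in> carrier (B i)" "y \<in> carrier (B i)" and eq: "natural_map G N x = natural_map G N y"
  then obtain g h where gh: "g \<in> H i" "x = K i #> g" "h \<in> H i" "y = K i #> h" by (auto simp: carrier_B)
  then have "N #> g = N #> h" using eq natural_map_B[OF i] by simp
  then have "act_B i x = act_B i y" using \<theta>_coset[of g h] gh \<theta>(3)[OF i] H_carrier[OF i] by auto
  then show "x = y" using act_B_inj[OF i] gh by (auto dest!: inj_onD simp: carrier_B)
qed

abbreviation "Q \<equiv> G Mod N"
abbreviation "PQ i \<equiv> natural_map G N ` carrier (B i)"

lemma PQ: "i \<in> \<Lambda> \<Longrightarrow> PQ i = (\<lambda>h. N #> h) ` H i"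
  using natural_map_B by (auto simp: carrier_B image_iff)

sublocale q: group_hom G Q "\<lambda>g. N #> g"
  using normal.factorgroup_is_group[OF N(1)] normal.r_coset_hom_Mod[OF N(1)] group_axioms
  by (simp add: group_hom_def group_hom_axioms_def)

lemma carrier_Q: "carrier Q = (\<lambda>g. N #> g) ` carrier G"
  by (auto simp: FactGroup_def RCOSETS_def)

text \<open>The homomorphism from \<open>Q0\<close> to \<open>G / N\<close> induced by the inclusion of \<open>\<Gamma>\<close>.\<close>
definition \<psi> :: "'q \<Rightarrow> 'a set" where
  "\<psi> x = N #> (SOME g. g \<in> \<Gamma> \<and> \<pi> g = x)"

lemma \<psi>_\<pi>: 
  assumes g: "g \<in> \<Gamma>"
  shows "\<psi> (\<pi> g) = N #> g"
proof -
  let ?h = "SOME h. h \<in> \<Gamma> \<and> \<pi> h = \<pi> g"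
  have h: "?h \<in> \<Gamma> \<and> \<pi> ?h = \<pi> g" by (rule someI[of _ g]) (use g in simp)
  then have "\<pi> (?h \<otimes> inv g) = \<one>\<^bsub>Q0\<^esub>" using \<pi>_eq[of ?h g] g by blast
  then have "?h \<otimes> inv g \<in> N" using ker_N[of "?h \<otimes> inv g"] h g subgroup.m_closed[OF \<Gamma>] subgroup.m_inv_closed[OF \<Gamma>] by blast
  then show ?thesis unfolding \<psi>_def using rcos_eq_iff[OF N_subgroup, of ?h g] h g \<Gamma>_carrier by blast
qed

sublocale \<psi>: group_hom Q0 Q \<psi>
proof -
  have "\<psi> \<in> hom Q0 Q"
  proof (rule homI)
    fix x assume "x \<in> carrier Q0"
    then obtain g where g: "g \<in> \<Gamma>" "x = \<pi> g" using \<pi>_onto by blast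
    then have gc: "g \<in> carrier G" using \<Gamma>_carrier by blast
    then show "\<psi> x \<in> carrier Q" using \<psi>_\<pi> g q.hom_closed by simp
    fix y assume "y \<in> carrier Q0"
    then obtain h where h: "h \<in> \<Gamma>" "y = \<pi> h" using \<pi>_onto by blast
    then have hc: "h \<in> carrier G" using \<Gamma>_carrier by blast
    have "\<psi> (x \<otimes>\<^bsub>Q0\<^esub> y) = \<psi> (\<pi> (g \<otimes> h))" using \<pi>_mult g h by simp
    also have "\<dots> = N #> (g \<otimes> h)" by (rule \<psi>_\<pi>) (use g h subgroup.m_closed[OF \<Gamma>] in blast)
    finally show "\<psi> (x \<otimes>\<^bsub>Q0\<^esub> y) = \<psi> x \<otimes>\<^bsub>Q\<^esub> \<psi> y" using \<psi>_\<pi> g h q.hom_mult[OF gc hc] by simp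
  qed
  then show "group_hom Q0 Q \<psi>" using Q0 q.is_group by (simp add: group_hom_def group_hom_axioms_def)
qed

lemma \<psi>_inj: "inj_on \<psi> (carrier Q0)"
proof (rule inj_onI)
  fix x y assume xy: "x \<in> carrier Q0" "y \<in> carrier Q0" "\<psi> x = \<psi> y"
  then obtain g h where gh: "g \<in> \<Gamma>" "x = \<pi> g" "h \<in> \<Gamma>" "y = \<pi> h" using \<pi>_onto by blast
  then have "N #> g = N #> h" using xy \<psi>_\<pi> by simp
  then have "act_A x = act_A y" using \<theta>_coset[of g h] gh \<theta>(2) \<Gamma>_carrier by auto
  then show "x = y" using act_A_inj xy by (auto dest: inj_onD)
qed

text \<open>The induced action of \<open>G / N\<close>.\<close>
definition \<Theta>Q :: "'a set \<Rightarrow> 'q \<times> ('q \<times> 'l \<times> 'a set) list \<Rightarrow> 'q \<times> ('q \<times> 'l \<times> 'a set) list" where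
  "\<Theta>Q x = \<theta> (SOME g. g \<in> carrier G \<and> N #> g = x)"

lemma \<Theta>Q_coset: "g \<in> carrier G \<Longrightarrow> \<Theta>Q (N #> g) = \<theta> g"
proof -
  assume g: "g \<in> carrier G"
  let ?h = "SOME h. h \<in> carrier G \<and> N #> h = N #> g"
  have "?h \<in> carrier G \<and> N #> ?h = N #> g" by (rule someI[of _ g]) (use g in simp)
  then show ?thesis unfolding \<Theta>Q_def using \<theta>_coset[of ?h g] g by blast
qed

lemma \<Theta>Q_mult: "x \<in> carrier Q \<Longrightarrow> y \<in> carrier Q \<Longrightarrow> \<Theta>Q (x \<otimes>\<^bsub>Q\<^esub> y) = \<Theta>Q x \<circ> \<Theta>Q y"
proof -
  assume "x \<in> carrier Q" "y \<in> carrier Q"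
  then obtain g h where gh: "g \<in> carrier G" "x = N #> g" "h \<in> carrier G" "y = N #> h" by (auto simp: carrier_Q)
  then have "\<Theta>Q (x \<otimes>\<^bsub>Q\<^esub> y) = \<theta> (g \<otimes> h)" using q.hom_mult[of g h] \<Theta>Q_coset[of "g \<otimes> h"] by simp
  then show ?thesis using gh \<Theta>Q_coset \<theta>.hom_mult[of g h] by (simp add: permutation_group_def)
qed

lemma \<Theta>Q_one: "\<Theta>Q \<one>\<^bsub>Q\<^esub> = id"
  using \<Theta>Q_coset[of \<one>] q.hom_one \<theta>.hom_one by (simp add: permutation_group_def)

lemma \<Theta>Q_\<psi>: "x \<in> carrier Q0 \<Longrightarrow> \<Theta>Q (\<psi> x) = act_A x"
proof -
  assume "x \<in> carrier Q0"
  then obtain g where g: "g \<in> \<Gamma>" "x = \<pi> g" using \<pi>_onto by blast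
  then show ?thesis using \<psi>_\<pi> \<Theta>Q_coset[of g] \<theta>(2) \<Gamma>_carrier by auto
qed

lemma \<Theta>Q_B: "i \<in> \<Lambda> \<Longrightarrow> x \<in> carrier (B i) \<Longrightarrow> \<Theta>Q (natural_map G N x) = act_B i x"
proof -
  assume i: "i \<in> \<Lambda>" and "x \<in> carrier (B i)"
  then obtain h where h: "h \<in> H i" "x = K i #> h" by (auto simp: carrier_B)
  then show ?thesis using natural_map_B[OF i] \<Theta>Q_coset[of h] \<theta>(3)[OF i] H_carrier[OF i] by auto
qed

lemma natural_map_j: "i \<in> \<Lambda> \<Longrightarrow> c \<in> C i \<Longrightarrow> natural_map G N (j i c) = \<psi> c"
proof -
  assume i: "i \<in> \<Lambda>" and "c \<in> C i"
  then obtain h where h: "h \<in> core i" "c = \<pi> h" by auto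
  then have "h \<in> H i" "h \<in> \<Gamma>" using core(2,3)[OF i] by auto
  then show "natural_map G N (j i c) = \<psi> c"
    unfolding h(2) j_core[OF i h(1)] by (simp add: natural_map_B[OF i] \<psi>_\<pi>)
qed

end

section \<open>The isoperimetric inequality in the quotient\<close>

(* G / N is treated as an abstract group: its unit should not be rewritten to N. *)
declare one_FactGroup [simp del] mult_FactGroup [simp del]

context relative_filling
begin

lemma PQ_subgroup: "i \<in> \<Lambda> \<Longrightarrow> subgroup (PQ i) Q"
  unfolding PQ by (rule q.subgroup_img_is_subgroup[OF H])

lemma PQ_carrier: "i \<in> \<Lambda> \<Longrightarrow> PQ i \<subseteq> carrier Q"
  by (rule subgroup.subset[OF PQ_subgroup])

text \<open>A letter of \<open>G / N\<close>, with its sign evaluated, read as a letter of the amalgam.\<close>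
definition amalgam_letter :: "('a set, 'l) gen letter \<Rightarrow> 'q + 'l \<times> 'a set" where
  "amalgam_letter l = (case fst l of
     Inl s \<Rightarrow> Inl (inv_into (carrier Q0) \<psi> (letter_val Q gen_val l))
   | Inr (i, x) \<Rightarrow> Inr (i, inv_into (carrier (B i)) (natural_map G N) (letter_val Q gen_val l)))"

lemma PQ_letter_val: "i \<in> \<Lambda> \<Longrightarrow> x \<in> PQ i \<Longrightarrow> letter_val Q gen_val (Inr (i, x), b) \<in> PQ i"
  using subgroup.m_inv_closed[OF PQ_subgroup] by (simp add: letter_val_def)

lemma amalgam_letter:
  assumes S2: "S2 \<subseteq> carrier Q0" and l: "fst l \<in> rel_gens (\<psi> ` S2) \<Lambda> PQ"
  shows "letter_ok (amalgam_letter l)" "act_letter (amalgam_letter l) = \<Theta>Q (letter_val Q gen_val l)"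
    "in_A (amalgam_letter l) \<Longrightarrow> A_val (amalgam_letter l) \<in> carrier Q0 \<and>
       \<psi> (A_val (amalgam_letter l)) = letter_val Q gen_val l"
proof -
  have "letter_ok (amalgam_letter l) \<and> act_letter (amalgam_letter l) = \<Theta>Q (letter_val Q gen_val l) \<and>
    (in_A (amalgam_letter l) \<longrightarrow> A_val (amalgam_letter l) \<in> carrier Q0 \<and>
       \<psi> (A_val (amalgam_letter l)) = letter_val Q gen_val l)"
  proof (cases l rule: letter_cases)
    case (1 s b)
    then obtain q where q: "q \<in> carrier Q0" "s = \<psi> q" using l S2 by auto
    have "letter_val Q gen_val l \<in> \<psi> ` carrier Q0"
    proof (cases b)
      case True
      then show ?thesis using 1 q by (simp add: letter_val_def)
    next
      case False
      then have e: "letter_val Q gen_val l = \<psi> (inv\<^bsub>Q0\<^esub> q)" using 1 q by (simp add: letter_val_def)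
      show ?thesis unfolding e by (rule imageI) (use q in simp)
    qed
    note v = inv_into_into[OF this] f_inv_into_f[OF this]
    then show ?thesis
      using 1 \<Theta>Q_\<psi>[OF v(1)] by (simp add: amalgam_letter_def letter_ok_def act_letter_def A_val_def)
  next
    case (2 i x b)
    then have i: "i \<in> \<Lambda>" and "x \<in> PQ i" using l by auto
    then have "letter_val Q gen_val l \<in> PQ i" using PQ_letter_val 2 by simp
    note v = inv_into_into[OF this] f_inv_into_f[OF this]
    let ?x = "inv_into (carrier (B i)) (natural_map G N) (letter_val Q gen_val l)"
    have a: "amalgam_letter l = Inr (i, ?x)" using 2 by (simp add: amalgam_letter_def)
    have "j_inv i ?x \<in> carrier Q0 \<and> \<psi> (j_inv i ?x) = letter_val Q gen_val l" if "?x \<in> D i"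
    proof -
      have c: "j_inv i ?x \<in> C i" "j i (j_inv i ?x) = ?x"
        using inv_into_into[OF that] f_inv_into_f[OF that] by auto
      have "\<psi> (j_inv i ?x) = natural_map G N (j i (j_inv i ?x))" by (rule natural_map_j[OF i c(1), symmetric])
      then show ?thesis using C_carrier[OF i c(1)] v(2) unfolding c(2) by simp
    qed
    then show ?thesis using a i v \<Theta>Q_B[OF i v(1)]
      by (simp add: letter_ok_def act_letter_def in_A_def A_val_def)
  qed
  then show "letter_ok (amalgam_letter l)" "act_letter (amalgam_letter l) = \<Theta>Q (letter_val Q gen_val l)"
    "in_A (amalgam_letter l) \<Longrightarrow> A_val (amalgam_letter l) \<in> carrier Q0 \<and>
       \<psi> (A_val (amalgam_letter l)) = letter_val Q gen_val l" by auto
qed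

lemma gens_Q: "S2 \<subseteq> carrier Q0 \<Longrightarrow> gen_val ` rel_gens (\<psi> ` S2) \<Lambda> PQ \<subseteq> carrier Q"
  by (rule gen_val_rel_gens) (use PQ_carrier in auto)

lemma act_word:
  assumes S2: "S2 \<subseteq> carrier Q0" and w: "w \<in> words (rel_gens (\<psi> ` S2) \<Lambda> PQ)"
  shows "foldr act_letter (map amalgam_letter w) = \<Theta>Q (word_val Q gen_val w)"
  using w
proof (induction w)
  case Nil
  then show ?case using \<Theta>Q_one by (simp add: id_def fun_eq_iff)
next
  case (Cons l w)
  then show ?case
    using amalgam_letter(2)[OF S2, of l] \<Theta>Q_mult[of "letter_val Q gen_val l" "word_val Q gen_val w"]
      q.H.letter_val_closed[OF gens_Q[OF S2], of l] q.H.word_val_closed[OF gens_Q[OF S2], of w]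
    by (simp add: word_val_Cons)
qed

abbreviation "\<kappa>' \<equiv> inv_into \<Lambda>0 \<kappa>"

lemma \<kappa>': "i \<in> \<Lambda>0 \<Longrightarrow> \<kappa>' (\<kappa> i) = i"
  using inv_into_f_f[OF \<kappa>] by simp

text \<open>If \<open>i\<close> is outside \<open>\<Lambda>0\<close>, then \<open>core i\<close> is trivial; this is why trivial letters have to be excluded.\<close>
lemma core_letter:
  assumes S2: "S2 \<subseteq> carrier Q0" and l: "fst l \<in> rel_gens (\<psi> ` S2) \<Lambda> PQ"
    and A: "in_A (amalgam_letter l)" and nt: "\<And>i. fst l \<noteq> Inr (i, \<one>\<^bsub>Q\<^esub>)"
  shows "\<exists>l0. fst l0 \<in> rel_gens S2 (\<kappa> ` \<Lambda>0) P \<and> l = map_letter \<psi> \<kappa>' l0"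
proof (cases l rule: letter_cases)
  case (1 s b)
  then obtain q where "q \<in> S2" "s = \<psi> q" using l by auto
  then show ?thesis using 1 by (intro exI[of _ "(Inl q, b)"]) simp
next
  case (2 i x b)
  have i: "i \<in> \<Lambda>" and x: "x \<in> PQ i" "x \<in> carrier Q" using l 2 PQ_carrier by auto
  define c where "c = A_val (amalgam_letter l)"
  have c: "c \<in> carrier Q0" "\<psi> c = letter_val Q gen_val l"
    using amalgam_letter(3)[OF S2 l A] by (auto simp: c_def)
  have cC: "c \<in> C i"
    using A 2 by (auto simp: c_def amalgam_letter_def in_A_def A_val_def intro: inv_into_into)
  interpret Ci: subgroup "C i" Q0 by (rule sub_C[OF i])
  define d where "d = (if b then c else inv\<^bsub>Q0\<^esub> c)"
  have d: "d \<in> C i" using cC by (simp add: d_def)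
  have xd: "x = \<psi> d" using c 2 x by (auto simp: d_def letter_val_def)
  have "i \<in> \<Lambda>0"
  proof (rule ccontr)
    assume "i \<notin> \<Lambda>0"
    then have "d = \<one>\<^bsub>Q0\<^esub>" using d core_trivial[OF i] \<pi>_one by auto
    then have "x = \<one>\<^bsub>Q\<^esub>" using xd \<psi>.hom_one by simp
    then show False using nt[of i] 2 by simp
  qed
  then show ?thesis using 2 xd d P \<kappa>' by (intro exI[of _ "(Inr (\<kappa> i, d), b)"]) auto
qed

lemma core_word:
  assumes S2: "S2 \<subseteq> carrier Q0" and u: "u \<in> words (rel_gens (\<psi> ` S2) \<Lambda> PQ)"
    and A: "\<forall>l\<in>set u. in_A (amalgam_letter l)" and nt: "\<And>l i. l \<in> set u \<Longrightarrow> fst l \<noteq> Inr (i, \<one>\<^bsub>Q\<^esub>)"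
  shows "\<exists>u0. u0 \<in> words (rel_gens S2 (\<kappa> ` \<Lambda>0) P) \<and> u = map (map_letter \<psi> \<kappa>') u0"
  using u A nt
proof (induction u)
  case Nil
  then show ?case by (intro exI[of _ "[]"]) simp
next
  case (Cons l u)
  obtain u0 where u0: "u0 \<in> words (rel_gens S2 (\<kappa> ` \<Lambda>0) P)" "u = map (map_letter \<psi> \<kappa>') u0"
    using Cons.IH Cons.prems by auto
  obtain l0 where "fst l0 \<in> rel_gens S2 (\<kappa> ` \<Lambda>0) P" "l = map_letter \<psi> \<kappa>' l0"
    using core_letter[OF S2, of l] Cons.prems by auto
  then show ?case using u0 by (intro exI[of _ "l0 # u0"]) simp
qed

lemma A_prod_val:
  assumes S2: "S2 \<subseteq> carrier Q0" and u: "u \<in> words (rel_gens (\<psi> ` S2) \<Lambda> PQ)"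
    and A: "\<forall>l\<in>set u. in_A (amalgam_letter l)"
  shows "A_prod (map amalgam_letter u) \<in> carrier Q0 \<and> \<psi> (A_prod (map amalgam_letter u)) = word_val Q gen_val u"
  using u A
proof (induction u)
  case Nil
  then show ?case using \<psi>.hom_one by (simp add: A_prod_def)
next
  case (Cons l u)
  then show ?case using amalgam_letter(3)[OF S2, of l] by (auto simp: A_prod_def word_val_Cons)
qed

text \<open>A word that is trivial in \<open>G / N\<close> fixes the base point of \<open>\<Omega>\<close>. After removal of trivial letters it is either
  a word of \<open>Q0\<close>, or two of its letters \<open>l1\<close> and \<open>l2\<close> can be merged with the word \<open>u\<close> of \<open>Q0\<close> between them
  into one letter \<open>h\<close>. The shorter word is filled by induction. To get back, two discs are inserted: a
  peripheral one of cost zero, which spells \<open>h\<close> as \<open>l1\<close>, \<open>c\<close>, \<open>l2\<close> with a peripheral word \<open>c\<close> for the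
  value of \<open>u\<close>, and one from \<open>Q0\<close> of cost at most \<open>C0 (|u| + 1)\<close>, which replaces \<open>c\<close> by \<open>u\<close>.\<close>
theorem quotient_relatively_hyperbolic: "relatively_hyperbolic Q \<Lambda> PQ"
proof -
  obtain S2 R2 and C0 :: real where r: "\<And>i. i \<in> \<kappa> ` \<Lambda>0 \<Longrightarrow> subgroup (P i) Q0"
    "finite S2" "S2 \<subseteq> carrier Q0" "finite R2" "R2 \<subseteq> free_product_elements Q0 S2 (\<kappa> ` \<Lambda>0) P" "0 \<le> C0"
    "is_presentation Q0 gen_val (rel_gens S2 (\<kappa> ` \<Lambda>0) P) (R2 \<union> peripheral_relators Q0 (\<kappa> ` \<Lambda>0) P)"
    "\<And>w. w \<in> words (rel_gens S2 (\<kappa> ` \<Lambda>0) P) \<Longrightarrow> word_val Q0 gen_val w = \<one>\<^bsub>Q0\<^esub> \<Longrightarrow>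
      \<exists>k. fills (rel_gens S2 (\<kappa> ` \<Lambda>0) P) (rel_label Q0 (\<kappa> ` \<Lambda>0) P R2) k w \<and> real k \<le> C0 * real (length w)"
    using relatively_hyperbolicD[OF rh] by metis
  let ?Z = "rel_gens S2 (\<kappa> ` \<Lambda>0) P" and ?X = "rel_gens (\<psi> ` S2) \<Lambda> PQ"
  let ?m = "map (map_letter \<psi> \<kappa>')"
  let ?V = "rel_label Q0 (\<kappa> ` \<Lambda>0) P R2" and ?U = "rel_label Q \<Lambda> PQ (?m ` R2)"
  have Pc: "P k \<subseteq> carrier Q0" if "k \<in> \<kappa> ` \<Lambda>0" for k using r(1)[OF that] by (rule subgroup.subset)
  have X0: "gen_val ` ?Z \<subseteq> carrier Q0" by (rule gen_val_rel_gens[OF r(3) Pc])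
  have X: "gen_val ` ?X \<subseteq> carrier Q" by (rule gens_Q[OF r(3)])
  have \<psi>C: "\<psi> ` C i \<subseteq> PQ i" if i: "i \<in> \<Lambda>" for i
  proof
    fix y assume "y \<in> \<psi> ` C i"
    then obtain h where "h \<in> core i" "y = \<psi> (\<pi> h)" by auto
    then show "y \<in> PQ i" using \<psi>_\<pi>[of h] core(2,3)[OF i] PQ[OF i] by auto
  qed
  have m: "\<psi> ` S2 \<subseteq> \<psi> ` S2" "\<kappa>' ` (\<kappa> ` \<Lambda>0) \<subseteq> \<Lambda>" "\<forall>k\<in>\<kappa> ` \<Lambda>0. \<psi> ` P k \<subseteq> PQ (\<kappa>' k)"
  proof -
    show "\<kappa>' ` (\<kappa> ` \<Lambda>0) \<subseteq> \<Lambda>" using \<kappa>' \<Lambda>0 by auto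
    show "\<forall>k\<in>\<kappa> ` \<Lambda>0. \<psi> ` P k \<subseteq> PQ (\<kappa>' k)"
    proof
      fix k assume "k \<in> \<kappa> ` \<Lambda>0"
      then obtain i where i: "i \<in> \<Lambda>0" "k = \<kappa> i" by auto
      then show "\<psi> ` P k \<subseteq> PQ (\<kappa>' k)" using \<psi>C[of i] P[OF i(1)] \<kappa>'[OF i(1)] \<Lambda>0 by auto
    qed
  qed simp
  have \<kappa>'_inj: "inj_on \<kappa>' (\<kappa> ` \<Lambda>0)" by (rule inj_on_inv_into) simp
  have words_m: "?m w \<in> words ?X" if "w \<in> words ?Z" for w
    using that map_letter_in[OF m] by (auto simp: words_iff)
  have val_m: "word_val Q gen_val (?m w) = \<psi> (word_val Q0 gen_val w)" if "w \<in> words ?Z" for w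
    by (rule word_val_map_letter[OF \<psi>.group_hom_axioms X0 that])
  have fills_m: "fills ?X ?U k (?m w)" if "fills ?Z ?V k w" for k w
    by (rule fills_hom[OF \<psi>.group_hom_axioms r(3) Pc m that])
  have R2: "w \<in> words ?Z" "word_val Q0 gen_val w = \<one>\<^bsub>Q0\<^esub>" if "w \<in> R2" for w
    using relator_trivial[OF r(7)] that by auto
  have fill0: "\<exists>k. fills ?X ?U k (?m w) \<and> real k \<le> C0 * real (length w)"
    if w: "w \<in> words ?Z" "word_val Q gen_val (?m w) = \<one>\<^bsub>Q\<^esub>" for w
  proof -
    have "\<psi> (word_val Q0 gen_val w) = \<psi> \<one>\<^bsub>Q0\<^esub>" using val_m[OF w(1)] w(2) \<psi>.hom_one by simp
    then have "word_val Q0 gen_val w = \<one>\<^bsub>Q0\<^esub>"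
      by (rule inj_onD[OF \<psi>_inj _ Q0.word_val_closed[OF X0 w(1)] Q0.one_closed])
    then obtain k where k: "fills ?Z ?V k w" "real k \<le> C0 * real (length w)" using r(8)[OF w(1)] by blast
    then show ?thesis using fills_m[OF k(1)] by blast
  qed
  have rot: "rotation_closed ?U" by (rule rotation_closed_face_label)
  have per: "?U t 0" if "i \<in> \<Lambda>" "\<forall>l\<in>set t. \<exists>x\<in>PQ i. fst l = Inr (i, x)" "word_val Q gen_val t = \<one>\<^bsub>Q\<^esub>" for i t
  proof -
    have "t \<in> peripheral_relators Q \<Lambda> PQ" unfolding peripheral_relators_iff using that by blast
    then show ?thesis using cyclic_relatorI by (auto simp: face_label_def)
  qed
  have per_words: "t \<in> words ?X" if pw: "i \<in> \<Lambda>" "\<forall>l\<in>set t. \<exists>x\<in>PQ i. fst l = Inr (i, x)" for i t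
  proof -
    have "fst l \<in> ?X" if l: "l \<in> set t" for l using pw(1) bspec[OF pw(2) l] by auto
    then show ?thesis by (auto simp: words_iff)
  qed
  have per_fill: "fills ?X ?U 0 t" if t: "i \<in> \<Lambda>" "\<forall>l\<in>set t. \<exists>x\<in>PQ i. fst l = Inr (i, x)" "word_val Q gen_val t = \<one>\<^bsub>Q\<^esub>" for i t
  proof (rule fills_relator[OF _ rot per_words[OF t(1,2)]])
    show "?U (inv_word t) 0"
    proof (rule per[OF t(1)], rule ballI)
      fix l assume "l \<in> set (inv_word t)"
      then have "fst l \<in> fst ` set t" using fst_set_inv_word[of t] by blast
      then obtain l' where l': "l' \<in> set t" "fst l = fst l'" by (rule imageE)
      show "\<exists>x\<in>PQ i. fst l = Inr (i, x)" unfolding l'(2) by (rule bspec[OF t(2) l'(1)])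
    next
      show "word_val Q gen_val (inv_word t) = \<one>\<^bsub>Q\<^esub>"
        unfolding q.H.word_val_inv_word[OF X per_words[OF t(1,2)]] t(3) by (rule q.H.inv_one)
    qed
  qed
  have main: "\<exists>k. fills ?X ?U k w \<and> real k \<le> C0 * real (length w)"
    if "w \<in> words ?X" "word_val Q gen_val w = \<one>\<^bsub>Q\<^esub>" for w
    using that
  proof (induction "length w" arbitrary: w rule: less_induct)
    case less
    note wX = less.prems(1) and w1 = less.prems(2)
    show ?case
    proof (cases "\<exists>l\<in>set w. \<exists>i. fst l = Inr (i, \<one>\<^bsub>Q\<^esub>)")
      case True
      then obtain l i where l: "l \<in> set w" "fst l = Inr (i, \<one>\<^bsub>Q\<^esub>)" by blast
      obtain x y where xy: "w = x @ l # y" using split_list[OF l(1)] by blast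
      have i: "i \<in> \<Lambda>" "\<one>\<^bsub>Q\<^esub> \<in> PQ i" using l(2) xy wX by auto
      have lv: "letter_val Q gen_val l = \<one>\<^bsub>Q\<^esub>" using l(2) by (simp add: letter_val_def)
      have w': "x \<in> words ?X" "y \<in> words ?X" "l # y \<in> words ?X" using wX xy by auto
      have "word_val Q gen_val (x @ y) = word_val Q gen_val w"
        using q.H.word_val_append[OF X w'(1,2)] q.H.word_val_append[OF X w'(1,3)] xy lv
          q.H.word_val_closed[OF X w'(2)] by (simp add: word_val_Cons)
      then obtain k where k: "fills ?X ?U k (x @ y)" "real k \<le> C0 * real (length (x @ y))"
        using less.hyps[of "x @ y"] xy w' w1 by auto
      have "fills ?X ?U 0 [l]"
        by (rule per_fill[OF i(1)]) (use l(2) i(2) lv in \<open>auto simp: word_val_Cons\<close>)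
      from fills_insert[OF k(1) this] have "fills ?X ?U k w" using xy by simp
      moreover have "C0 * real (length (x @ y)) \<le> C0 * real (length w)" using xy r(6) by (intro mult_left_mono) auto
      ultimately show ?thesis using k(2) by (intro exI[of _ k]) linarith
    next
      case False
      then have nt: "\<And>l i. l \<in> set w \<Longrightarrow> fst l \<noteq> Inr (i, \<one>\<^bsub>Q\<^esub>)" by blast
      have ok: "letter_ok l" if l: "l \<in> set (map amalgam_letter w)" for l
      proof -
        obtain l' where l': "l' \<in> set w" "l = amalgam_letter l'" using l by auto
        have "fst l' \<in> ?X" using l'(1) wX by (auto simp: words_iff)
        from amalgam_letter(1)[OF r(3) this] show ?thesis using l'(2) by simp
      qed
      have "foldr act_letter (map amalgam_letter w) (\<one>\<^bsub>Q0\<^esub>, []) = (\<one>\<^bsub>Q0\<^esub>, [])"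
        unfolding act_word[OF r(3) wX] w1 \<Theta>Q_one by simp
      from fixed_word_reducible[OF ok this] show ?thesis
      proof
        assume "\<forall>l\<in>set (map amalgam_letter w). in_A l"
        then have "\<forall>l\<in>set w. in_A (amalgam_letter l)" by simp
        from core_word[OF r(3) wX this nt] obtain w0 where w0: "w0 \<in> words ?Z" "w = ?m w0" by blast
        then show ?thesis using fill0[OF w0(1)] w1 by simp
      next
        assume "reducible (map amalgam_letter w)"
        then obtain x' i b1 u' b2 y' where d: "map amalgam_letter w = x' @ Inr (i, b1) # u' @ Inr (i, b2) # y'"
          "\<forall>l\<in>set u'. in_A l" "A_prod u' \<in> C i" unfolding reducible_def by blast
        from d(1) obtain x r' where r': "w = x @ r'" "map amalgam_letter r' = Inr (i, b1) # u' @ Inr (i, b2) # y'"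
          by (auto simp: map_eq_append_conv)
        from r'(2) obtain l1 r'' where r'': "r' = l1 # r''" "amalgam_letter l1 = Inr (i, b1)"
          "map amalgam_letter r'' = u' @ Inr (i, b2) # y'"
          by (cases r') simp_all
        from r''(3) obtain u s where us: "r'' = u @ s" "u' = map amalgam_letter u" "map amalgam_letter s = Inr (i, b2) # y'"
          by (auto simp: map_eq_append_conv)
        from us(3) obtain l2 y where "s = l2 # y" "amalgam_letter l2 = Inr (i, b2)"
          by (cases s) simp_all
        with r' r'' us have w: "w = x @ l1 # u @ l2 # y" "amalgam_letter l1 = Inr (i, b1)"
          "amalgam_letter l2 = Inr (i, b2)" "u' = map amalgam_letter u" by auto
        have ws: "x \<in> words ?X" "fst l1 \<in> ?X" "u \<in> words ?X" "fst l2 \<in> ?X" "y \<in> words ?X" using wX w(1) by auto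
        have "\<exists>x1\<in>PQ i. fst l1 = Inr (i, x1) \<and> i \<in> \<Lambda>"
          using w(2) ws(2) by (cases l1 rule: letter_cases) (auto simp: amalgam_letter_def)
        then obtain x1 where l1: "x1 \<in> PQ i" "fst l1 = Inr (i, x1)" and i: "i \<in> \<Lambda>" by blast
        have "\<exists>x2\<in>PQ i. fst l2 = Inr (i, x2)"
          using w(3) ws(4) by (cases l2 rule: letter_cases) (auto simp: amalgam_letter_def)
        then obtain x2 where l2: "x2 \<in> PQ i" "fst l2 = Inr (i, x2)" by blast
        have uA: "\<forall>l\<in>set u. in_A (amalgam_letter l)" using d(2) w(4) by simp
        have uval: "word_val Q gen_val u \<in> carrier Q" by (rule q.H.word_val_closed[OF X ws(3)])
        obtain u0 where u0: "u0 \<in> words ?Z" "u = ?m u0" using core_word[OF r(3) ws(3) uA nt] w(1) by auto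
        define q where "q = word_val Q0 gen_val u0"
        have q: "q \<in> carrier Q0" unfolding q_def by (rule Q0.word_val_closed[OF X0 u0(1)])
        have \<psi>q: "\<psi> q = word_val Q gen_val u" using val_m[OF u0(1)] u0(2) by (simp add: q_def)
        have qC: "q \<in> C i"
        proof -
          have "A_prod u' \<in> carrier Q0" "\<psi> (A_prod u') = \<psi> q"
            using A_prod_val[OF r(3) ws(3) uA] w(4) \<psi>q by auto
          then have "A_prod u' = q" using \<psi>_inj q by (auto dest: inj_onD)
          then show ?thesis using d(3) by simp
        qed
        \<comment> \<open>The value of \<open>u\<close> as a peripheral word: one letter, or the empty word if \<open>core i\<close> is trivial.\<close>
        have "\<exists>c k. (\<forall>l\<in>set c. \<exists>x\<in>PQ i. fst l = Inr (i, x)) \<and> word_val Q gen_val c = word_val Q gen_val u \<and>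
            fills ?X ?U k (u @ inv_word c) \<and> real k \<le> C0 * (real (length u) + 1)"
        proof (cases "i \<in> \<Lambda>0")
          case True
          let ?l = "(Inr (i, \<psi> q), True)" and ?lz = "(Inr (\<kappa> i, q), True)"
          have l0: "[inv_letter ?lz] \<in> words ?Z" using True qC P[OF True] by simp
          have ml: "?m (u0 @ [inv_letter ?lz]) = u @ inv_word [?l]"
            using u0(2) \<kappa>'[OF True] by (simp add: map_letter_def inv_letter_def)
          have "word_val Q0 gen_val (u0 @ [inv_letter ?lz]) = \<one>\<^bsub>Q0\<^esub>"
            using Q0.word_val_append[OF X0 u0(1) l0] q by (simp add: q_def[symmetric] word_val_Cons letter_val_def inv_letter_def)
          then obtain k where k: "fills ?Z ?V k (u0 @ [inv_letter ?lz])" "real k \<le> C0 * real (length (u0 @ [inv_letter ?lz]))"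
            using r(8)[of "u0 @ [inv_letter ?lz]"] u0(1) l0 by auto
          have len: "real (length (u0 @ [inv_letter ?lz])) = real (length u) + 1" using u0(2) by simp
          have "\<psi> q \<in> PQ i" using \<psi>C[OF i] qC by blast
          then show ?thesis using fills_m[OF k(1)] k(2) \<psi>q uval unfolding ml len
            by (intro exI[of _ "[?l]"] exI[of _ k]) (auto simp: word_val_Cons letter_val_def)
        next
          case False
          then have q1: "q = \<one>\<^bsub>Q0\<^esub>" using qC core_trivial[OF i] \<pi>_one by auto
          then obtain k where k: "fills ?Z ?V k u0" "real k \<le> C0 * real (length u0)"
            using r(8)[OF u0(1)] by (auto simp: q_def)
          have len: "C0 * real (length u0) \<le> C0 * (real (length u) + 1)"
            using u0(2) r(6) by (intro mult_left_mono) auto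
          have "word_val Q gen_val u = \<one>\<^bsub>Q\<^esub>" using \<psi>q q1 \<psi>.hom_one by simp
          then show ?thesis using fills_m[OF k(1)] k(2) len u0(2)
            by (intro exI[of _ "[]"] exI[of _ k]) auto
        qed
        then obtain c k1 where c: "\<forall>l\<in>set c. \<exists>x\<in>PQ i. fst l = Inr (i, x)"
          "word_val Q gen_val c = word_val Q gen_val u" "fills ?X ?U k1 (u @ inv_word c)"
          "real k1 \<le> C0 * (real (length u) + 1)" by blast
        interpret PQi: subgroup "PQ i" Q by (rule PQ_subgroup[OF i])
        define v1 where "v1 = letter_val Q gen_val l1"
        define v2 where "v2 = letter_val Q gen_val l2"
        have v: "v1 \<in> PQ i" "v2 \<in> PQ i"
          using PQ_letter_val[OF i l1(1), of "snd l1"] PQ_letter_val[OF i l2(1), of "snd l2"] l1(2) l2(2)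
          by (auto simp: v1_def v2_def letter_val_def)
        have vu: "word_val Q gen_val u \<in> PQ i" using \<psi>C[OF i] qC \<psi>q by (metis imageI subsetD)
        define h where "h = v1 \<otimes>\<^bsub>Q\<^esub> (word_val Q gen_val u \<otimes>\<^bsub>Q\<^esub> v2)"
        have h: "h \<in> PQ i" unfolding h_def using v vu by (intro PQi.m_closed)
        let ?h = "(Inr (i, h), True)"
        have cs: "v1 \<in> carrier Q" "v2 \<in> carrier Q" "h \<in> carrier Q" using v h PQi.mem_carrier by auto
        have cw: "c \<in> words ?X" by (rule per_words[OF i c(1)])
        have hX: "fst ?h \<in> ?X" using h i by simp
        have yc: "word_val Q gen_val y \<in> carrier Q" by (rule q.H.word_val_closed[OF X ws(5)])
        have "word_val Q gen_val (x @ ?h # y) = word_val Q gen_val w"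
        proof -
          have 1: "word_val Q gen_val (u @ l2 # y) = word_val Q gen_val u \<otimes>\<^bsub>Q\<^esub> (v2 \<otimes>\<^bsub>Q\<^esub> word_val Q gen_val y)"
            using q.H.word_val_append[OF X ws(3), of "l2 # y"] ws by (simp add: word_val_Cons v2_def)
          have lh: "letter_val Q gen_val ?h = h" by (simp add: letter_val_def)
          have 2: "word_val Q gen_val (?h # y) = word_val Q gen_val (l1 # u @ l2 # y)"
          proof -
            have "word_val Q gen_val (?h # y) = h \<otimes>\<^bsub>Q\<^esub> word_val Q gen_val y" by (simp only: word_val_Cons lh)
            also have "\<dots> = v1 \<otimes>\<^bsub>Q\<^esub> (word_val Q gen_val u \<otimes>\<^bsub>Q\<^esub> (v2 \<otimes>\<^bsub>Q\<^esub> word_val Q gen_val y))"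
              unfolding h_def using cs(1,2) uval yc by (simp add: q.H.m_assoc)
            also have "\<dots> = word_val Q gen_val (l1 # u @ l2 # y)" by (simp only: word_val_Cons 1 v1_def)
            finally show ?thesis .
          qed
          show ?thesis using q.H.word_val_append[OF X ws(1), of "?h # y"] q.H.word_val_append[OF X ws(1), of "l1 # u @ l2 # y"]
            2 w(1) ws hX by simp
        qed
        then obtain k where k: "fills ?X ?U k (x @ ?h # y)" "real k \<le> C0 * real (length (x @ ?h # y))"
          using less.hyps[of "x @ ?h # y"] w(1) ws w1 hX by auto
        let ?\<rho> = "[l1] @ c @ [l2] @ [inv_letter ?h]"
        have \<rho>: "fills ?X ?U 0 ?\<rho>"
        proof (rule per_fill[OF i], rule ballI)
          fix l assume "l \<in> set ?\<rho>"
          then show "\<exists>x\<in>PQ i. fst l = Inr (i, x)" using l1 l2 h c(1) by auto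
        next
          have "word_val Q gen_val (c @ [l2, inv_letter ?h]) = word_val Q gen_val u \<otimes>\<^bsub>Q\<^esub> (v2 \<otimes>\<^bsub>Q\<^esub> inv\<^bsub>Q\<^esub> h)"
            using q.H.word_val_append[OF X cw, of "[l2, inv_letter ?h]"] ws(4) hX c(2) cs
            by (simp add: word_val_Cons v2_def[symmetric]) (simp add: letter_val_def inv_letter_def)
          then have "word_val Q gen_val ?\<rho> = v1 \<otimes>\<^bsub>Q\<^esub> (word_val Q gen_val u \<otimes>\<^bsub>Q\<^esub> (v2 \<otimes>\<^bsub>Q\<^esub> inv\<^bsub>Q\<^esub> h))"
            by (simp add: word_val_Cons v1_def[symmetric])
          also have "\<dots> = h \<otimes>\<^bsub>Q\<^esub> inv\<^bsub>Q\<^esub> h"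
          proof -
            have "v1 \<otimes>\<^bsub>Q\<^esub> (word_val Q gen_val u \<otimes>\<^bsub>Q\<^esub> (v2 \<otimes>\<^bsub>Q\<^esub> d)) =
                v1 \<otimes>\<^bsub>Q\<^esub> (word_val Q gen_val u \<otimes>\<^bsub>Q\<^esub> v2) \<otimes>\<^bsub>Q\<^esub> d" if "d \<in> carrier Q" for d
              using cs(1,2) uval that by (simp add: q.H.m_assoc)
            from this[OF q.H.inv_closed[OF cs(3)]] show ?thesis unfolding h_def[symmetric] .
          qed
          also have "\<dots> = \<one>\<^bsub>Q\<^esub>" using cs by simp
          finally show "word_val Q gen_val ?\<rho> = \<one>\<^bsub>Q\<^esub>" .
        qed
        have big: "?U [inv_letter ?h, ?h] 0"
          by (rule per[OF i]) (use h cs in \<open>auto simp: word_val_Cons letter_val_def inv_letter_def\<close>)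
        have "fills ?X ?U (k + 0) (x @ ?\<rho> @ ?h # y)" by (rule fills_insert[OF k(1) \<rho>])
        then have "fills ?X ?U k ((x @ [l1] @ c @ [l2]) @ [inv_letter ?h, ?h] @ y)" by simp
        from fills_close[OF rot this big] have "fills ?X ?U k ((x @ [l1]) @ (c @ [l2] @ y))" by simp
        from fills_insert[OF this c(3)]
        have "fills ?X ?U (k + k1) ((x @ [l1] @ u) @ (inv_word c @ c) @ ([l2] @ y))" by simp
        moreover have "?U (inv_word c @ c) 0"
        proof (rule per[OF i], rule ballI)
          fix l assume "l \<in> set (inv_word c @ c)"
          then have "fst l \<in> fst ` set (inv_word c) \<union> fst ` set c" by (auto simp del: fst_set_inv_word)
          then have "fst l \<in> fst ` set c" by simp
          then obtain l' where l': "l' \<in> set c" "fst l = fst l'" by (rule imageE)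
          show "\<exists>x\<in>PQ i. fst l = Inr (i, x)" unfolding l'(2) by (rule bspec[OF c(1) l'(1)])
        next
          show "word_val Q gen_val (inv_word c @ c) = \<one>\<^bsub>Q\<^esub>"
            using q.H.word_val_append[OF X _ cw, of "inv_word c"] q.H.word_val_inv_word[OF X cw] cw uval c(2) by simp
        qed
        ultimately have F: "fills ?X ?U (k + k1) w" using fills_close[OF rot, of ?X "k + k1" "x @ [l1] @ u" "inv_word c @ c" "[l2] @ y" 0] w(1) by simp
        have "real (k + k1) \<le> C0 * real (length (x @ ?h # y)) + C0 * (real (length u) + 1)" using k(2) c(4) by simp
        also have "\<dots> = C0 * real (length w)" using w(1) by (simp add: algebra_simps)
        finally show ?thesis using F by blast
      qed
    qed
  qed
  show ?thesis
  proof (rule relatively_hyperbolicI[of Q \<Lambda> PQ "\<psi> ` S2" "?m ` R2" C0])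
    show "group Q" by (rule q.is_group)
    show "subgroup (PQ i) Q" if "i \<in> \<Lambda>" for i by (rule PQ_subgroup[OF that])
    show "finite (\<psi> ` S2)" "\<psi> ` S2 \<subseteq> carrier Q" "finite (?m ` R2)" using r(2,3,4) by auto
    show "?m ` R2 \<subseteq> free_product_elements Q (\<psi> ` S2) \<Lambda> PQ"
      using free_product_elements_map[OF \<psi>.group_hom_axioms r(3) Pc m \<psi>_inj \<kappa>'_inj] r(5) by blast
    show "word_val Q gen_val v = \<one>\<^bsub>Q\<^esub>" if "v \<in> ?m ` R2" for v
      using that val_m R2 \<psi>.hom_one by auto
    show "carrier Q \<subseteq> word_val Q gen_val ` words ?X"
    proof
      let ?E = "word_val Q gen_val ` words ?X"
      have E: "?E = generate Q (gen_val ` ?X)" by (rule q.H.generate_word_val[OF X, symmetric])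
      have sub: "subgroup ?E Q" unfolding E by (rule q.H.generate_is_subgroup[OF X])
      have inS: "N #> s \<in> ?E" if "s \<in> S" for s
      proof -
        have s: "s \<in> \<Gamma>" using that S_\<Gamma> by blast
        have "\<pi> s \<in> carrier Q0" using s \<pi>_onto by blast
        then obtain w0 where w0: "w0 \<in> words ?Z" "\<pi> s = word_val Q0 gen_val w0"
          using r(7) unfolding is_presentation_def by (metis (no_types, lifting) imageE)
        then have "N #> s = word_val Q gen_val (?m w0)" using val_m[OF w0(1)] \<psi>_\<pi>[OF s] by simp
        then show ?thesis using words_m[OF w0(1)] by blast
      qed
      have inH: "N #> h \<in> ?E" if "i \<in> \<Lambda>" "h \<in> H i" for i h
      proof -
        have "N #> h \<in> PQ i" using that PQ by blast
        then have "Inr (i, N #> h) \<in> ?X" using that by simp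
        then have "gen_val (Inr (i, N #> h) :: ('a set, 'l) gen) \<in> gen_val ` ?X" by (rule imageI)
        then show ?thesis unfolding E by (simp add: generate.incl)
      qed
      have inX: "N #> gen_val x \<in> ?E" if "x \<in> rel_gens S \<Lambda> H" for x
        using that inS inH by (cases x rule: gen_cases) auto
      fix y assume "y \<in> carrier Q"
      then obtain g where g: "g \<in> carrier G" "y = N #> g" by (auto simp: carrier_Q)
      have "g \<in> word_val G gen_val ` words (rel_gens S \<Lambda> H)" using g pres by (simp add: is_presentation_def)
      then have "g \<in> generate G (gen_val ` rel_gens S \<Lambda> H)" using generate_word_val[OF gens] by simp
      then have "N #> g \<in> ?E"
      proof (induction rule: generate.induct)
        case one
        then show ?case using q.hom_one subgroup.one_closed[OF sub] by simp
      next
        case (incl h)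
        then show ?case using inX by auto
      next
        case (inv h)
        then have "N #> h \<in> ?E" "h \<in> carrier G" using inX gens by auto
        then show ?case using q.hom_inv[of h] subgroup.m_inv_closed[OF sub] by simp
      next
        case (eng h h')
        have "h \<in> carrier G" "h' \<in> carrier G" using eng.hyps generate_in_carrier[OF gens] by auto
        then show ?case using q.hom_mult[of h h'] subgroup.m_closed[OF sub eng.IH] by simp
      qed
      then show "y \<in> ?E" using g by simp
    qed
  qed (rule main)
qed

end

section \<open>Reduction to the finitely generated case\<close>
theorem proposition7:
  fixes G :: "'a monoid" and \<Lambda> :: "'l set" and H :: "'l \<Rightarrow> 'a set"
  assumes finite_case: "\<And>(G :: nat monoid) (\<Lambda> :: nat set) H.
      relatively_hyperbolic G \<Lambda> H \<Longrightarrow> finite \<Lambda> \<Longrightarrow>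
      (\<And>i. i \<in> \<Lambda> \<Longrightarrow> finitely_generated_subgroup G (H i)) \<Longrightarrow> filling_property G \<Lambda> H"
    and hyp: "relatively_hyperbolic G \<Lambda> H"
  shows "filling_property G \<Lambda> H"
proof -
  obtain S R and C :: real where G: "group G" and H: "\<And>i. i \<in> \<Lambda> \<Longrightarrow> subgroup (H i) G"
    and S: "finite S" "S \<subseteq> carrier G" and R: "finite R" "R \<subseteq> free_product_elements G S \<Lambda> H"
    and pres: "is_presentation G gen_val (rel_gens S \<Lambda> H) (R \<union> peripheral_relators G \<Lambda> H)"
    and fill: "\<And>w. w \<in> words (rel_gens S \<Lambda> H) \<Longrightarrow> word_val G gen_val w = \<one>\<^bsub>G\<^esub> \<Longrightarrow>
      \<exists>k. fills (rel_gens S \<Lambda> H) (rel_label G \<Lambda> H R) k w \<and> real k \<le> C * real (length w)"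
    using relatively_hyperbolicD[OF hyp] by metis
  interpret G: group G by (rule G)
  define A where "A i = {h. \<exists>r\<in>R. \<exists>b. (Inr (i, h), b) \<in> set r}" for i
  define \<Lambda>0 where "\<Lambda>0 = {i \<in> \<Lambda>. A i \<noteq> {}}"
  define core where "core i = generate G (A i)" for i
  define \<Gamma> where "\<Gamma> = generate G (S \<union> (\<Union>i\<in>\<Lambda>. A i))"
  have RX: "r \<in> words (rel_gens S \<Lambda> H)" if "r \<in> R" for r using that R(2) by (auto simp: free_product_elements_def)
  have Hc: "H i \<subseteq> carrier G" if "i \<in> \<Lambda>" for i using H[OF that] by (rule subgroup.subset)
  have A: "i \<in> \<Lambda> \<and> h \<in> H i" if h: "h \<in> A i" for i h
  proof -
    obtain r b where "r \<in> R" "(Inr (i, h), b) \<in> set r" using h by (auto simp: A_def)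
    then show ?thesis using RX[of r] by (force simp: words_iff)
  qed
  have AH: "A i \<subseteq> H i" "A i \<subseteq> carrier G" if "i \<in> \<Lambda>" for i using A that Hc by blast+
  have RA: "i \<in> \<Lambda>0 \<and> h \<in> A i" if "r \<in> R" "(Inr (i, h), b) \<in> set r" for r i h b
  proof -
    have "h \<in> A i" using that by (auto simp: A_def)
    then show ?thesis using A by (auto simp: \<Lambda>0_def)
  qed
  let ?E = "(\<Union>r\<in>R. fst ` set r)"
  have finE: "finite ?E" using R(1) by auto
  have E: "Inr (i, h) \<in> ?E" if h: "h \<in> A i" for i h
  proof -
    obtain r b where r: "r \<in> R" "(Inr (i, h), b) \<in> set r" using h by (auto simp: A_def)
    show ?thesis using imageI[OF r(2), of fst] r(1) by auto
  qed
  have finA: "finite (A i)" for i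
  proof (rule finite_subset)
    show "A i \<subseteq> (\<lambda>x. snd (projr x)) ` ?E" by (rule subsetI, rule image_eqI[OF _ E]) auto
  qed (use finE in simp)
  have fin\<Lambda>: "finite \<Lambda>0"
  proof (rule finite_subset)
    show "\<Lambda>0 \<subseteq> (\<lambda>x. fst (projr x)) ` ?E"
    proof
      fix i assume "i \<in> \<Lambda>0"
      then obtain h where "h \<in> A i" by (auto simp: \<Lambda>0_def)
      from E[OF this] show "i \<in> (\<lambda>x. fst (projr x)) ` ?E" by (rule image_eqI[rotated]) simp
    qed
  qed (use finE in simp)
  have UA: "(\<Union>i\<in>\<Lambda>0. A i) = (\<Union>i\<in>\<Lambda>. A i)" by (auto simp: \<Lambda>0_def)
  have gens: "S \<union> (\<Union>i\<in>\<Lambda>. A i) \<subseteq> carrier G" using S AH by blast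
  have \<Gamma>: "subgroup \<Gamma> G" unfolding \<Gamma>_def by (rule G.generate_is_subgroup[OF gens])
  have \<Gamma>c: "\<Gamma> \<subseteq> carrier G" by (rule subgroup.subset[OF \<Gamma>])
  let ?G0 = "G\<lparr>carrier := \<Gamma>\<rparr>"
  have \<Lambda>0: "\<Lambda>0 \<subseteq> \<Lambda>" by (auto simp: \<Lambda>0_def)
  have triv: "word_val G gen_val r = \<one>\<^bsub>G\<^esub>" if "r \<in> R" for r
    using relator_trivial(2)[OF pres] that by blast
  have rh0: "relatively_hyperbolic ?G0 \<Lambda>0 core"
    unfolding core_def \<Gamma>_def UA[symmetric]
  proof (rule core_relatively_hyperbolic[where \<Lambda> = \<Lambda> and H = H and S = S and R = R and C = C])
    show "i \<in> \<Lambda>0 \<and> h \<in> A i" if "r \<in> R" "(Inr (i, h), b) \<in> set r" for r i h b by (rule RA[OF that])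
    show "A i \<subseteq> H i" if "i \<in> \<Lambda>0" for i using AH(1) that \<Lambda>0 by blast
  qed (fact G S R \<Lambda>0 | rule H triv fill; assumption)+
  have core: "subgroup (core i) G" "core i \<subseteq> H i" "core i \<subseteq> \<Gamma>" if "i \<in> \<Lambda>" for i
  proof -
    show "subgroup (core i) G" unfolding core_def by (rule G.generate_is_subgroup[OF AH(2)[OF that]])
    show "core i \<subseteq> H i" unfolding core_def by (rule G.generate_subgroup_incl[OF AH(1)[OF that] H[OF that]])
    show "core i \<subseteq> \<Gamma>" unfolding core_def \<Gamma>_def using that by (intro G.mono_generate) blast
  qed
  \<comment> \<open>The hypothesis speaks about groups and index sets of natural numbers.\<close>
  have "finite (S \<union> (\<Union>i\<in>\<Lambda>. A i))" using S(1) fin\<Lambda> finA UA by (metis finite_UN_I finite_UnI)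
  then have "countable \<Gamma>" unfolding \<Gamma>_def by (rule G.countable_generate[OF _ gens])
  define \<iota> where "\<iota> = to_nat_on \<Gamma>"
  define \<kappa> where "\<kappa> = to_nat_on \<Lambda>0"
  have \<iota>: "inj_on \<iota> \<Gamma>" unfolding \<iota>_def by (rule inj_on_to_nat_on[OF \<open>countable \<Gamma>\<close>])
  have \<kappa>: "inj_on \<kappa> \<Lambda>0" unfolding \<kappa>_def by (intro inj_on_to_nat_on countable_finite fin\<Lambda>)
  have \<kappa>': "inv_into \<Lambda>0 \<kappa> (\<kappa> i) = i" if "i \<in> \<Lambda>0" for i using inv_into_f_f[OF \<kappa> that] .
  define G1 where "G1 = image_group \<iota> ?G0"
  have iso: "\<iota> \<in> iso ?G0 G1" unfolding G1_def by (rule inj_imp_image_group_iso) (simp add: \<iota>)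
  interpret G0: group ?G0 by (rule G.subgroup_imp_group[OF \<Gamma>])
  have "group G1" using G0.iso_imp_img_group[OF iso] by (simp add: G1_def image_group_def)
  then interpret \<iota>: group_hom ?G0 G1 \<iota>
    using iso G0.group_axioms by (simp add: group_hom_def group_hom_axioms_def iso_def)
  have carrier1: "carrier G1 = \<iota> ` \<Gamma>" by (simp add: G1_def image_group_def)
  have \<iota>_mult: "\<iota> (g \<otimes>\<^bsub>G\<^esub> h) = \<iota> g \<otimes>\<^bsub>G1\<^esub> \<iota> h" if "g \<in> \<Gamma>" "h \<in> \<Gamma>" for g h
    using \<iota>.hom_mult that by simp
  have \<iota>_eq: "\<iota> g = \<iota> h \<longleftrightarrow> g = h" if "g \<in> \<Gamma>" "h \<in> \<Gamma>" for g h using \<iota> that by (auto dest: inj_onD)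
  have \<iota>_one: "\<iota> \<one>\<^bsub>G\<^esub> = \<one>\<^bsub>G1\<^esub>" using \<iota>.hom_one by simp
  define H1 where "H1 k = \<iota> ` core (inv_into \<Lambda>0 \<kappa> k)" for k
  have H1: "H1 (\<kappa> i) = \<iota> ` core i" if "i \<in> \<Lambda>0" for i by (simp add: H1_def \<kappa>'[OF that])
  have sub1: "subgroup (\<iota> ` M) G1" if "subgroup M G" "M \<subseteq> \<Gamma>" for M
    by (rule \<iota>.subgroup_img_is_subgroup[OF G.subgroup_incl[OF that(1) \<Gamma> that(2)]])
  have rh1: "relatively_hyperbolic G1 (\<kappa> ` \<Lambda>0) H1"
    by (rule relatively_hyperbolic_iso[OF rh0 \<iota>.H.group_axioms iso \<kappa> H1])
  have fg: "finitely_generated_subgroup G1 (H1 k)" if k: "k \<in> \<kappa> ` \<Lambda>0" for k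
  proof -
    obtain i where i: "i \<in> \<Lambda>0" "k = \<kappa> i" using k by auto
    then have i\<Lambda>: "i \<in> \<Lambda>" using \<Lambda>0 by blast
    have "A i \<subseteq> core i" by (auto simp: core_def intro: generate.incl)
    then have Ai: "A i \<subseteq> \<Gamma>" using core(3)[OF i\<Lambda>] by blast
    have "generate G1 (\<iota> ` A i) = \<iota> ` generate ?G0 (A i)" by (rule \<iota>.generate_img) (use Ai in simp)
    also have "\<dots> = \<iota> ` core i" using G.generate_consistent[OF Ai \<Gamma>] by (simp add: core_def)
    finally have "generate G1 (\<iota> ` A i) = H1 k" using H1[OF i(1)] i(2) by simp
    moreover have "\<iota> ` A i \<subseteq> H1 k" using H1[OF i(1)] i(2) \<open>A i \<subseteq> core i\<close> by auto
    ultimately show ?thesis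
      unfolding finitely_generated_subgroup_def by (intro exI[of _ "\<iota> ` A i"]) (simp add: finA)
  qed
  have "filling_property G1 (\<kappa> ` \<Lambda>0) H1"
    by (rule finite_case[OF rh1 _ fg]) (use fin\<Lambda> in simp_all)
  then obtain B1 where B1: "finite B1" "B1 \<subseteq> (\<Union>k\<in>\<kappa> ` \<Lambda>0. H1 k) - {\<one>\<^bsub>G1\<^esub>}"
    and fill1: "\<And>K N. (\<forall>k\<in>\<kappa> ` \<Lambda>0. K k \<lhd> G1\<lparr>carrier := H1 k\<rparr> \<and> K k \<inter> B1 = {}) \<and>
               N = normal_closure G1 (\<Union>k\<in>\<kappa> ` \<Lambda>0. K k) \<Longrightarrow>
           (\<forall>k\<in>\<kappa> ` \<Lambda>0. inj_on (natural_map G1 N) (carrier (subgroup_quotient G1 (H1 k) (K k)))) \<and>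
           relatively_hyperbolic (G1 Mod N) (\<kappa> ` \<Lambda>0)
             (\<lambda>k. natural_map G1 N ` carrier (subgroup_quotient G1 (H1 k) (K k)))"
    unfolding filling_property_def by blast
  \<comment> \<open>A subgroup \<open>K i\<close> that avoids \<open>B\<close> meets \<open>core i\<close> in a subgroup that avoids the finite set for \<open>\<Gamma>\<close>.\<close>
  define B where "B = {g \<in> \<Gamma>. \<iota> g \<in> B1}"
  have finB: "finite B"
  proof (rule inj_on_finite)
    show "inj_on \<iota> B" using \<iota> by (rule inj_on_subset) (auto simp: B_def)
    show "\<iota> ` B \<subseteq> B1" by (auto simp: B_def)
  qed (rule B1(1))
  have Bsub: "B \<subseteq> (\<Union>i\<in>\<Lambda>. H i) - {\<one>\<^bsub>G\<^esub>}"
  proof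
    fix g assume g: "g \<in> B"
    then obtain i h where i: "i \<in> \<Lambda>0" "h \<in> core i" "\<iota> g = \<iota> h"
      using B1(2) H1 by (auto simp: B_def subset_iff image_iff)
    have i\<Lambda>: "i \<in> \<Lambda>" using i \<Lambda>0 by blast
    have "g = h" using \<iota>_eq[of g h] i core(3)[OF i\<Lambda>] g by (auto simp: B_def)
    then have "g \<in> H i" using core(2)[OF i\<Lambda>] i by blast
    moreover have "g \<noteq> \<one>\<^bsub>G\<^esub>" using g B1(2) \<iota>_one by (auto simp: B_def)
    ultimately show "g \<in> (\<Union>i\<in>\<Lambda>. H i) - {\<one>\<^bsub>G\<^esub>}" using i\<Lambda> by blast
  qed
  have "(\<forall>i\<in>\<Lambda>. inj_on (natural_map G N) (carrier (subgroup_quotient G (H i) (K i)))) \<and>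
      relatively_hyperbolic (G Mod N) \<Lambda> (\<lambda>i. natural_map G N ` carrier (subgroup_quotient G (H i) (K i)))"
    if KN: "(\<forall>i\<in>\<Lambda>. K i \<lhd> G\<lparr>carrier := H i\<rparr> \<and> K i \<inter> B = {}) \<and> N = normal_closure G (\<Union>i\<in>\<Lambda>. K i)" for K N
  proof -
    have K: "K i \<lhd> G\<lparr>carrier := H i\<rparr>" "K i \<inter> B = {}" if "i \<in> \<Lambda>" for i using KN that by auto
    have N: "N = normal_closure G (\<Union>i\<in>\<Lambda>. K i)" using KN by simp
    have KH: "K i \<subseteq> H i" if "i \<in> \<Lambda>" for i
      using subgroup.subset[OF normal_imp_subgroup[OF K(1)[OF that]]] by simp
    have Kc: "(\<Union>i\<in>\<Lambda>. K i) \<subseteq> carrier G" using KH Hc by blast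
    note nc = G.normal_closure[OF Kc, folded N]
    define K1 where "K1 k = \<iota> ` (K (inv_into \<Lambda>0 \<kappa> k) \<inter> core (inv_into \<Lambda>0 \<kappa> k))" for k
    have K1: "K1 (\<kappa> i) = \<iota> ` (K i \<inter> core i)" if "i \<in> \<Lambda>0" for i by (simp add: K1_def \<kappa>'[OF that])
    define N1 where "N1 = normal_closure G1 (\<Union>k\<in>\<kappa> ` \<Lambda>0. K1 k)"
    have K1_normal: "K1 (\<kappa> i) \<lhd> G1\<lparr>carrier := H1 (\<kappa> i)\<rparr>" "K1 (\<kappa> i) \<inter> B1 = {}" if i: "i \<in> \<Lambda>0" for i
    proof -
      have i\<Lambda>: "i \<in> \<Lambda>" using i \<Lambda>0 by blast
      have "K i \<inter> core i \<lhd> G\<lparr>carrier := H i \<inter> core i\<rparr>"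
        by (rule G.normal_inter[OF H[OF i\<Lambda>] core(1)[OF i\<Lambda>] K(1)[OF i\<Lambda>]])
      also have "H i \<inter> core i = core i" using core(2)[OF i\<Lambda>] by blast
      finally have n: "K i \<inter> core i \<lhd> G\<lparr>carrier := core i\<rparr>" .
      have gh: "group_hom (G\<lparr>carrier := core i\<rparr>) (G1\<lparr>carrier := \<iota> ` core i\<rparr>) \<iota>"
        using \<iota>_mult core(3)[OF i\<Lambda>] G.subgroup_imp_group[OF core(1)[OF i\<Lambda>]]
          \<iota>.H.subgroup_imp_group[OF sub1[OF core(1)[OF i\<Lambda>] core(3)[OF i\<Lambda>]]]
        by (auto simp: group_hom_def group_hom_axioms_def hom_def)
      show "K1 (\<kappa> i) \<lhd> G1\<lparr>carrier := H1 (\<kappa> i)\<rparr>"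
        unfolding K1[OF i] H1[OF i] by (rule normal.surj_hom_normal_subgroup[OF n gh]) simp
      show "K1 (\<kappa> i) \<inter> B1 = {}"
        using K(2)[OF i\<Lambda>] core(3)[OF i\<Lambda>] unfolding K1[OF i] B_def by blast
    qed
    have f1: "(\<forall>k\<in>\<kappa> ` \<Lambda>0. inj_on (natural_map G1 N1) (carrier (subgroup_quotient G1 (H1 k) (K1 k)))) \<and>
           relatively_hyperbolic (G1 Mod N1) (\<kappa> ` \<Lambda>0)
             (\<lambda>k. natural_map G1 N1 ` carrier (subgroup_quotient G1 (H1 k) (K1 k)))"
      by (rule fill1) (use K1_normal N1_def in auto)
    have K1_sub: "K1 (\<kappa> i) \<subseteq> carrier G1" if "i \<in> \<Lambda>0" for i
      using core(3)[of i] that \<Lambda>0 unfolding K1[OF that] carrier1 by blast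
    have "(\<Union>k\<in>\<kappa> ` \<Lambda>0. K1 k) \<subseteq> carrier G1" using K1_sub by blast
    note nc1 = \<iota>.H.normal_closure[OF this, folded N1_def]
    have N1sub: "subgroup N1 G1" by (rule normal_imp_subgroup[OF nc1(1)])
    interpret q1: group_hom G1 "G1 Mod N1" "\<lambda>g. N1 #>\<^bsub>G1\<^esub> g"
      using normal.factorgroup_is_group[OF nc1(1)] normal.r_coset_hom_Mod[OF nc1(1)] \<iota>.H.group_axioms
      by (simp add: group_hom_def group_hom_axioms_def)
    define \<pi> where "\<pi> g = N1 #>\<^bsub>G1\<^esub> \<iota> g" for g
    have \<pi>_one: "\<pi> g = \<one>\<^bsub>G1 Mod N1\<^esub> \<longleftrightarrow> \<iota> g \<in> N1" if "g \<in> \<Gamma>" for g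
    proof -
      have "\<pi> g = \<one>\<^bsub>G1 Mod N1\<^esub> \<longleftrightarrow> N1 #>\<^bsub>G1\<^esub> \<iota> g = N1 #>\<^bsub>G1\<^esub> \<one>\<^bsub>G1\<^esub>"
        using q1.hom_one by (simp add: \<pi>_def)
      also have "\<dots> \<longleftrightarrow> \<iota> g \<in> N1" using \<iota>.H.rcos_eq_iff[OF N1sub, of "\<iota> g" "\<one>\<^bsub>G1\<^esub>"] that carrier1 by auto
      finally show ?thesis .
    qed
    have P: "natural_map G1 N1 ` carrier (subgroup_quotient G1 (H1 (\<kappa> i)) (K1 (\<kappa> i))) = \<pi> ` core i"
      and nat1: "h \<in> core i \<Longrightarrow> natural_map G1 N1 (K1 (\<kappa> i) #>\<^bsub>G1\<^esub> \<iota> h) = \<pi> h"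
      and car1: "carrier (subgroup_quotient G1 (H1 (\<kappa> i)) (K1 (\<kappa> i))) = (\<lambda>h. K1 (\<kappa> i) #>\<^bsub>G1\<^esub> \<iota> h) ` core i"
      if i: "i \<in> \<Lambda>0" for i h
    proof -
      have i\<Lambda>: "i \<in> \<Lambda>" using i \<Lambda>0 by blast
      have sH: "subgroup (H1 (\<kappa> i)) G1" unfolding H1[OF i] by (rule sub1[OF core(1,3)[OF i\<Lambda>]])
      have sK: "subgroup (K1 (\<kappa> i)) G1"
        by (rule \<iota>.H.incl_subgroup[OF sH normal_imp_subgroup[OF K1_normal(1)[OF i]]])
      have KN1: "K1 (\<kappa> i) \<subseteq> N1" using nc1(2) i by blast
      show nat1: "natural_map G1 N1 (K1 (\<kappa> i) #>\<^bsub>G1\<^esub> \<iota> h) = \<pi> h" if "h \<in> core i" for h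
        unfolding \<pi>_def by (rule natural_map_coset[OF \<iota>.H.group_axioms nc1(1) KN1 sK])
          (use that core(3)[OF i\<Lambda>] carrier1 in blast)
      show car1: "carrier (subgroup_quotient G1 (H1 (\<kappa> i)) (K1 (\<kappa> i))) = (\<lambda>h. K1 (\<kappa> i) #>\<^bsub>G1\<^esub> \<iota> h) ` core i"
        unfolding H1[OF i] by (auto simp: subgroup_quotient_def FactGroup_def RCOSETS_def r_coset_def)
      show "natural_map G1 N1 ` carrier (subgroup_quotient G1 (H1 (\<kappa> i)) (K1 (\<kappa> i))) = \<pi> ` core i"
        unfolding car1 image_image using nat1 by (rule image_cong[OF HOL.refl])
    qed
    have N1_N: "N1 \<subseteq> \<iota> ` (N \<inter> \<Gamma>)"
    proof (rule nc1(3))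
      show "\<iota> ` (N \<inter> \<Gamma>) \<lhd> G1"
        by (rule normal.surj_hom_normal_subgroup[OF G.normal_Int_subgroup[OF \<Gamma> nc(1)] \<iota>.group_hom_axioms])
          (simp add: carrier1)
      show "(\<Union>k\<in>\<kappa> ` \<Lambda>0. K1 k) \<subseteq> \<iota> ` (N \<inter> \<Gamma>)"
      proof (rule UN_least)
        fix k assume "k \<in> \<kappa> ` \<Lambda>0"
        then obtain i where i: "i \<in> \<Lambda>0" "k = \<kappa> i" by auto
        then have i\<Lambda>: "i \<in> \<Lambda>" using \<Lambda>0 by blast
        have "K i \<subseteq> N" using nc(2) i\<Lambda> by blast
        then show "K1 k \<subseteq> \<iota> ` (N \<inter> \<Gamma>)" unfolding i(2) K1[OF i(1)] using core(3)[OF i\<Lambda>] by (intro image_mono) blast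
      qed
    qed
    have rf: "relative_filling G \<Lambda> H K A S R \<Lambda>0 (G1 Mod N1) \<pi> \<kappa>
        (\<lambda>k. natural_map G1 N1 ` carrier (subgroup_quotient G1 (H1 k) (K1 k)))"
    proof (rule relative_filling.intro)
      show "is_presentation G gen_val (rel_gens S \<Lambda> H) (R \<union> peripheral_relators G \<Lambda> H)" by (rule pres)
      show "subgroup (H i) G" "K i \<lhd> G\<lparr>carrier := H i\<rparr>" "A i \<subseteq> H i" if "i \<in> \<Lambda>" for i
        using H K(1) AH(1) that by auto
      show "A i = {}" if "i \<in> \<Lambda>" "i \<notin> \<Lambda>0" for i using that by (simp add: \<Lambda>0_def)
      show "\<Lambda>0 \<subseteq> \<Lambda>" by (rule \<Lambda>0)
      show "R \<subseteq> words (rel_gens S \<Lambda> (\<lambda>i. generate G (A i)))"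
      proof
        fix r assume r: "r \<in> R"
        have "fst l \<in> rel_gens S \<Lambda> (\<lambda>i. generate G (A i))" if l: "l \<in> set r" for l
        proof (cases l rule: letter_cases)
          case (1 s b)
          then show ?thesis using RX[OF r] l by (force simp: words_iff)
        next
          case (2 i h b)
          then have "i \<in> \<Lambda>0" "h \<in> A i" using RA[OF r, of i h b] l by auto
          then show ?thesis using 2 \<Lambda>0 by (auto intro: generate.incl)
        qed
        then show "r \<in> words (rel_gens S \<Lambda> (\<lambda>i. generate G (A i)))" by (auto simp: words_iff)
      qed
      show "group (G1 Mod N1)" by (rule q1.H.group_axioms)
      show "\<pi> \<in> hom (G\<lparr>carrier := generate G (S \<union> \<Union> (A ` \<Lambda>))\<rparr>) (G1 Mod N1)"
        unfolding \<Gamma>_def[symmetric] \<pi>_def using Group.hom_compose[OF \<iota>.homh q1.homh] by (simp add: comp_def)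
      show "\<pi> ` generate G (S \<union> \<Union> (A ` \<Lambda>)) = carrier (G1 Mod N1)"
        unfolding \<Gamma>_def[symmetric] \<pi>_def by (auto simp: FactGroup_def RCOSETS_def carrier1)
      show "g \<in> normal_closure G (\<Union> (K ` \<Lambda>))" if "g \<in> generate G (S \<union> \<Union> (A ` \<Lambda>))" "\<pi> g = \<one>\<^bsub>G1 Mod N1\<^esub>" for g
      proof -
        have g: "g \<in> \<Gamma>" using that(1) by (simp add: \<Gamma>_def)
        then have "\<iota> g \<in> N1" using \<pi>_one that(2) by simp
        then obtain h where h: "h \<in> N" "h \<in> \<Gamma>" "\<iota> g = \<iota> h" using N1_N by blast
        then have "g = h" using \<iota>_eq[OF g h(2)] by simp
        then show ?thesis using h(1) N by simp
      qed
      show "\<pi> h = \<one>\<^bsub>G1 Mod N1\<^esub> \<longleftrightarrow> h \<in> K i" if i: "i \<in> \<Lambda>" and "h \<in> generate G (A i)" for i h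
      proof (cases "i \<in> \<Lambda>0")
        case False
        then have "core i = {\<one>\<^bsub>G\<^esub>}" using i G.generate_empty by (simp add: core_def \<Lambda>0_def)
        then have "h = \<one>\<^bsub>G\<^esub>" using that(2) by (simp add: core_def)
        moreover have "\<one>\<^bsub>G\<^esub> \<in> K i" using subgroup.one_closed[OF normal_imp_subgroup[OF K(1)[OF i]]] by simp
        moreover have "\<one>\<^bsub>G\<^esub> \<in> \<Gamma>" by (rule subgroup.one_closed[OF \<Gamma>])
        ultimately show ?thesis using \<pi>_one[of h] \<iota>_one subgroup.one_closed[OF N1sub] by simp
      next
        case True
        have h: "h \<in> core i" using that(2) by (simp add: core_def)
        then have h\<Gamma>: "h \<in> \<Gamma>" using core(3)[OF i] by blast
        have one: "\<one>\<^bsub>G\<^esub> \<in> core i" by (rule subgroup.one_closed[OF core(1)[OF i]])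
        show ?thesis
        proof
          assume "\<pi> h = \<one>\<^bsub>G1 Mod N1\<^esub>"
          also have "\<dots> = \<pi> \<one>\<^bsub>G\<^esub>" using \<pi>_one[of "\<one>\<^bsub>G\<^esub>"] subgroup.one_closed[OF \<Gamma>] \<iota>_one subgroup.one_closed[OF N1sub] by simp
          finally have "natural_map G1 N1 (K1 (\<kappa> i) #>\<^bsub>G1\<^esub> \<iota> h) = natural_map G1 N1 (K1 (\<kappa> i) #>\<^bsub>G1\<^esub> \<iota> \<one>\<^bsub>G\<^esub>)"
            using nat1[OF True h] nat1[OF True one] by simp
          moreover have "inj_on (natural_map G1 N1) (carrier (subgroup_quotient G1 (H1 (\<kappa> i)) (K1 (\<kappa> i))))"
            using f1 True by blast
          ultimately have eq: "K1 (\<kappa> i) #>\<^bsub>G1\<^esub> \<iota> h = K1 (\<kappa> i) #>\<^bsub>G1\<^esub> \<iota> \<one>\<^bsub>G\<^esub>"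
            using h one unfolding car1[OF True] by (blast dest: inj_onD)
          have sK: "subgroup (K1 (\<kappa> i)) G1"
            by (rule \<iota>.H.incl_subgroup[OF _ normal_imp_subgroup[OF K1_normal(1)[OF True]]])
              (unfold H1[OF True], rule sub1[OF core(1,3)[OF i]])
          have "\<iota> h \<in> K1 (\<kappa> i)"
            using eq \<iota>.H.rcos_eq_iff[OF sK, of "\<iota> h" "\<one>\<^bsub>G1\<^esub>"] h\<Gamma> carrier1 \<iota>_one by auto
          then obtain h' where h': "h' \<in> K i" "h' \<in> core i" "\<iota> h = \<iota> h'" unfolding K1[OF True] by blast
          then have "h = h'" using \<iota>_eq[OF h\<Gamma>, of h'] core(3)[OF i] by blast
          then show "h \<in> K i" using h'(1) by simp
        next
          assume "h \<in> K i"
          then have "\<iota> h \<in> K1 (\<kappa> i)" using h K1[OF True] by blast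
          then have "\<iota> h \<in> N1" using nc1(2) True by blast
          then show "\<pi> h = \<one>\<^bsub>G1 Mod N1\<^esub>" using \<pi>_one[OF h\<Gamma>] by simp
        qed
      qed
      show "inj_on \<kappa> \<Lambda>0" by (rule \<kappa>)
      show "natural_map G1 N1 ` carrier (subgroup_quotient G1 (H1 (\<kappa> i)) (K1 (\<kappa> i))) = \<pi> ` generate G (A i)"
        if "i \<in> \<Lambda>0" for i using P[OF that] by (simp add: core_def)
      show "relatively_hyperbolic (G1 Mod N1) (\<kappa> ` \<Lambda>0)
             (\<lambda>k. natural_map G1 N1 ` carrier (subgroup_quotient G1 (H1 k) (K1 k)))" using f1 by simp
    qed
    show ?thesis
      using relative_filling.natural_map_inj[OF rf] relative_filling.quotient_relatively_hyperbolic[OF rf]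
      unfolding N by blast
  qed
  then show ?thesis
    unfolding filling_property_def using finB Bsub by (intro exI[of _ B]) blast
qed

end
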